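(* Let $\mathcal{T}(n)$ be the Teichmüller space of unit volume flat $n$-tori, identified with $\mathrm{SL}(n,\mathbb{R})/\mathrm{SO}(n)\cong\mathcal{P}_n$. For $\mathcal{T}(2)$, the Thurston metric, the Teichmüller metric, the Weil-Petersson metric, and the hyperbolic metric all coincide. For $\mathcal{T}(n)$ with $n\ge 3$: (1) The Thurston metric $d_{Th}$ is an asymmetric polyhedral Finsler metric which can be computed explicitly, by the formula $$d_{Th}(Y,X)=\tfrac12\max\{\log|\lambda| : \lambda \text{ is an eigenvalue of } XY^{-1}\},\qquad X,Y\in\mathcal{P}_n .$$ (2) The Teichmüller metric is the symmetrization of the Thurston metric by maximum: $d_{Teich}(X,Y)=\max\big(d_{Th}(X,Y),d_{Th}(Y,X)\big)$. (3) The Weil-Petersson metric is equal to the natural Riemannian metric on the symmetric space $\mathrm{SL}(n,\mathbb{R})/\mathrm{SO}(n)$.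
   Context: Let $\mathbb{T}^n=\mathbb{R}^n/\mathbb{Z}^n$. $\mathcal{T}(n)$ is the set of classes $[S,f]$, where $S$ is a flat $n$-torus of volume 1 and $f:S\to\mathbb{T}^n$ is an orientation-preserving homeomorphism; $[S,f]=[S',f']$ iff there is an isometry $h:S\to S'$ with $f'\circ h$ homotopic to $f$. Writing $S=\mathbb{R}^n/\Lambda$ and lifting $f$ to $\tilde f:\mathbb{R}^n\to\mathbb{R}^n$, the vectors $\zeta_i=\tilde f^{-1}(e_i)$ form an ordered basis of $\Lambda$; taking them as the columns of a matrix $g\in\mathrm{SL}(n,\mathbb{R})$ identifies $\mathcal{T}(n)$ with $\mathrm{SL}(n,\mathbb{R})/\mathrm{SO}(n)$. $\mathcal{P}_n$ is the space of real symmetric positive-definite $n\times n$ matrices of determinant 1, with $\mathrm{SL}(n,\mathbb{R})$ acting by $g\cdot X=gXg^T$, identified with $\mathrm{SL}(n,\mathbb{R})/\mathrm{SO}(n)$ by $g\,\mathrm{SO}(n)\mapsto gg^T$. For $n=2$, $\mathcal{T}(2)\cong\mathrm{SL}(2,\mathbb{R})/\mathrm{SO}(2)\cong\mathbb{H}^2$, with $\tau\in\mathbb{H}^2$ corresponding to the torus $\mathbb{C}/(\mathbb{Z}+\tau\mathbb{Z})$ (up to rescaling), and the hyperbolic metric is that of $\mathbb{H}^2$. Thurston metric: $d_{Th}([S,f],[S',f'])=\frac12\log\inf_\phi \mathcal{L}(\phi)$, where $\phi$ ranges over Lipschitz homeomorphisms $S\to S'$ homotopic to $f'^{-1}\circ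 f$ and $\mathcal{L}(\phi)=\sup_{x\ne y} d_{S'}(\phi(x),\phi(y))/d_S(x,y)$. Teichmüller metric: $d_{Teich}([S,f],[S',f'])=\frac1{2n}\log\inf_\phi K(\phi)$, where $\phi$ ranges over quasiconformal maps homotopic to $f'^{-1}\circ f$. Here $K$ is the maximal dilatation: for a diffeomorphism $\phi$, with $L(T)=\max_{|x|=1}|Tx|$ and $\ell(T)=\min_{|x|=1}|Tx|$ for linear $T$, one sets $K_I(\phi)=\sup_x |J_\phi(x)|/\ell(\phi'(x))^n$, $K_O(\phi)=\sup_x L(\phi'(x))^n/|J_\phi(x)|$, $K(\phi)=\max(K_I(\phi),K_O(\phi))$, with $J_\phi$ the Jacobian (computed in lifts to $\mathbb{R}^n$). Weil-Petersson metric: points of $\mathcal{T}(n)$ are unit volume flat metrics $g$ on $\mathbb{T}^n$. On smooth symmetric $(0,2)$-tensors (tangent vectors to the space of Riemannian metrics) there is the $L^2$-pairing $\langle\langle h_1,h_2\rangle\rangle_{L^2(g)}=\int_{\mathbb{T}^n}\mathrm{Tr}(g^{-1}h_1g^{-1}h_2)\,d\mu_g$, with $d\mu_g$ the volume form of $g$. The Weil-Petersson metric is its restriction to the trace-free, divergence-free tensors tangent to $\mathcal{T}(n)$ (tensors constant in $\mathbb{R}^n$-coordinates). The natural Riemannian metric on $\mathrm{SL}(n,\mathbb{R})/\mathrm{SO}(n)$ is the $\mathrm{SL}(n,\mathbb{R})$-invariant metric equal to $\langle A,B\rangle=\mathrm{Tr}(AB)$ on the tangent space at the basepoint (the traceless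 symmetric matrices). A Finsler metric on a manifold $M$ is a continuous function $F:TM\to[0,\infty)$ whose restriction to each $T_pM$ is positive-definite, subadditive and linear under scaling by positive scalars. A polyhedral Finsler metric on a symmetric space is a Finsler metric such that for each tangent space the induced unit ball is a polytope.
   Formalization: Formula (1) has 1/4 for 1/2; for n=2, d_Th = d_Teich = 1/4 hyperbolic and WP = sqrt 2 hyperbolic distance, not equality; "polyhedral" means polytope unit balls in tangent spaces of maximal flats; T(n) is identified with P_n by the Gram matrix g^T g of the lattice basis. *)

theory Defs
  imports "HOL-Analysis.Analysis" "HOL-Homology.Homology"
begin

section \<open>Flat tori of unit volume and the Teichmueller space\<close>

definition int_vectors :: "(real^'n) set" where
  "int_vectors = {z. \<forall>i. z $ i \<in> \<int>}"

definition lattice_of :: "real^'n^'n \<Rightarrow> (real^'n) set" where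
  "lattice_of M = (\<lambda>z. M *v z) ` int_vectors"

definition unit_lattices :: "(real^'n) set set" where
  "unit_lattices = {lattice_of M |M. \<bar>det M\<bar> = 1}"

text \<open>The torus \<open>\<real>\<^sup>n/\<Lambda>\<close> is the set of cosets of \<open>\<Lambda>\<close>; the flat distance of two points is the
  distance of the two cosets as subsets of \<open>\<real>\<^sup>n\<close>.\<close>

definition flat_torus :: "(real^'n) set \<Rightarrow> (real^'n) set metric" where
  "flat_torus \<Lambda> = metric (range (\<lambda>x. (+) x ` \<Lambda>), setdist)"

abbreviation torus_top :: "(real^'n) set \<Rightarrow> (real^'n) set topology" where
  "torus_top \<Lambda> \<equiv> mtopology_of (flat_torus \<Lambda>)"

definition is_lift ::
  "(real^'n) set \<Rightarrow> (real^'n) set \<Rightarrow> (real^'n \<Rightarrow> real^'n) \<Rightarrow> ((real^'n) set \<Rightarrow> (real^'n) set) \<Rightarrow> bool" where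
  "is_lift \<Lambda> \<Lambda>' F \<phi> \<longleftrightarrow>
     continuous_on UNIV F \<and> (\<forall>x. (+) (F x) ` \<Lambda>' = \<phi> ((+) x ` \<Lambda>))"

text \<open>A homeomorphism \<open>F\<close> of \<open>\<real>\<^sup>n\<close> preserves orientation if it has local degree \<open>1\<close>: it carries the
  local orientation at \<open>0\<close>, an element of \<open>H\<^sub>n(\<real>\<^sup>n, \<real>\<^sup>n - 0)\<close>, to the one at \<open>F 0\<close>, where local
  orientations at different points are compared by translation.\<close>

definition orientation_preserving :: "(real^'n \<Rightarrow> real^'n) \<Rightarrow> bool" where
  "orientation_preserving F \<longleftrightarrow>
     (\<forall>c \<in> carrier (relative_homology_group (int CARD('n)) (euclidean :: (real^'n) topology) (- {0})).
        hom_induced (int CARD('n)) euclidean (- {0}) euclidean (- {0}) (\<lambda>x. F x - F 0) c = c)"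

type_synonym 'n marked_torus = "(real^'n) set \<times> ((real^'n) set \<Rightarrow> (real^'n) set)"

definition marked_tori :: "'n::finite marked_torus set" where
  "marked_tori = {(\<Lambda>, f). \<Lambda> \<in> unit_lattices \<and>
     homeomorphic_map (torus_top \<Lambda>) (torus_top int_vectors) f \<and>
     (\<exists>F. is_lift \<Lambda> int_vectors F f \<and> orientation_preserving F)}"

definition torus_isometry ::
  "(real^'n) set \<Rightarrow> (real^'n) set \<Rightarrow> ((real^'n) set \<Rightarrow> (real^'n) set) \<Rightarrow> bool" where
  "torus_isometry \<Lambda> \<Lambda>' h \<longleftrightarrow>
     bij_betw h (mspace (flat_torus \<Lambda>)) (mspace (flat_torus \<Lambda>')) \<and>
     (\<forall>x \<in> mspace (flat_torus \<Lambda>). \<forall>y \<in> mspace (flat_torus \<Lambda>).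
        mdist (flat_torus \<Lambda>') (h x) (h y) = mdist (flat_torus \<Lambda>) x y)"

definition marking_equiv :: "('n::finite marked_torus \<times> 'n marked_torus) set" where
  "marking_equiv = {((\<Lambda>, f), (\<Lambda>', f')). (\<Lambda>, f) \<in> marked_tori \<and> (\<Lambda>', f') \<in> marked_tori \<and>
     (\<exists>h. torus_isometry \<Lambda> \<Lambda>' h \<and>
          homotopic_with (\<lambda>_. True) (torus_top \<Lambda>) (torus_top int_vectors) (f' \<circ> h) f)}"

definition teich :: "'n::finite marked_torus set set" where
  "teich = marked_tori // marking_equiv"

text \<open>Value on a pair of classes of a function of representatives; meaningful when the value does
  not depend on the representatives.\<close>

definition on_classes :: "('a \<Rightarrow> 'a \<Rightarrow> 'b) \<Rightarrow> 'a set \<Rightarrow> 'a set \<Rightarrow> 'b" where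
  "on_classes d A B = the_elem ((\<lambda>(p, q). d p q) ` (A \<times> B))"


section \<open>The symmetric space of positive definite matrices of determinant 1\<close>

definition spd_space :: "(real^'n^'n) set" where
  "spd_space = {X. transpose X = X \<and> (\<forall>v. v \<noteq> 0 \<longrightarrow> 0 < v \<bullet> (X *v v)) \<and> det X = 1}"

text \<open>The tangent space at \<open>X\<close> of the hypersurface \<open>det = 1\<close> in the space of symmetric matrices.\<close>

definition spd_tangent :: "real^'n^'n \<Rightarrow> (real^'n^'n) set" where
  "spd_tangent X = {A. transpose A = A \<and> trace (matrix_inv X ** A) = 0}"

text \<open>The columns of the period matrix are the lattice basis \<open>\<zeta>\<^sub>i\<close> corresponding to \<open>e\<^sub>i\<close>.  A lift of
  the marking need not fix \<open>0\<close>, hence the summand \<open>F 0\<close>.  The class of a marked torus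
  determines this matrix only up to rotation of \<open>\<real>\<^sup>n\<close>, which acts on it from the left; so the
  invariant point of \<open>spd_space\<close> is the Gram matrix of the basis (the matrix \<open>g g\<^sup>T\<close> for \<open>g\<close> the
  matrix with rows \<open>\<zeta>\<^sub>i\<close>).  It is also the flat metric of the torus carried to \<open>\<real>\<^sup>n/\<int>\<^sup>n\<close> by the
  affine representative of the marking.\<close>

definition period_matrix :: "'n::finite marked_torus \<Rightarrow> real^'n^'n" where
  "period_matrix = (\<lambda>(\<Lambda>, f). THE g. \<exists>F. is_lift \<Lambda> int_vectors F f \<and>
     (\<forall>i. F (column i g) = F 0 + axis i 1))"

definition gram :: "'n::finite marked_torus \<Rightarrow> real^'n^'n" where
  "gram p = transpose (period_matrix p) ** period_matrix p"

definition teich_to_spd :: "'n::finite marked_torus set \<Rightarrow> real^'n^'n" where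
  "teich_to_spd C = the_elem (gram ` C)"

definition on_spd ::
  "('n::finite marked_torus set \<Rightarrow> 'n marked_torus set \<Rightarrow> real) \<Rightarrow> real^'n^'n \<Rightarrow> real^'n^'n \<Rightarrow> real" where
  "on_spd d X Y = d (inv_into teich teich_to_spd X) (inv_into teich teich_to_spd Y)"


section \<open>The Thurston metric\<close>

definition lipschitz_const ::
  "(real^'n) set \<Rightarrow> (real^'n) set \<Rightarrow> ((real^'n) set \<Rightarrow> (real^'n) set) \<Rightarrow> real" where
  "lipschitz_const \<Lambda> \<Lambda>' \<phi> =
     Sup {mdist (flat_torus \<Lambda>') (\<phi> x) (\<phi> y) / mdist (flat_torus \<Lambda>) x y |x y.
       x \<in> mspace (flat_torus \<Lambda>) \<and> y \<in> mspace (flat_torus \<Lambda>) \<and> x \<noteq> y}"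

definition marked_homeo ::
  "'n::finite marked_torus \<Rightarrow> 'n marked_torus \<Rightarrow> ((real^'n) set \<Rightarrow> (real^'n) set) \<Rightarrow> bool" where
  "marked_homeo = (\<lambda>(\<Lambda>, f) (\<Lambda>', f') \<phi>.
     homeomorphic_map (torus_top \<Lambda>) (torus_top \<Lambda>') \<phi> \<and>
     homotopic_with (\<lambda>_. True) (torus_top \<Lambda>) (torus_top \<Lambda>')
       \<phi> (inv_into (mspace (flat_torus \<Lambda>')) f' \<circ> f))"

definition thurston_marked :: "'n::finite marked_torus \<Rightarrow> 'n marked_torus \<Rightarrow> real" where
  "thurston_marked p q = 1/2 * ln (Inf {lipschitz_const (fst p) (fst q) \<phi> |\<phi>.
     marked_homeo p q \<phi> \<and> Lipschitz_continuous_map (flat_torus (fst p)) (flat_torus (fst q)) \<phi>})"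

definition thurston :: "'n::finite marked_torus set \<Rightarrow> 'n marked_torus set \<Rightarrow> real" where
  "thurston = on_classes thurston_marked"


section \<open>The Teichmueller metric\<close>

definition max_stretch :: "('a::real_normed_vector \<Rightarrow> 'b::real_normed_vector) \<Rightarrow> real" where
  "max_stretch T = (SUP x \<in> sphere 0 1. norm (T x))"

definition min_stretch :: "('a::real_normed_vector \<Rightarrow> 'b::real_normed_vector) \<Rightarrow> real" where
  "min_stretch T = (INF x \<in> sphere 0 1. norm (T x))"

abbreviation dif :: "(real^'n \<Rightarrow> real^'n) \<Rightarrow> real^'n \<Rightarrow> real^'n \<Rightarrow> real^'n" where
  "dif F x \<equiv> frechet_derivative F (at x)"

definition jacobian :: "(real^'n \<Rightarrow> real^'n) \<Rightarrow> real^'n \<Rightarrow> real" where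
  "jacobian F x = det (matrix (dif F x))"

text \<open>The dilatations are the essential suprema of \<open>\<bar>J\<bar> / l\<^sup>n\<close> and \<open>L\<^sup>n / \<bar>J\<bar>\<close>, written without
  division; for a diffeomorphism of tori these are the suprema over all points, by continuity.\<close>

definition inner_dilatation :: "(real^'n \<Rightarrow> real^'n) \<Rightarrow> real" where
  "inner_dilatation F =
     Inf {K. AE x in lebesgue. \<bar>jacobian F x\<bar> \<le> K * min_stretch (dif F x) ^ CARD('n)}"

definition outer_dilatation :: "(real^'n \<Rightarrow> real^'n) \<Rightarrow> real" where
  "outer_dilatation F =
     Inf {K. AE x in lebesgue. max_stretch (dif F x) ^ CARD('n) \<le> K * \<bar>jacobian F x\<bar>}"

definition max_dilatation :: "(real^'n \<Rightarrow> real^'n) \<Rightarrow> real" where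
  "max_dilatation F = max (inner_dilatation F) (outer_dilatation F)"

definition absolutely_continuous_on_interval ::
  "real \<Rightarrow> real \<Rightarrow> (real \<Rightarrow> 'a::real_normed_vector) \<Rightarrow> bool" where
  "absolutely_continuous_on_interval a b u \<longleftrightarrow>
     (\<forall>e>0. \<exists>d>0. \<forall>D. finite D \<and> (\<forall>(s, t) \<in> D. a \<le> s \<and> s \<le> t \<and> t \<le> b) \<and>
        pairwise (\<lambda>(s, t) (s', t'). disjnt {s<..<t} {s'<..<t'}) D \<and>
        (\<Sum>(s, t) \<in> D. t - s) < d \<longrightarrow> (\<Sum>(s, t) \<in> D. norm (u t - u s)) < e)"

text \<open>Absolute continuity on almost all lines parallel to the axes.  The exceptional set below is a
  union of lines in direction \<open>e\<^sub>i\<close>, so that it is null iff it meets \<open>e\<^sub>i\<^sup>\<bottom>\<close> in an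
  \<open>(n-1)\<close>-dimensional null set.\<close>

definition ACL :: "(real^'n \<Rightarrow> real^'n) \<Rightarrow> bool" where
  "ACL F \<longleftrightarrow> (\<forall>i. AE x in lebesgue. \<forall>a b.
     absolutely_continuous_on_interval a b (\<lambda>t. F (x + t *\<^sub>R axis i 1)))"

text \<open>The analytic definition of quasiconformality of a homeomorphism of \<open>\<real>\<^sup>n\<close>.  The inverse of a
  quasiconformal map is quasiconformal, so imposing the condition on the inverse as well
  describes the same class of maps.\<close>

definition analytically_qc :: "(real^'n \<Rightarrow> real^'n) \<Rightarrow> bool" where
  "analytically_qc F \<longleftrightarrow> ACL F \<and> (AE x in lebesgue. F differentiable (at x)) \<and>
     (\<exists>K. AE x in lebesgue. max_stretch (dif F x) ^ CARD('n) \<le> K * \<bar>jacobian F x\<bar> \<and>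
                            \<bar>jacobian F x\<bar> \<le> K * min_stretch (dif F x) ^ CARD('n))"

definition quasiconformal :: "(real^'n \<Rightarrow> real^'n) \<Rightarrow> bool" where
  "quasiconformal F \<longleftrightarrow> homeomorphism UNIV UNIV F (inv_into UNIV F) \<and>
     analytically_qc F \<and> analytically_qc (inv_into UNIV F)"

definition teichmueller_marked :: "'n::finite marked_torus \<Rightarrow> 'n marked_torus \<Rightarrow> real" where
  "teichmueller_marked p q = 1 / (2 * real CARD('n)) * ln (Inf {max_dilatation F |F \<phi>.
     marked_homeo p q \<phi> \<and> is_lift (fst p) (fst q) F \<phi> \<and> quasiconformal F})"

definition teichmueller :: "'n::finite marked_torus set \<Rightarrow> 'n marked_torus set \<Rightarrow> real" where
  "teichmueller = on_classes teichmueller_marked"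


section \<open>Asymmetric metrics, Finsler metrics and path-length distances\<close>

definition asymmetric_metric :: "'a set \<Rightarrow> ('a \<Rightarrow> 'a \<Rightarrow> real) \<Rightarrow> bool" where
  "asymmetric_metric M d \<longleftrightarrow>
     (\<forall>x\<in>M. \<forall>y\<in>M. 0 \<le> d x y \<and> (d x y = 0 \<longleftrightarrow> x = y)) \<and>
     (\<forall>x\<in>M. \<forall>y\<in>M. \<forall>z\<in>M. d x z \<le> d x y + d y z) \<and>
     (\<exists>x\<in>M. \<exists>y\<in>M. d x y \<noteq> d y x)"

definition path_dist ::
  "'a::real_normed_vector set \<Rightarrow> ('a \<Rightarrow> 'a \<Rightarrow> real) \<Rightarrow> 'a \<Rightarrow> 'a \<Rightarrow> real" where
  "path_dist M F x y =
     Inf {integral {0..1} (\<lambda>t. F (\<gamma> t) (vector_derivative \<gamma> (at t))) |\<gamma>.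
       \<gamma> C1_differentiable_on {0..1} \<and> \<gamma> ` {0..1} \<subseteq> M \<and> \<gamma> 0 = x \<and> \<gamma> 1 = y}"

definition finsler_metric ::
  "'a::real_normed_vector set \<Rightarrow> ('a \<Rightarrow> 'a set) \<Rightarrow> ('a \<Rightarrow> 'a \<Rightarrow> real) \<Rightarrow> bool" where
  "finsler_metric M T F \<longleftrightarrow>
     continuous_on (Sigma M T) (\<lambda>(x, v). F x v) \<and>
     (\<forall>x\<in>M. (\<forall>v \<in> T x. 0 \<le> F x v \<and> (F x v = 0 \<longleftrightarrow> v = 0)) \<and>
             (\<forall>v \<in> T x. \<forall>w \<in> T x. F x (v + w) \<le> F x v + F x w) \<and>
             (\<forall>v \<in> T x. \<forall>c \<ge> 0. F x (c *\<^sub>R v) = c * F x v))"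

text \<open>The maximal flats of the symmetric space are the sets of all \<open>g D g\<^sup>T\<close> with \<open>D\<close> positive
  diagonal of determinant \<open>1\<close>, where \<open>g \<in> SL(n,\<real>)\<close> is fixed; this is the tangent space of such a
  flat at its point \<open>g g\<^sup>T\<close>.  Every maximal flat through \<open>X\<close> arises from some \<open>g\<close> with
  \<open>g g\<^sup>T = X\<close>.\<close>

definition flat_tangent :: "real^'n^'n \<Rightarrow> (real^'n^'n) set" where
  "flat_tangent g = {g ** D ** transpose g |D. (\<forall>i j. i \<noteq> j \<longrightarrow> D $ i $ j = 0) \<and> trace D = 0}"

text \<open>As usual for symmetric spaces, a Finsler metric is called polyhedral if its unit balls in the
  tangent spaces of the maximal flats are polytopes.  The unit ball of an invariant Finsler metric
  in a full tangent space is never a polytope, being invariant under a conjugate of \<open>SO(n)\<close>.\<close>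

definition polyhedral_finsler_metric :: "(real^'n^'n \<Rightarrow> real^'n^'n \<Rightarrow> real) \<Rightarrow> bool" where
  "polyhedral_finsler_metric F \<longleftrightarrow> finsler_metric spd_space spd_tangent F \<and>
     (\<forall>g. det g = 1 \<longrightarrow> polytope {A \<in> flat_tangent g. F (g ** transpose g) A \<le> 1})"

definition complex_eigenvalue :: "real^'n^'n \<Rightarrow> complex \<Rightarrow> bool" where
  "complex_eigenvalue A l \<longleftrightarrow> (\<exists>v. v \<noteq> 0 \<and> map_matrix complex_of_real A *v v = l *s v)"


section \<open>The Weil--Petersson metric and the natural Riemannian metric\<close>

text \<open>Tensors on \<open>\<real>\<^sup>n/\<int>\<^sup>n\<close> are given by their matrices in the coordinates of \<open>\<real>\<^sup>n\<close>.\<close>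

definition l2_pairing ::
  "(real^'n \<Rightarrow> real^'n^'n) \<Rightarrow> (real^'n \<Rightarrow> real^'n^'n) \<Rightarrow> (real^'n \<Rightarrow> real^'n^'n) \<Rightarrow> real" where
  "l2_pairing g h1 h2 = integral (cbox 0 1)
     (\<lambda>x. trace (matrix_inv (g x) ** h1 x ** matrix_inv (g x) ** h2 x) * sqrt (det (g x)))"

text \<open>Points of the Teichmueller space are constant metrics \<open>X\<close> and tangent vectors are the constant,
  trace-free (hence in \<open>spd_tangent X\<close>) and automatically divergence-free tensors.\<close>

definition weil_petersson :: "real^'n^'n \<Rightarrow> real^'n^'n \<Rightarrow> real^'n^'n \<Rightarrow> real" where
  "weil_petersson X A B = l2_pairing (\<lambda>_. X) (\<lambda>_. A) (\<lambda>_. B)"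

definition weil_petersson_dist :: "'n::finite marked_torus set \<Rightarrow> 'n marked_torus set \<Rightarrow> real" where
  "weil_petersson_dist C C' =
     path_dist spd_space (\<lambda>X A. sqrt (weil_petersson X A A)) (teich_to_spd C) (teich_to_spd C')"

text \<open>By transitivity of the action these two conditions determine \<open>m\<close> on all tangent spaces.\<close>

definition natural_riemannian_metric ::
  "(real^'n^'n \<Rightarrow> real^'n^'n \<Rightarrow> real^'n^'n \<Rightarrow> real) \<Rightarrow> bool" where
  "natural_riemannian_metric m \<longleftrightarrow>
     (\<forall>A \<in> spd_tangent (mat 1). \<forall>B \<in> spd_tangent (mat 1). m (mat 1) A B = trace (A ** B)) \<and>
     (\<forall>g. det g = 1 \<longrightarrow> (\<forall>X \<in> spd_space. \<forall>A \<in> spd_tangent X. \<forall>B \<in> spd_tangent X.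
        m (g ** X ** transpose g) (g ** A ** transpose g) (g ** B ** transpose g) = m X A B))"


section \<open>Flat 2-tori and the hyperbolic plane\<close>

definition upper_half_plane :: "complex set" where
  "upper_half_plane = {z. 0 < Im z}"

definition hyperbolic_dist :: "complex \<Rightarrow> complex \<Rightarrow> real" where
  "hyperbolic_dist = path_dist upper_half_plane (\<lambda>z v. cmod v / Im z)"

text \<open>The columns are \<open>1\<close> and \<open>\<tau>\<close>, rescaled to span unit area.\<close>

definition tau_matrix :: "complex \<Rightarrow> real^2^2" where
  "tau_matrix \<tau> = (1 / sqrt (Im \<tau>)) *\<^sub>R vector [vector [1, Re \<tau>], vector [0, Im \<tau>]]"

text \<open>The marking is induced by the linear map sending \<open>1, \<tau>\<close> (rescaled) to \<open>e\<^sub>1, e\<^sub>2\<close>; it maps a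
  coset to its image under this map.\<close>

definition tau_class :: "complex \<Rightarrow> 2 marked_torus set" where
  "tau_class \<tau> = marking_equiv ``
     {(lattice_of (tau_matrix \<tau>), \<lambda>C. (\<lambda>x. matrix_inv (tau_matrix \<tau>) *v x) ` C)}"

end

theory Submission
  imports Defs
begin

text \<open>Continuous maps of flat tori lift to \<open>\<real>\<^sup>n\<close>, and a lift \<open>F\<close> satisfies \<open>F (x + l) = F x + A l\<close> for a
  matrix \<open>A\<close> carrying one lattice to the other; the homotopy class of the map amounts to \<open>A\<close>, and \<open>F\<close>
  stays at bounded distance from \<open>A\<close>.  Hence the class of a marked torus amounts to the Gram matrix of
  its marked basis.  Every quantity is governed by the largest Rayleigh quotient
  \<open>r(X, A) = max (u \<bullet> A u) / (u \<bullet> X u)\<close>.  Comparing \<open>F\<close> and \<open>A\<close> on long vectors shows that the linear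
  map is the best Lipschitz map in its class, so that the Thurston distance from \<open>X\<close> to \<open>Y\<close> is
  \<open>1/4 ln r(X, Y)\<close>; simultaneous diagonalization of \<open>X\<close> and \<open>Y\<close> turns this into the eigenvalue formula.
  For a quasiconformal \<open>F\<close>, averaging over large cubes bounds the dilatations from below by those of
  \<open>A\<close>.  Differentiating \<open>ln (u \<bullet> \<gamma> u)\<close> along a path \<open>\<gamma>\<close> shows that \<open>1/4 r(X, A)\<close> is a Finsler metric
  for the Thurston distance, with the geodesics \<open>g exp(t D) g\<^sup>T\<close>; for \<open>n = 2\<close> it is \<open>1/4\<close> of the
  hyperbolic metric in the coordinate \<open>\<tau>\<close>.\<close>

section \<open>Positive definite matrices and Rayleigh quotients\<close>

text \<open>Origin of the constants: a Gram matrix measures squared lengths, so the best Lipschitz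
  constant is the square root of \<open>rayleigh\<close>, and the factor 1/2 of the Thurston metric
  becomes 1/4. The dilatations are n-th powers of that square root, so the factor 1/(2n) of the
  Teichmueller metric becomes 1/4 as well. In the plane, a tangent vector \<open>A\<close> of
  hyperbolic length s at \<open>X\<close> gives a traceless 2x2 matrix
  \<open>matrix_inv X ** A\<close> with eigenvalues s and -s; its largest eigenvalue gives the
  Finsler norm s/4, and the trace of its square gives the Weil-Petersson norm sqrt 2 * s. A
  traceless spectrum need not be symmetric about 0 once there are three eigenvalues, which is where
  the asymmetry for n >= 3 comes from. The main obstacle is that a quasiconformal map is
  differentiable only almost everywhere, so its derivative can be compared with the linear map only
  in the mean. The averaging argument controls the outer dilatation; the inner dilatation is reached
  by applying the same argument to the inverse map.\<close>

text \<open>First-order condition at a maximum: for small t the linear term dominates the quadratic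
  one, whatever the sign of \<open>b\<close>.\<close>

lemma quadratic_nonpos_imp_zero:
  fixes a b :: real
  assumes "\<And>t. 2 * t * a + t\<^sup>2 * b \<le> 0"
  shows "a = 0"
proof (rule ccontr)
  assume "a \<noteq> 0"
  \<comment> \<open>At t = a/s the linear term is 2 a^2/s, while the quadratic term is at least
    -a^2/s because b >= -s.\<close>
  define s where "s = \<bar>b\<bar> + 1"
  have s: "s > 0" "b \<ge> - s" by (auto simp: s_def)
  have "2 * (a / s) * a + (a / s)\<^sup>2 * b \<le> 0" by (rule assms)
  moreover have "(a / s)\<^sup>2 * b \<ge> (a / s)\<^sup>2 * (- s)" using s by (intro mult_left_mono) auto
  moreover have "(a / s)\<^sup>2 * (- s) = - (a\<^sup>2 / s)" using s by (simp add: power2_eq_square field_simps)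
  moreover have "2 * (a / s) * a = 2 * (a\<^sup>2 / s)" by (simp add: power2_eq_square)
  moreover have "a\<^sup>2 / s > 0" using s \<open>a \<noteq> 0\<close> by simp
  ultimately show False by linarith
qed

lemma inner_symmetric_matrix:
  fixes S :: "real^'n^'n"
  assumes "transpose S = S"
  shows "x \<bullet> (S *v y) = (S *v x) \<bullet> y"
  by (metis assms dot_lmul_matrix vector_transpose_matrix)

text \<open>A maximizer of the quadratic form on the unit sphere of \<open>V\<close> works. Its
  first variation vanishes in every direction of \<open>V\<close>, and the residual
  \<open>S *v v - l *\<^sub>R v\<close> lies in \<open>V\<close> by invariance, so it is orthogonal
  to itself.\<close>

lemma symmetric_eigenvector_in_subspace:
  fixes S :: "real^'n^'n"
  assumes sym: "transpose S = S" and V: "subspace V" and inv: "\<And>x. x \<in> V \<Longrightarrow> S *v x \<in> V"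
    and w: "w \<in> V" "w \<noteq> 0"
  obtains v l where "v \<in> V" "norm v = 1" "S *v v = l *\<^sub>R v"
proof -
  let ?K = "sphere 0 1 \<inter> V"
  have K: "compact ?K" by (simp add: V closed_subspace compact_Int_closed)
  have "(1 / norm w) *\<^sub>R w \<in> ?K" using w V by (simp add: subspace_scale)
  then have ne: "?K \<noteq> {}" by blast
  have "continuous_on ?K (\<lambda>x. x \<bullet> (S *v x))"
    by (intro continuous_intros)
  then obtain v where v: "v \<in> ?K" and max: "\<And>x. x \<in> ?K \<Longrightarrow> x \<bullet> (S *v x) \<le> v \<bullet> (S *v v)"
    using continuous_attains_sup[OF K ne] by blast
  define l where "l = v \<bullet> (S *v v)"
  have nv: "norm v = 1" "v \<in> V" using v by auto
  have vv: "v \<bullet> v = 1" using nv by (simp add: norm_eq_1)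
  have le: "x \<bullet> (S *v x) \<le> l * (x \<bullet> x)" if "x \<in> V" for x
  proof (cases "x = 0")
    case False
    have "(1 / norm x) *\<^sub>R x \<in> ?K" using False that V by (simp add: subspace_scale)
    from max[OF this] have "(x \<bullet> (S *v x)) / (norm x)\<^sup>2 \<le> l"
      by (simp add: l_def matrix_vector_mult_scaleR power2_eq_square)
    then show ?thesis using False by (simp add: divide_le_eq power2_norm_eq_inner)
  qed simp
  have ortho: "u \<bullet> (S *v v - l *\<^sub>R v) = 0" if "u \<in> V" for u
  proof (rule quadratic_nonpos_imp_zero)
    fix t :: real
    have "v + t *\<^sub>R u \<in> V" using nv(2) that V by (simp add: subspace_add subspace_scale)
    from le[OF this] have *: "(v + t *\<^sub>R u) \<bullet> (S *v (v + t *\<^sub>R u)) \<le> l * ((v + t *\<^sub>R u) \<bullet> (v + t *\<^sub>R u))" .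
    have "v \<bullet> (S *v u) = u \<bullet> (S *v v)" by (metis inner_commute inner_symmetric_matrix sym)
    then have 1: "(v + t *\<^sub>R u) \<bullet> (S *v (v + t *\<^sub>R u)) = l + 2 * t * (u \<bullet> (S *v v)) + t\<^sup>2 * (u \<bullet> (S *v u))"
      by (simp add: matrix_vector_right_distrib matrix_vector_mult_scaleR inner_add_left inner_add_right
          l_def power2_eq_square algebra_simps)
    have 2: "l * ((v + t *\<^sub>R u) \<bullet> (v + t *\<^sub>R u)) = l + 2 * t * (l * (u \<bullet> v)) + t\<^sup>2 * (l * (u \<bullet> u))"
      using vv by (simp add: inner_add_left inner_add_right power2_eq_square algebra_simps inner_commute)
    from * show "2 * t * (u \<bullet> (S *v v - l *\<^sub>R v)) + t\<^sup>2 * (u \<bullet> (S *v u) - l * (u \<bullet> u)) \<le> 0"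
      unfolding 1 2 by (simp add: inner_diff_right algebra_simps)
  qed
  have "S *v v - l *\<^sub>R v \<in> V" using inv nv(2) V by (simp add: subspace_diff subspace_scale)
  from ortho[OF this] have "S *v v = l *\<^sub>R v" by simp
  with that nv show ?thesis by blast
qed

text \<open>Induction on the number of vectors: by symmetry of \<open>S\<close>, the orthogonal
  complement of the eigenvectors already found is invariant, and it is nonzero as long as k is below
  the dimension.\<close>

lemma symmetric_orthonormal_eigenvectors:
  fixes S :: "real^'n^'n"
  assumes sym: "transpose S = S" and "k \<le> CARD('n)"
  shows "\<exists>B. finite B \<and> card B = k \<and> pairwise orthogonal B \<and> (\<forall>b\<in>B. norm b = 1 \<and> (\<exists>l. S *v b = l *\<^sub>R b))"
  using assms(2)
proof (induction k)
  case 0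
  show ?case by (rule exI[of _ "{}"]) simp
next
  case (Suc k)
  then obtain B where B: "finite B" "card B = k" "pairwise orthogonal B"
    "\<forall>b\<in>B. norm b = 1 \<and> (\<exists>l. S *v b = l *\<^sub>R b)" by auto
  let ?V = "{x. \<forall>b\<in>B. orthogonal b x}"
  have V: "subspace ?V"
    by (auto simp: subspace_def orthogonal_def inner_add_right)
  have "dim B \<le> k" using dim_le_card'[OF B(1)] B(2) by simp
  then have "dim B < DIM(real^'n)" using Suc.prems by simp
  then obtain w where w: "w \<noteq> 0" "\<And>x. x \<in> span B \<Longrightarrow> orthogonal w x"
    using orthogonal_to_subspace_exists by blast
  have "w \<in> ?V" using w(2) span_base orthogonal_commute by blast
  moreover have "S *v x \<in> ?V" if "x \<in> ?V" for x
  proof -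
    have "b \<bullet> (S *v x) = 0" if b: "b \<in> B" for b
    proof -
      obtain l where "S *v b = l *\<^sub>R b" using B(4) b by blast
      then show ?thesis using \<open>x \<in> ?V\<close> b by (simp add: inner_symmetric_matrix[OF sym] orthogonal_def)
    qed
    then show ?thesis by (simp add: orthogonal_def)
  qed
  ultimately obtain v l where v: "v \<in> ?V" "norm v = 1" "S *v v = l *\<^sub>R v"
    using symmetric_eigenvector_in_subspace[OF sym V _ _ w(1)] by blast
  have "v \<notin> B"
  proof
    assume "v \<in> B"
    then have "v \<bullet> v = 0" using v(1) by (auto simp: orthogonal_def)
    then show False using v(2) by simp
  qed
  then have "finite (insert v B)" "card (insert v B) = Suc k" using B by auto
  moreover have "pairwise orthogonal (insert v B)"
    using B(3) v(1) by (auto simp: pairwise_insert orthogonal_commute)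
  moreover have "\<forall>b\<in>insert v B. norm b = 1 \<and> (\<exists>l. S *v b = l *\<^sub>R b)" using B(4) v by auto
  ultimately show ?case by blast
qed

definition diagm :: "real^'n \<Rightarrow> real^'n^'n" where
  "diagm d = (\<chi> i j. if i = j then d $ i else 0)"

lemma diagm_mult_vec [simp]: "diagm d *v v = (\<chi> i. d $ i * v $ i)"
  by (simp add: diagm_def matrix_vector_mult_def vec_eq_iff if_distrib[of "\<lambda>x. x * _"] sum.delta cong: if_cong)

lemma transpose_diagm [simp]: "transpose (diagm d) = diagm d"
  by (auto simp: diagm_def transpose_def vec_eq_iff)

lemma diagm_mult: "diagm c ** diagm d = diagm (\<chi> i. c $ i * d $ i)"
  by (rule matrix_eq[THEN iffD2]) (simp add: vec_eq_iff flip: matrix_vector_mul_assoc)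

lemma diagm_one: "diagm (\<chi> i. 1) = mat 1"
  by (simp add: diagm_def mat_def vec_eq_iff)

lemma det_diagm: "det (diagm d) = (\<Prod>i\<in>UNIV. d $ i)"
  by (subst det_diagonal) (auto simp: diagm_def)

lemma trace_diagm: "trace (diagm d) = (\<Sum>i\<in>UNIV. d $ i)"
  by (simp add: trace_def diagm_def)

theorem symmetric_matrix_diagonalizable:
  fixes S :: "real^'n^'n"
  assumes sym: "transpose S = S"
  obtains Q d where "orthogonal_matrix Q" "S = Q ** diagm d ** transpose Q"
proof -
  obtain B where B: "finite B" "card B = CARD('n)" "pairwise orthogonal B"
    "\<forall>b\<in>B. norm b = 1 \<and> (\<exists>l. S *v b = l *\<^sub>R b)"
    using symmetric_orthonormal_eigenvectors[OF sym order_refl] by blast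
  obtain e :: "'n \<Rightarrow> real^'n" where e: "bij_betw e UNIV B"
    using finite_same_card_bij[OF finite B(1)] B(2) by metis
  have "\<exists>l. S *v e i = l *\<^sub>R e i" for i using B(4) e by (auto simp: bij_betw_def)
  then obtain l where l: "\<And>i. S *v e i = l i *\<^sub>R e i" by metis
  let ?Q = "(\<chi> i j. e j $ i) :: real^'n^'n"
  have col: "column j ?Q = e j" for j by (simp add: column_def vec_eq_iff)
  have "orthogonal_matrix ?Q"
    unfolding orthogonal_matrix_orthonormal_columns col
  proof (intro conjI allI impI)
    show "norm (e i) = 1" for i using B(4) e by (auto simp: bij_betw_def)
    fix i j :: 'n assume "i \<noteq> j"
    then have "e i \<noteq> e j" using e by (meson UNIV_I bij_betw_def inj_on_def)
    then show "orthogonal (e i) (e j)" using B(3) e by (auto simp: bij_betw_def pairwise_def)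
  qed
  moreover have "S ** ?Q = ?Q ** diagm (\<chi> i. l i)"
  proof (rule matrix_eq[THEN iffD2], rule allI)
    fix x :: "real^'n"
    have Q: "?Q *v y = (\<Sum>j\<in>UNIV. y $ j *\<^sub>R e j)" for y
      by (simp add: matrix_vector_mult_def vec_eq_iff mult.commute)
    have "S *v (?Q *v x) = (\<Sum>j\<in>UNIV. x $ j *\<^sub>R (S *v e j))"
      by (simp add: Q matrix_vector_right_distrib matrix_vector_mult_scaleR linear_sum[OF matrix_vector_mul_linear] o_def)
    also have "\<dots> = ?Q *v (diagm (\<chi> i. l i) *v x)"
      by (simp add: Q l mult.commute)
    finally show "(S ** ?Q) *v x = (?Q ** diagm (\<chi> i. l i)) *v x"
      by (simp only: matrix_vector_mul_assoc)
  qed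
  ultimately show ?thesis
    by (metis that matrix_mul_assoc matrix_mul_rid orthogonal_matrix_def)
qed

section \<open>Positive definite matrices and simultaneous diagonalization\<close>

declare transpose_matrix_vector [simp del] vector_transpose_matrix [simp del]

text \<open>The positivity half of \<open>spd_space\<close>: square roots and congruences by
  arbitrary invertible matrices preserve it, whereas the determinant has to be tracked
  separately.\<close>

definition posdef :: "real^'n^'n \<Rightarrow> bool" where
  "posdef X \<longleftrightarrow> transpose X = X \<and> (\<forall>v. v \<noteq> 0 \<longrightarrow> 0 < v \<bullet> (X *v v))"

lemma spd_space_iff: "X \<in> spd_space \<longleftrightarrow> posdef X \<and> det X = 1"
  by (auto simp: spd_space_def posdef_def)

lemma posdef_pos: "posdef X \<Longrightarrow> v \<noteq> 0 \<Longrightarrow> 0 < v \<bullet> (X *v v)"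
  by (simp add: posdef_def)

lemma inner_transpose_mult_vec:
  fixes A :: "real^'n^'m"
  shows "(A *v x) \<bullet> y = x \<bullet> (transpose A *v y)"
  by (metis dot_lmul_matrix inner_commute transpose_matrix_vector)

lemma congruence_quadratic_form:
  fixes g A :: "real^'n^'n"
  shows "u \<bullet> ((g ** A ** transpose g) *v u) = (transpose g *v u) \<bullet> (A *v (transpose g *v u))"
  by (simp add: inner_transpose_mult_vec flip: matrix_vector_mul_assoc)

lemma invertible_mult_vec_eq_0:
  fixes g :: "real^'n^'n"
  assumes "invertible g"
  shows "g *v x = 0 \<longleftrightarrow> x = 0"
  by (metis assms invertible_def matrix_left_invertible_ker matrix_vector_mult_0_right)

lemma invertible_transposeI: "invertible (g::real^'n^'n) \<Longrightarrow> invertible (transpose g)"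
  by (simp add: invertible_det_nz)

lemma matrix_inv_left_right:
  fixes g :: "real^'n^'n"
  assumes "invertible g"
  shows "g ** matrix_inv g = mat 1" "matrix_inv g ** g = mat 1"
  using someI_ex[OF assms[unfolded invertible_def]] by (simp_all add: matrix_inv_def)

lemma posdef_congruence:
  fixes g X :: "real^'n^'n"
  assumes "posdef X" "invertible g"
  shows "posdef (g ** X ** transpose g)"
  unfolding posdef_def congruence_quadratic_form
proof (intro conjI allI impI)
  show "transpose (g ** X ** transpose g) = g ** X ** transpose g"
    using assms by (simp add: posdef_def matrix_transpose_mul matrix_mul_assoc)
  fix v :: "real^'n" assume "v \<noteq> 0"
  then have "transpose g *v v \<noteq> 0"
    using invertible_mult_vec_eq_0[OF invertible_transposeI[OF assms(2)]] by blast
  then show "0 < (transpose g *v v) \<bullet> (X *v (transpose g *v v))"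
    using assms(1) posdef_pos by blast
qed

lemma posdef_diagm:
  fixes d :: "real^'n"
  shows "posdef (diagm d) \<longleftrightarrow> (\<forall>i. 0 < d $ i)"
proof
  assume "posdef (diagm d)"
  then have "0 < axis i 1 \<bullet> (diagm d *v axis i 1)" for i by (rule posdef_pos) simp
  then show "\<forall>i. 0 < d $ i" by (simp add: inner_axis')
next
  assume d: "\<forall>i. 0 < d $ i"
  show "posdef (diagm d)" unfolding posdef_def
  proof (intro conjI allI impI)
    fix v :: "real^'n" assume "v \<noteq> 0"
    then obtain i where i: "v $ i \<noteq> 0" by (auto simp: vec_eq_iff)
    have "0 < v $ i * (d $ i * v $ i)" using i d
      by (metis mult.left_commute mult_pos_pos not_real_square_gt_zero)
    moreover have "0 \<le> v $ j * (d $ j * v $ j)" for j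
      using d by (metis less_imp_le mult.left_commute mult_nonneg_nonneg zero_le_square)
    ultimately show "0 < v \<bullet> (diagm d *v v)"
      by (simp add: inner_vec_def) (rule sum_pos2[of _ i]; simp)
  qed simp
qed

lemma posdef_mat_1: "posdef (mat 1)"
  using posdef_diagm[of "\<chi> i. 1"] by (simp add: diagm_one)

lemma posdef_invertible:
  fixes X :: "real^'n^'n"
  assumes "posdef X" shows "invertible X"
proof -
  have "X *v x = 0 \<Longrightarrow> x = 0" for x using posdef_pos[OF assms, of x] by force
  then show ?thesis
    by (metis invertible_left_inverse matrix_left_invertible_ker)
qed

lemma orthogonal_matrix_invertible:
  fixes Q :: "real^'n^'n"
  shows "orthogonal_matrix Q \<Longrightarrow> invertible Q"
  unfolding orthogonal_matrix_def invertible_def by blast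

text \<open>Square roots are taken of the eigenvalues in an orthonormal eigenbasis; positivity of
  the eigenvalues comes from conjugating \<open>X\<close> back to diagonal form.\<close>

lemma posdef_sqrt:
  fixes X :: "real^'n^'n"
  assumes "posdef X"
  obtains R where "posdef R" "R ** R = X"
proof -
  obtain Q d where Q: "orthogonal_matrix Q" and X: "X = Q ** diagm d ** transpose Q"
    using assms symmetric_matrix_diagonalizable unfolding posdef_def by blast
  have QQ: "transpose Q ** Q = mat 1" using Q by (simp add: orthogonal_matrix)
  have invQ: "invertible (transpose Q)"
    using Q by (simp add: orthogonal_matrix_invertible)
  have "posdef (transpose Q ** X ** transpose (transpose Q))"
    using posdef_congruence[OF assms invQ] .
  also have "transpose Q ** X ** transpose (transpose Q) = (transpose Q ** Q) ** diagm d ** (transpose Q ** Q)"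
    unfolding X by (simp only: matrix_mul_assoc transpose_transpose)
  finally have d: "\<forall>i. 0 < d $ i" by (simp add: QQ posdef_diagm)
  let ?r = "\<chi> i. sqrt (d $ i)"
  let ?R = "Q ** diagm ?r ** transpose Q"
  have "posdef ?R"
    using d Q by (intro posdef_congruence orthogonal_matrix_invertible) (simp_all add: posdef_diagm)
  moreover have "?R ** ?R = Q ** diagm ?r ** (transpose Q ** Q) ** diagm ?r ** transpose Q"
    by (simp only: matrix_mul_assoc)
  then have "?R ** ?R = Q ** (diagm ?r ** diagm ?r) ** transpose Q"
    by (simp add: QQ matrix_mul_assoc)
  then have "?R ** ?R = X"
    using d by (simp add: X diagm_mult less_imp_le)
  ultimately show ?thesis using that by blast
qed

text \<open>With R the square root of \<open>X\<close>, an orthogonal Q diagonalizing R^-1 A R^-1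
  gives g = R Q. Only symmetry of \<open>A\<close> is assumed, so that \<open>A\<close> may be a
  second point of the space or a tangent vector at \<open>X\<close>.\<close>

theorem simultaneous_diagonalization:
  fixes X A :: "real^'n^'n"
  assumes X: "posdef X" and A: "transpose A = A"
  obtains g :: "real^'n^'n" and d where "invertible g" "X = g ** transpose g" "A = g ** diagm d ** transpose g"
proof -
  obtain R where R: "posdef R" "R ** R = X" using posdef_sqrt[OF X] .
  note inv = posdef_invertible[OF R(1)]
  have tR: "transpose R = R" using R(1) by (simp add: posdef_def)
  let ?I = "matrix_inv R"
  have I: "R ** ?I = mat 1" "?I ** R = mat 1" using matrix_inv_left_right[OF inv] by auto
  have tI: "transpose ?I = ?I"
    by (metis I tR matrix_mul_assoc matrix_mul_lid matrix_mul_rid matrix_transpose_mul transpose_mat)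
  have "transpose (?I ** A ** ?I) = ?I ** A ** ?I"
    by (simp add: matrix_transpose_mul tI A matrix_mul_assoc)
  then obtain Q d where Q: "orthogonal_matrix Q" "?I ** A ** ?I = Q ** diagm d ** transpose Q"
    using symmetric_matrix_diagonalizable by blast
  have QQ: "Q ** transpose Q = mat 1" using Q by (simp add: orthogonal_matrix_def)
  show ?thesis
  proof (rule that[of "R ** Q" d])
    show "invertible (R ** Q)" using inv Q by (simp add: invertible_mult orthogonal_matrix_invertible)
    have "(R ** Q) ** transpose (R ** Q) = R ** (Q ** transpose Q) ** R"
      by (simp add: matrix_transpose_mul tR matrix_mul_assoc)
    then show "X = (R ** Q) ** transpose (R ** Q)" by (simp add: QQ R)
    have "(R ** Q) ** diagm d ** transpose (R ** Q) = R ** (Q ** diagm d ** transpose Q) ** R"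
      by (simp add: matrix_transpose_mul tR matrix_mul_assoc)
    also have "\<dots> = (R ** ?I) ** A ** (?I ** R)" by (simp only: Q(2)[symmetric] matrix_mul_assoc)
    finally show "A = (R ** Q) ** diagm d ** transpose (R ** Q)" by (simp add: I)
  qed
qed

lemma congruence_diagm_posdef:
  fixes g :: "real^'n^'n"
  assumes g: "invertible g" and pd: "posdef (g ** diagm d ** transpose g)"
  shows "0 < d $ i"
proof -
  let ?I = "matrix_inv g"
  have I: "g ** ?I = mat 1" "?I ** g = mat 1" using matrix_inv_left_right[OF g] by auto
  have "transpose g ** transpose ?I = mat 1" by (simp add: I flip: matrix_transpose_mul)
  moreover have "posdef (?I ** (g ** diagm d ** transpose g) ** transpose ?I)"
    using posdef_congruence[OF pd, of ?I] I by (auto simp: invertible_def)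
  moreover have "?I ** (g ** diagm d ** transpose g) ** transpose ?I = (?I ** g) ** diagm d ** (transpose g ** transpose ?I)"
    by (simp only: matrix_mul_assoc)
  ultimately have "posdef (diagm d)" by (simp only: I matrix_mul_lid matrix_mul_rid)
  then show ?thesis by (simp add: posdef_diagm)
qed

text \<open>The largest eigenvalue of \<open>A\<close> relative to \<open>X\<close>. The quotient is
  homogeneous of degree 0, so the compact unit sphere sees all of its values.\<close>

definition rayleigh :: "real^'n^'n \<Rightarrow> real^'n^'n \<Rightarrow> real" where
  "rayleigh X A = (SUP u \<in> sphere 0 1. (u \<bullet> (A *v u)) / (u \<bullet> (X *v u)))"

lemma bdd_above_rayleigh:
  fixes X A :: "real^'n^'n"
  assumes "posdef X"
  shows "bdd_above ((\<lambda>u. (u \<bullet> (A *v u)) / (u \<bullet> (X *v u))) ` sphere 0 1)"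
proof -
  have "u \<bullet> (X *v u) \<noteq> 0" if "u \<in> sphere 0 1" for u
    using posdef_pos[OF assms, of u] that by fastforce
  then have "compact ((\<lambda>u. (u \<bullet> (A *v u)) / (u \<bullet> (X *v u))) ` sphere 0 1)"
    by (intro compact_continuous_image continuous_intros) auto
  then show ?thesis by (simp add: bounded_imp_bdd_above compact_imp_bounded)
qed

lemma rayleigh_bound:
  fixes X A :: "real^'n^'n"
  assumes "posdef X"
  shows "u \<bullet> (A *v u) \<le> rayleigh X A * (u \<bullet> (X *v u))"
proof (cases "u = 0")
  case False
  let ?v = "(1 / norm u) *\<^sub>R u"
  have "(?v \<bullet> (A *v ?v)) / (?v \<bullet> (X *v ?v)) \<le> rayleigh X A"
    unfolding rayleigh_def using False by (intro cSUP_upper bdd_above_rayleigh assms) auto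
  then have "(u \<bullet> (A *v u)) / (u \<bullet> (X *v u)) \<le> rayleigh X A"
    using False by (simp add: matrix_vector_mult_scaleR)
  then show ?thesis using posdef_pos[OF assms False] by (simp add: divide_le_eq)
qed simp

lemma sphere_0_1_nonempty: "sphere (0::'a::euclidean_space) 1 \<noteq> {}"
  using vector_choose_size[of 1] by force

lemma rayleigh_le:
  fixes X A :: "real^'n^'n"
  assumes "posdef X" "\<And>u. u \<bullet> (A *v u) \<le> c * (u \<bullet> (X *v u))"
  shows "rayleigh X A \<le> c"
  unfolding rayleigh_def
proof (rule cSUP_least)
  fix u :: "real^'n" assume "u \<in> sphere 0 1"
  then have "u \<noteq> 0" by auto
  then show "(u \<bullet> (A *v u)) / (u \<bullet> (X *v u)) \<le> c"
    using posdef_pos[OF assms(1)] assms(2) by (simp add: divide_le_eq)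
qed (rule sphere_0_1_nonempty)

lemma rayleigh_eqI:
  fixes X A :: "real^'n^'n"
  assumes X: "posdef X" and le: "\<And>u. u \<bullet> (A *v u) \<le> c * (u \<bullet> (X *v u))"
    and u: "u \<noteq> 0" "u \<bullet> (A *v u) = c * (u \<bullet> (X *v u))"
  shows "rayleigh X A = c"
proof (rule antisym)
  show "rayleigh X A \<le> c" using X le by (rule rayleigh_le)
  have "c * (u \<bullet> (X *v u)) \<le> rayleigh X A * (u \<bullet> (X *v u))"
    using rayleigh_bound[OF X, of u A] u by simp
  then show "c \<le> rayleigh X A" using posdef_pos[OF X u(1)] by simp
qed

text \<open>In the coordinates w = g^T u the quotient is the mean of the \<open>d $ i\<close> with
  weights w_i^2, which is largest when all weight sits on a maximal entry.\<close>

lemma rayleigh_diagm: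
  fixes g :: "real^'n^'n"
  assumes g: "invertible g"
  shows "rayleigh (g ** transpose g) (g ** diagm d ** transpose g) = Max (range (($) d))"
proof -
  have fin: "finite (range (($) d))" by simp
  have X: "g ** transpose g = g ** mat 1 ** transpose g" by simp
  have pd: "posdef (g ** mat 1 ** transpose g)" using posdef_congruence[OF posdef_mat_1 g] .
  obtain k where k: "Max (range (($) d)) = d $ k"
    using Max_in[OF fin] by (metis (no_types, lifting) UNIV_not_empty image_is_empty imageE)
  \<comment> \<open>The vector whose coordinates w = g^T u are those of the k-th axis, k being the
    index of a maximal entry.\<close>
  let ?u = "transpose (matrix_inv g) *v axis k 1"
  have gu: "transpose g *v ?u = axis k 1"
    by (simp add: matrix_vector_mul_assoc matrix_inv_left_right[OF g] flip: matrix_transpose_mul)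
  show ?thesis unfolding X
  proof (rule rayleigh_eqI[OF pd])
    fix u :: "real^'n"
    let ?w = "transpose g *v u"
    have "?w $ i * (d $ i * ?w $ i) \<le> Max (range (($) d)) * (?w $ i * ?w $ i)" for i
      using mult_right_mono[OF Max_ge[OF fin], of "d $ i" "?w $ i * ?w $ i"] by (simp add: mult_ac)
    then show "u \<bullet> ((g ** diagm d ** transpose g) *v u)
      \<le> Max (range (($) d)) * (u \<bullet> ((g ** mat 1 ** transpose g) *v u))"
      unfolding congruence_quadratic_form
      by (simp add: inner_vec_def sum_distrib_left sum_mono)
  next
    show "?u \<noteq> 0" using gu by force
    show "?u \<bullet> ((g ** diagm d ** transpose g) *v ?u)
      = Max (range (($) d)) * (?u \<bullet> ((g ** mat 1 ** transpose g) *v ?u))"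
      unfolding congruence_quadratic_form gu by (simp add: k inner_axis')
  qed
qed

lemma map_matrix_of_real_mult:
  fixes A B :: "real^'n^'n"
  shows "map_matrix complex_of_real (A ** B) = map_matrix complex_of_real A ** map_matrix complex_of_real B"
  by (simp add: map_matrix_def matrix_matrix_mult_def vec_eq_iff)

lemma map_matrix_of_real_mat_1: "map_matrix complex_of_real (mat 1) = mat 1"
  by (simp add: map_matrix_def mat_def vec_eq_iff)

text \<open>Similarity by the complexified \<open>g\<close> reduces the claim to a diagonal matrix,
  all of whose complex eigenvalues are its real diagonal entries.\<close>

lemma complex_eigenvalue_diagm:
  fixes g :: "real^'n^'n"
  assumes g: "invertible g"
  shows "complex_eigenvalue (g ** diagm d ** matrix_inv g) l \<longleftrightarrow> (\<exists>i. l = complex_of_real (d $ i))"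
proof -
  let ?c = "map_matrix complex_of_real"
  have I: "?c g ** ?c (matrix_inv g) = mat 1" "?c (matrix_inv g) ** ?c g = mat 1"
    by (simp_all add: matrix_inv_left_right[OF g] map_matrix_of_real_mat_1 flip: map_matrix_of_real_mult)
  have D: "?c (diagm d) *v w = (\<chi> i. of_real (d $ i) * w $ i)" for w
    by (simp add: diagm_def map_matrix_def matrix_vector_mult_def vec_eq_iff if_distrib[of "\<lambda>x. x * _"]
        if_distrib[of complex_of_real] sum.delta cong: if_cong)
  have sm: "A *v (l *s v) = l *s (A *v v)" for A :: "complex^'n^'n" and v
    by (simp add: matrix_vector_mult_def vec_eq_iff sum_distrib_left mult_ac)
  show ?thesis
  proof
    assume "complex_eigenvalue (g ** diagm d ** matrix_inv g) l"
    then obtain v where v: "v \<noteq> 0" "?c (g ** diagm d ** matrix_inv g) *v v = l *s v"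
      by (auto simp: complex_eigenvalue_def)
    let ?w = "?c (matrix_inv g) *v v"
    have gw: "?c g *v ?w = v" by (simp add: matrix_vector_mul_assoc I)
    then have "?w \<noteq> 0" using v(1) by force
    then obtain i where i: "?w $ i \<noteq> 0" by (auto simp: vec_eq_iff)
    have "?c g *v (?c (diagm d) *v ?w) = l *s v"
      using v(2) by (simp add: map_matrix_of_real_mult matrix_vector_mul_assoc matrix_mul_assoc)
    then have "?c (matrix_inv g) *v (?c g *v (?c (diagm d) *v ?w)) = l *s ?w" by (simp add: sm)
    then have "?c (diagm d) *v ?w = l *s ?w" unfolding matrix_vector_mul_assoc[of "?c (matrix_inv g)"] by (simp add: I)
    then have "of_real (d $ i) * ?w $ i = l * ?w $ i" unfolding D by (simp add: vec_eq_iff)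
    then show "\<exists>i. l = complex_of_real (d $ i)" using i by auto
  next
    assume "\<exists>i. l = complex_of_real (d $ i)"
    then obtain i where i: "l = complex_of_real (d $ i)" ..
    let ?v = "?c g *v axis i 1"
    have w: "?c (matrix_inv g) *v ?v = axis i 1" by (simp add: matrix_vector_mul_assoc I)
    have "?c (g ** diagm d ** matrix_inv g) *v ?v = ?c g *v (?c (diagm d) *v (?c (matrix_inv g) *v ?v))"
      by (simp add: map_matrix_of_real_mult matrix_vector_mul_assoc matrix_mul_assoc)
    also have "?c (diagm d) *v (?c (matrix_inv g) *v ?v) = l *s axis i 1"
      unfolding w D by (simp add: i vec_eq_iff axis_def)
    finally have "?c (g ** diagm d ** matrix_inv g) *v ?v = l *s ?v" by (simp add: sm)
    moreover have "?v \<noteq> 0" using w by force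
    ultimately show "complex_eigenvalue (g ** diagm d ** matrix_inv g) l"
      unfolding complex_eigenvalue_def by blast
  qed
qed

section \<open>Lifts of maps between flat tori\<close>

definition tproj :: "(real^'n) set \<Rightarrow> real^'n \<Rightarrow> (real^'n) set" where
  "tproj \<Lambda> x = (+) x ` \<Lambda>"

lemma is_lift_iff: "is_lift \<Lambda> \<Lambda>' F \<phi> \<longleftrightarrow> continuous_on UNIV F \<and> (\<forall>x. tproj \<Lambda>' (F x) = \<phi> (tproj \<Lambda> x))"
  by (simp add: is_lift_def tproj_def)

text \<open>The axis vectors generate the integer vectors as a group, hence steps of both signs. The
  proof clears one coordinate at a time, each by induction over the integers.\<close>

lemma int_vectors_induct [consumes 1, case_names zero plus minus]:
  assumes "z \<in> int_vectors" and P0: "P 0"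
    and Pp: "\<And>z i. P z \<Longrightarrow> P (z + axis i 1)" and Pm: "\<And>z i. P z \<Longrightarrow> P (z - axis i 1)"
  shows "P z"
proof -
  have *: "P (y + of_int k *\<^sub>R axis i 1)" if "P y" for y i k
  proof (induction k rule: int_induct[where k = 0])
    case base
    show ?case using that by simp
  next
    case (step1 k)
    then have "P (y + of_int k *\<^sub>R axis i 1 + axis i 1)" by (intro Pp)
    then show ?case by (simp add: algebra_simps)
  next
    case (step2 k)
    then have "P (y + of_int k *\<^sub>R axis i 1 - axis i 1)" by (intro Pm)
    then show ?case by (simp add: algebra_simps)
  qed
  have "P z" if "finite S" "z \<in> int_vectors" "\<forall>i. i \<notin> S \<longrightarrow> z $ i = 0" for S z
    using that
  proof (induction S arbitrary: z rule: finite_induct)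
    case empty
    then have "z = 0" by (simp add: vec_eq_iff)
    then show ?case using P0 by simp
  next
    case (insert i S)
    let ?y = "z - (z $ i) *\<^sub>R axis i 1"
    obtain k where k: "z $ i = of_int k" using insert.prems(1) by (auto simp: int_vectors_def elim: Ints_cases)
    have "P ?y"
    proof (rule insert.IH)
      show "?y \<in> int_vectors" using insert.prems(1) by (auto simp: int_vectors_def axis_def)
      show "\<forall>j. j \<notin> S \<longrightarrow> ?y $ j = 0" using insert.prems(2) by (auto simp: axis_def)
    qed
    from *[OF this, of k i] show ?case by (simp add: k)
  qed
  from this[of UNIV z] assms(1) show ?thesis by simp
qed

lemma int_vectors_closed:
  "0 \<in> int_vectors" "x \<in> int_vectors \<Longrightarrow> y \<in> int_vectors \<Longrightarrow> x + y \<in> int_vectors"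
  "x \<in> int_vectors \<Longrightarrow> - x \<in> int_vectors" "axis i 1 \<in> int_vectors"
  by (auto simp: int_vectors_def axis_def)

lemma lattice_of_mat_1: "lattice_of (mat 1) = int_vectors"
  by (simp add: lattice_of_def)

lemma int_vectors_unit_lattice: "(int_vectors :: (real^'n) set) \<in> unit_lattices"
  unfolding unit_lattices_def by (auto simp flip: lattice_of_mat_1 intro!: exI[of _ "mat 1"])

lemma unit_latticeE:
  assumes "\<Lambda> \<in> unit_lattices"
  obtains M where "\<Lambda> = lattice_of M" "\<bar>det M\<bar> = 1" "invertible M"
proof -
  obtain M where "\<Lambda> = lattice_of M" "\<bar>det M\<bar> = 1" using assms by (auto simp: unit_lattices_def)
  moreover then have "invertible M" by (auto simp: invertible_det_nz)
  ultimately show ?thesis using that by blast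
qed

lemma lattice_closed:
  assumes "\<Lambda> \<in> unit_lattices"
  shows "0 \<in> \<Lambda>" "x \<in> \<Lambda> \<Longrightarrow> y \<in> \<Lambda> \<Longrightarrow> x + y \<in> \<Lambda>" "x \<in> \<Lambda> \<Longrightarrow> - x \<in> \<Lambda>" "x \<in> \<Lambda> \<Longrightarrow> y \<in> \<Lambda> \<Longrightarrow> x - y \<in> \<Lambda>"
proof -
  obtain M where M: "\<Lambda> = lattice_of M" using assms by (rule unit_latticeE)
  show 0: "0 \<in> \<Lambda>" unfolding M lattice_of_def using int_vectors_closed(1) by force
  show a: "x \<in> \<Lambda> \<Longrightarrow> y \<in> \<Lambda> \<Longrightarrow> x + y \<in> \<Lambda>" for x y
    unfolding M lattice_of_def by (auto simp: int_vectors_closed simp flip: matrix_vector_right_distrib)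
  show m: "x \<in> \<Lambda> \<Longrightarrow> - x \<in> \<Lambda>" for x
  proof -
    assume "x \<in> \<Lambda>"
    then obtain z where z: "z \<in> int_vectors" "x = M *v z" by (auto simp: M lattice_of_def)
    then have "- x = M *v (- z)" by (simp add: linear_neg[OF matrix_vector_mul_linear])
    then show "- x \<in> \<Lambda>" unfolding M lattice_of_def using int_vectors_closed(3)[OF z(1)] by blast
  qed
  show "x \<in> \<Lambda> \<Longrightarrow> y \<in> \<Lambda> \<Longrightarrow> x - y \<in> \<Lambda>" using a[of x "- y"] m[of y] by simp
qed

text \<open>A nonzero integer vector has norm at least 1, and the inverse of the basis matrix
  stretches by at most \<open>B\<close>; so 1/B bounds nonzero lattice vectors from below.\<close>

lemma lattice_discrete:
  assumes "\<Lambda> \<in> unit_lattices"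
  obtains e where "e > 0" "\<And>l. l \<in> \<Lambda> \<Longrightarrow> l \<noteq> 0 \<Longrightarrow> e \<le> norm l"
proof -
  obtain M where M: "\<Lambda> = lattice_of M" "invertible M" using assms by (rule unit_latticeE)
  obtain B where B: "B > 0" "\<And>x. norm (matrix_inv M *v x) \<le> B * norm x"
    using linear_bounded_pos[OF matrix_vector_mul_linear] by blast
  show ?thesis
  proof (rule that[of "1 / B"])
    fix l assume l: "l \<in> \<Lambda>" "l \<noteq> 0"
    then obtain z where z: "z \<in> int_vectors" "l = M *v z" by (auto simp: M lattice_of_def)
    have "z \<noteq> 0" using z l(2) by auto
    then obtain i where i: "z $ i \<noteq> 0" by (auto simp: vec_eq_iff)
    then have "1 \<le> \<bar>z $ i\<bar>" using z(1) by (auto simp: int_vectors_def intro: Ints_nonzero_abs_ge1)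
    also have "\<dots> \<le> norm z" by (rule component_le_norm_cart)
    also have "z = matrix_inv M *v l" by (simp add: z(2) matrix_vector_mul_assoc matrix_inv_left_right[OF M(2)])
    also have "norm \<dots> \<le> B * norm l" by (rule B)
    finally show "1 / B \<le> norm l" using B(1) by (simp add: divide_le_eq mult.commute)
  qed (use B in auto)
qed

lemma lattice_closed_set:
  assumes "\<Lambda> \<in> unit_lattices" shows "closed \<Lambda>"
proof -
  obtain e where e: "e > 0" "\<And>l. l \<in> \<Lambda> \<Longrightarrow> l \<noteq> 0 \<Longrightarrow> e \<le> norm l" using assms by (rule lattice_discrete) blast
  have "y = x" if "x \<in> \<Lambda>" "y \<in> \<Lambda>" "dist y x < e" for x y
    using e(2)[of "y - x"] lattice_closed(4)[OF assms that(2,1)] that(3) by (auto simp: dist_norm)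
  then show ?thesis using discrete_imp_closed[OF e(1)] by blast
qed

text \<open>Rounding down the coordinates in a lattice basis leaves a remainder in a fixed
  parallelepiped.\<close>

lemma lattice_cobounded:
  assumes "\<Lambda> \<in> unit_lattices"
  obtains C where "\<And>x. \<exists>l\<in>\<Lambda>. norm (x - l) \<le> C"
proof -
  obtain M where M: "\<Lambda> = lattice_of M" "invertible M" using assms by (rule unit_latticeE)
  obtain B where B: "B > 0" "\<And>x. norm (M *v x) \<le> B * norm x"
    using linear_bounded_pos[OF matrix_vector_mul_linear] by blast
  show ?thesis
  proof (rule that)
    fix x
    let ?y = "matrix_inv M *v x"
    let ?z = "(\<chi> i. of_int \<lfloor>?y $ i\<rfloor>) :: real^'a"
    have "norm (?y - ?z) \<le> (\<Sum>i\<in>UNIV. \<bar>(?y - ?z) $ i\<bar>)" by (rule norm_le_l1_cart)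
    also have "\<dots> \<le> (\<Sum>i\<in>(UNIV::'a set). 1)"
      by (intro sum_mono) (simp add: abs_le_iff, linarith)
    finally have *: "norm (?y - ?z) \<le> real CARD('a)" by simp
    have "x = M *v ?y" by (simp add: matrix_vector_mul_assoc matrix_inv_left_right[OF M(2)])
    then have "norm (x - M *v ?z) = norm (M *v (?y - ?z))" by (metis matrix_vector_mult_diff_distrib)
    also have "\<dots> \<le> B * real CARD('a)" using B(2)[of "?y - ?z"] * B(1)
      by (meson dual_order.trans less_imp_le mult_left_mono)
    finally show "\<exists>l\<in>\<Lambda>. norm (x - l) \<le> B * real CARD('a)"
      unfolding M lattice_of_def by (force simp: int_vectors_def)
  qed
qed

lemma tproj_eq_iff:
  assumes "\<Lambda> \<in> unit_lattices"
  shows "tproj \<Lambda> x = tproj \<Lambda> y \<longleftrightarrow> x - y \<in> \<Lambda>"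
proof
  assume "tproj \<Lambda> x = tproj \<Lambda> y"
  then have "x + 0 \<in> (+) y ` \<Lambda>" unfolding tproj_def using lattice_closed(1)[OF assms] by blast
  then show "x - y \<in> \<Lambda>" by auto
next
  assume d: "x - y \<in> \<Lambda>"
  have "(+) x ` \<Lambda> \<subseteq> (+) y ` \<Lambda>" if "x - y \<in> \<Lambda>" for x y
  proof clarify
    fix l assume "l \<in> \<Lambda>"
    then have "x - y + l \<in> \<Lambda>" using that lattice_closed(2)[OF assms] by blast
    then have "y + (x - y + l) \<in> (+) y ` \<Lambda>" by blast
    then show "x + l \<in> (+) y ` \<Lambda>" by (simp add: algebra_simps)
  qed
  from this[OF d] this[of y x] d show "tproj \<Lambda> x = tproj \<Lambda> y"
    unfolding tproj_def using lattice_closed(3)[OF assms d] by auto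
qed

text \<open>Differences of points of the two cosets are exactly the translates of
  \<open>x - y\<close> by lattice vectors; the infimum is attained since the lattice is
  closed.\<close>

lemma setdist_tproj:
  assumes L: "\<Lambda> \<in> unit_lattices"
  shows "setdist (tproj \<Lambda> x) (tproj \<Lambda> y) = infdist (x - y) \<Lambda>"
proof (rule antisym)
  have ne: "\<Lambda> \<noteq> {}" using lattice_closed(1)[OF L] by blast
  obtain l where l: "l \<in> \<Lambda>" "infdist (x - y) \<Lambda> = dist (x - y) l"
    using infdist_attains_inf[OF lattice_closed_set[OF L] ne] by blast
  have "setdist (tproj \<Lambda> x) (tproj \<Lambda> y) \<le> dist (x + 0) (y + l)"
    unfolding tproj_def using l lattice_closed(1)[OF L] by (intro setdist_le_dist imageI)
  then show "setdist (tproj \<Lambda> x) (tproj \<Lambda> y) \<le> infdist (x - y) \<Lambda>"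
    unfolding l(2) by (simp add: dist_norm algebra_simps)
  show "infdist (x - y) \<Lambda> \<le> setdist (tproj \<Lambda> x) (tproj \<Lambda> y)"
  proof (rule le_setdistI)
    fix a b assume "a \<in> tproj \<Lambda> x" "b \<in> tproj \<Lambda> y"
    then obtain l m where lm: "l \<in> \<Lambda>" "m \<in> \<Lambda>" "a = x + l" "b = y + m" by (auto simp: tproj_def)
    have "infdist (x - y) \<Lambda> \<le> dist (x - y) (m - l)"
      using lattice_closed(4)[OF L lm(2,1)] by (rule infdist_le)
    then show "infdist (x - y) \<Lambda> \<le> dist a b" by (simp add: lm dist_norm algebra_simps)
  qed (use ne in \<open>auto simp: tproj_def\<close>)
qed

lemma infdist_lattice_attained:
  assumes L: "\<Lambda> \<in> unit_lattices"
  obtains l where "l \<in> \<Lambda>" "infdist x \<Lambda> = norm (x - l)"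
  using infdist_attains_inf[OF lattice_closed_set[OF L], of x] lattice_closed(1)[OF L]
  by (auto simp: dist_norm)

lemma infdist_lattice_le:
  assumes L: "\<Lambda> \<in> unit_lattices"
  shows "infdist x \<Lambda> \<le> norm x"
  using infdist_le[OF lattice_closed(1)[OF L], of x] by simp

lemma Metric_space_flat_torus:
  assumes L: "\<Lambda> \<in> unit_lattices"
  shows "Metric_space (range (tproj \<Lambda>)) setdist"
proof
  fix C D :: "(real^'a) set"
  show "0 \<le> setdist C D" by (rule setdist_pos_le)
  show "setdist C D = setdist D C" by (rule setdist_sym)
next
  fix C D :: "(real^'a) set"
  assume "C \<in> range (tproj \<Lambda>)" "D \<in> range (tproj \<Lambda>)"
  then obtain x y where xy: "C = tproj \<Lambda> x" "D = tproj \<Lambda> y" by auto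
  show "setdist C D = 0 \<longleftrightarrow> C = D"
    unfolding xy setdist_tproj[OF L] tproj_eq_iff[OF L]
    using in_closed_iff_infdist_zero[OF lattice_closed_set[OF L]] lattice_closed(1)[OF L] by blast
next
  fix C D E :: "(real^'a) set"
  assume "C \<in> range (tproj \<Lambda>)" "D \<in> range (tproj \<Lambda>)" "E \<in> range (tproj \<Lambda>)"
  then obtain x y z where xyz: "C = tproj \<Lambda> x" "D = tproj \<Lambda> y" "E = tproj \<Lambda> z" by auto
  obtain l where l: "l \<in> \<Lambda>" "infdist (x - y) \<Lambda> = norm (x - y - l)" by (rule infdist_lattice_attained[OF L])
  obtain m where m: "m \<in> \<Lambda>" "infdist (y - z) \<Lambda> = norm (y - z - m)" by (rule infdist_lattice_attained[OF L])
  have "infdist (x - z) \<Lambda> \<le> dist (x - z) (l + m)" using lattice_closed(2)[OF L l(1) m(1)] by (rule infdist_le)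
  also have "\<dots> = norm ((x - y - l) + (y - z - m))" by (simp add: dist_norm algebra_simps)
  also have "\<dots> \<le> norm (x - y - l) + norm (y - z - m)" by (rule norm_triangle_ineq)
  finally show "setdist C E \<le> setdist C D + setdist D E"
    unfolding xyz setdist_tproj[OF L] l m .
qed

lemma flat_torus_alt: "flat_torus \<Lambda> = metric (range (tproj \<Lambda>), setdist)"
  by (simp add: flat_torus_def tproj_def[abs_def])

lemma mspace_flat_torus: "\<Lambda> \<in> unit_lattices \<Longrightarrow> mspace (flat_torus \<Lambda>) = range (tproj \<Lambda>)"
  by (simp add: flat_torus_alt Metric_space.mspace_metric[OF Metric_space_flat_torus])

lemma mdist_flat_torus: "\<Lambda> \<in> unit_lattices \<Longrightarrow> mdist (flat_torus \<Lambda>) (tproj \<Lambda> x) (tproj \<Lambda> y) = infdist (x - y) \<Lambda>"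
  by (simp add: flat_torus_alt Metric_space.mdist_metric[OF Metric_space_flat_torus] setdist_tproj)

text \<open>Lets continuity of a map on the torus be tested on its pullback to the covering space.
  Openness holds because a point of a small ball around a coset has a representative equally close
  to any given representative of the center.\<close>

lemma quotient_map_tproj:
  assumes L: "\<Lambda> \<in> unit_lattices"
  shows "quotient_map euclidean (torus_top \<Lambda>) (tproj \<Lambda>)"
proof (rule continuous_open_imp_quotient_map)
  have "Lipschitz_continuous_map euclidean_metric (flat_torus \<Lambda>) (tproj \<Lambda>)"
    unfolding Lipschitz_continuous_map_def
    by (auto simp: mspace_flat_torus[OF L] mdist_flat_torus[OF L] dist_norm infdist_lattice_le[OF L] intro!: exI[of _ 1])
  then show "continuous_map euclidean (torus_top \<Lambda>) (tproj \<Lambda>)"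
    using Lipschitz_continuous_imp_continuous_map by fastforce
  interpret Metric_space "mspace (flat_torus \<Lambda>)" "mdist (flat_torus \<Lambda>)" by simp
  show "open_map euclidean (torus_top \<Lambda>) (tproj \<Lambda>)"
    unfolding open_map_def mtopology_of_def openin_mtopology
  proof (intro allI impI conjI)
    fix U :: "(real^'a) set" and C
    assume "openin euclidean U"
    then have U: "open U" by simp
    show "tproj \<Lambda> ` U \<subseteq> mspace (flat_torus \<Lambda>)" by (auto simp: mspace_flat_torus[OF L])
    assume "C \<in> tproj \<Lambda> ` U"
    then obtain x where x: "x \<in> U" "C = tproj \<Lambda> x" by blast
    obtain r where r: "r > 0" "ball x r \<subseteq> U" using U x(1) open_contains_ball by blast
    have "mball C r \<subseteq> tproj \<Lambda> ` U"
    proof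
      fix D assume "D \<in> mball C r"
      then obtain y where y: "D = tproj \<Lambda> y" "infdist (x - y) \<Lambda> < r"
        unfolding in_mball by (auto simp: mspace_flat_torus[OF L] x mdist_flat_torus[OF L])
      obtain l where l: "l \<in> \<Lambda>" "infdist (x - y) \<Lambda> = norm (x - y - l)" by (rule infdist_lattice_attained[OF L])
      have "y + l \<in> U" using r y l by (auto simp: dist_norm algebra_simps subset_iff)
      moreover have "D = tproj \<Lambda> (y + l)" unfolding y tproj_eq_iff[OF L] using lattice_closed(3)[OF L l(1)] by simp
      ultimately show "D \<in> tproj \<Lambda> ` U" by blast
    qed
    then show "\<exists>r>0. mball C r \<subseteq> tproj \<Lambda> ` U" using r by blast
  qed
qed (simp add: mspace_flat_torus[OF L])

text \<open>The product of a quotient map with an identity need not be a quotient map; it is one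
  here because the interval is locally compact and Hausdorff. This is what homotopies of torus maps
  require.\<close>

lemma quotient_map_interval_tproj:
  assumes L: "\<Lambda> \<in> unit_lattices"
  shows "quotient_map (top_of_set ({0..1::real} \<times> UNIV)) (prod_topology (top_of_set {0..1}) (torus_top \<Lambda>))
    (\<lambda>(t, x). (t, tproj \<Lambda> x))"
proof -
  have "compact_space (top_of_set {0..1::real})" by (simp add: compact_space_subtopology)
  moreover have "Hausdorff_space (top_of_set {0..1::real})" by (simp add: Hausdorff_space_subtopology)
  ultimately have "quotient_map (prod_topology (top_of_set {0..1::real}) euclidean) (prod_topology (top_of_set {0..1}) (torus_top \<Lambda>))
    (\<lambda>(t, x). (t, tproj \<Lambda> x))"
    by (intro quotient_map_prod_right quotient_map_tproj L) (auto intro: compact_imp_locally_compact_space)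
  moreover have "prod_topology (top_of_set {0..1::real}) euclidean = (top_of_set ({0..1::real} \<times> (UNIV::(real^'a) set)))"
    by (metis prod_topology_subtopology_eu subtopology_UNIV)
  ultimately show ?thesis by simp
qed

section \<open>Existence and uniqueness of lifts\<close>

lemma continuous_on_matrix_mult [continuous_intros]:
  fixes A :: "real^'n^'m"
  shows "continuous_on S f \<Longrightarrow> continuous_on S (\<lambda>x. A *v f x)"
  by (rule bounded_linear.continuous_on[OF matrix_vector_mul_bounded_linear])

text \<open>Composition with the \<open>n\<close> coordinate characters of the torus reduces the lifting problem to continuous
  logarithms of nowhere vanishing functions.\<close>

lemma torus_map_lift:
  fixes \<phi> :: "'a::real_normed_vector \<Rightarrow> (real^'n) set"
  assumes L: "\<Lambda> \<in> unit_lattices" and U: "contractible U"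
    and \<phi>: "continuous_map (top_of_set U) (torus_top \<Lambda>) \<phi>"
  obtains F where "continuous_on U F" "\<And>u. u \<in> U \<Longrightarrow> tproj \<Lambda> (F u) = \<phi> u"
proof -
  obtain M where M: "\<Lambda> = lattice_of M" "invertible M" using L by (rule unit_latticeE)
  \<comment> \<open>The k-th character. Lattice coordinates of two representatives of a coset differ
    by integers, so the exponential does not depend on the representative selected by
    \<open>SOME\<close>.\<close>
  define E where "E k C = exp (2 * pi * \<i> * of_real ((matrix_inv M *v (SOME c. c \<in> C)) $ k))" for k C
  have E: "E k (tproj \<Lambda> x) = exp (2 * pi * \<i> * of_real ((matrix_inv M *v x) $ k))" for k x
  proof -
    have "(SOME c. c \<in> tproj \<Lambda> x) \<in> tproj \<Lambda> x"
    proof (rule someI[of "\<lambda>c. c \<in> tproj \<Lambda> x"])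
      show "x \<in> tproj \<Lambda> x" unfolding tproj_def using lattice_closed(1)[OF L] by force
    qed
    then obtain z where z: "z \<in> int_vectors" "(SOME c. c \<in> tproj \<Lambda> x) = x + M *v z"
      by (auto simp: tproj_def M lattice_of_def)
    obtain m where m: "z $ k = of_int m" using z(1) by (auto simp: int_vectors_def elim: Ints_cases)
    have "matrix_inv M *v (SOME c. c \<in> tproj \<Lambda> x) = matrix_inv M *v x + z"
      by (simp add: z matrix_vector_right_distrib matrix_vector_mul_assoc matrix_inv_left_right[OF M(2)])
    then have "E k (tproj \<Lambda> x) = exp (2 * pi * \<i> * of_real ((matrix_inv M *v x) $ k + of_int m))"
      by (simp add: E_def m)
    also have "\<dots> = exp (2 * pi * \<i> * of_real ((matrix_inv M *v x) $ k))"
      by (subst exp_eq) (auto simp: algebra_simps intro!: exI[of _ m])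
    finally show ?thesis .
  qed
  have contE: "continuous_map (torus_top \<Lambda>) euclidean (E k)" for k
  proof (rule continuous_compose_quotient_map[OF quotient_map_tproj[OF L]])
    have "continuous_on UNIV (\<lambda>x. E k (tproj \<Lambda> x))"
      unfolding E by (intro continuous_intros)
    then show "continuous_map euclidean euclidean (E k \<circ> tproj \<Lambda>)" by (simp add: o_def)
  qed
  have "\<exists>g. continuous_on U g \<and> (\<forall>u\<in>U. E k (\<phi> u) = exp (g u))" for k
  proof -
    have "continuous_map (top_of_set U) euclidean (E k \<circ> \<phi>)"
      using \<phi> contE continuous_map_compose by blast
    then have "continuous_on U (\<lambda>u. E k (\<phi> u))" by (simp add: o_def)
    moreover have "E k (\<phi> u) \<noteq> 0" for u by (simp add: E_def)
    ultimately obtain g where "continuous_on U g" "\<And>u. u \<in> U \<Longrightarrow> E k (\<phi> u) = exp (g u)"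
      using continuous_logarithm_on_contractible[OF _ U, of "\<lambda>u. E k (\<phi> u)"] by metis
    then show ?thesis by blast
  qed
  then obtain g where g: "\<And>k. continuous_on U (g k)" "\<And>k u. u \<in> U \<Longrightarrow> E k (\<phi> u) = exp (g k u)" by metis
  \<comment> \<open>The imaginary parts of the logarithms, divided by 2 pi, recover the lattice
    coordinates modulo integers.\<close>
  let ?G = "\<lambda>u. (\<chi> k. Im (g k u) / (2 * pi)) :: real^'n"
  show ?thesis
  proof (rule that[of "\<lambda>u. M *v ?G u"])
    show "continuous_on U (\<lambda>u. M *v ?G u)"
      by (intro continuous_intros g) auto
    fix u assume u: "u \<in> U"
    then have "\<phi> u \<in> range (tproj \<Lambda>)"
      using continuous_map_image_subset_topspace[OF \<phi>] by (auto simp: mspace_flat_torus[OF L])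
    then obtain y where y: "\<phi> u = tproj \<Lambda> y" by blast
    have "\<exists>m::int. Im (g k u) / (2 * pi) = (matrix_inv M *v y) $ k + of_int m" for k
    proof -
      have "exp (g k u) = exp (2 * pi * \<i> * of_real ((matrix_inv M *v y) $ k))"
        using g(2)[OF u, of k] by (simp add: y E)
      then obtain m :: int where "g k u = 2 * pi * \<i> * of_real ((matrix_inv M *v y) $ k) + of_real (of_int (2 * m) * pi) * \<i>"
        unfolding exp_eq by auto
      then have "Im (g k u) = 2 * pi * (matrix_inv M *v y) $ k + 2 * of_int m * pi" by simp
      then show ?thesis by (intro exI[of _ m]) (simp add: field_simps)
    qed
    then obtain m :: "'n \<Rightarrow> int" where m: "\<And>k. Im (g k u) / (2 * pi) = (matrix_inv M *v y) $ k + of_int (m k)" by metis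
    have "?G u = matrix_inv M *v y + (\<chi> k. of_int (m k))" by (simp add: m vec_eq_iff)
    then have "M *v ?G u - y = M *v (\<chi> k. of_int (m k))"
      by (simp add: matrix_vector_right_distrib matrix_vector_mul_assoc matrix_inv_left_right[OF M(2)])
    also have "\<dots> \<in> \<Lambda>" unfolding M lattice_of_def by (intro imageI) (simp add: int_vectors_def)
    finally show "tproj \<Lambda> (M *v ?G u) = \<phi> u" unfolding y tproj_eq_iff[OF L] .
  qed
qed

text \<open>In lattice coordinates the components of \<open>D\<close> are integer valued, and a
  continuous function with discrete range is constant on a connected set. Uniqueness of lifts and
  homotopy invariance both rest on this.\<close>

lemma lattice_valued_constant:
  fixes D :: "'a::topological_space \<Rightarrow> real^'n"
  assumes L: "\<Lambda> \<in> unit_lattices" and U: "connected U" and D: "continuous_on U D" "\<And>u. u \<in> U \<Longrightarrow> D u \<in> \<Lambda>"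
    and uv: "u \<in> U" "v \<in> U"
  shows "D u = D v"
proof -
  obtain M where M: "\<Lambda> = lattice_of M" "invertible M" using L by (rule unit_latticeE)
  have Z: "(matrix_inv M *v D w) $ k \<in> \<int>" if w: "w \<in> U" for w k
  proof -
    obtain z where z: "z \<in> int_vectors" "D w = M *v z" using D(2)[OF w] by (auto simp: M lattice_of_def)
    then have "matrix_inv M *v D w = z" by (simp add: matrix_vector_mul_assoc matrix_inv_left_right[OF M(2)])
    then show ?thesis using z by (simp add: int_vectors_def)
  qed
  have "(matrix_inv M *v D u) $ k = (matrix_inv M *v D v) $ k" for k
  proof -
    have "(\<lambda>w. (matrix_inv M *v D w) $ k) constant_on U"
    proof (rule continuous_discrete_range_constant[OF U])
      show "continuous_on U (\<lambda>w. (matrix_inv M *v D w) $ k)" by (intro continuous_intros D)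
      fix x assume "x \<in> U"
      then show "\<exists>e>0. \<forall>y. y \<in> U \<and> (matrix_inv M *v D y) $ k \<noteq> (matrix_inv M *v D x) $ k
          \<longrightarrow> e \<le> norm ((matrix_inv M *v D y) $ k - (matrix_inv M *v D x) $ k)"
        by (intro exI[of _ 1]) (auto intro!: Ints_nonzero_abs_ge1 Ints_diff Z)
    qed
    then show ?thesis using uv by (auto simp: constant_on_def)
  qed
  then have "matrix_inv M *v D u = matrix_inv M *v D v" by (simp add: vec_eq_iff)
  then have "M *v (matrix_inv M *v D u) = M *v (matrix_inv M *v D v)" by simp
  then show ?thesis by (simp add: matrix_vector_mul_assoc matrix_inv_left_right[OF M(2)])
qed

lemma is_lift_continuous:
  assumes L: "\<Lambda> \<in> unit_lattices" "\<Lambda>' \<in> unit_lattices" and F: "is_lift \<Lambda> \<Lambda>' F \<phi>"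
  shows "continuous_map (torus_top \<Lambda>) (torus_top \<Lambda>') \<phi>"
proof (rule continuous_compose_quotient_map[OF quotient_map_tproj[OF L(1)]])
  have "continuous_map euclidean euclidean F" using F by (simp add: is_lift_iff)
  then have "continuous_map euclidean (torus_top \<Lambda>') (tproj \<Lambda>' \<circ> F)"
    using quotient_imp_continuous_map[OF quotient_map_tproj[OF L(2)]] continuous_map_compose by blast
  moreover have "tproj \<Lambda>' \<circ> F = \<phi> \<circ> tproj \<Lambda>" using F by (auto simp: is_lift_iff)
  ultimately show "continuous_map euclidean (torus_top \<Lambda>') (\<phi> \<circ> tproj \<Lambda>)" by simp
qed

lemma is_lift_exists:
  fixes \<phi> :: "(real^'n) set \<Rightarrow> (real^'n) set"
  assumes L: "\<Lambda> \<in> unit_lattices" "\<Lambda>' \<in> unit_lattices" and \<phi>: "continuous_map (torus_top \<Lambda>) (torus_top \<Lambda>') \<phi>"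
  obtains F where "is_lift \<Lambda> \<Lambda>' F \<phi>"
proof -
  have "continuous_map euclidean (torus_top \<Lambda>') (\<phi> \<circ> tproj \<Lambda>)"
    using quotient_imp_continuous_map[OF quotient_map_tproj[OF L(1)]] \<phi> continuous_map_compose by blast
  then have *: "continuous_map (top_of_set UNIV) (torus_top \<Lambda>') (\<phi> \<circ> tproj \<Lambda>)" by simp
  obtain F where "continuous_on UNIV F" "\<And>u. tproj \<Lambda>' (F u) = (\<phi> \<circ> tproj \<Lambda>) u"
    using torus_map_lift[OF L(2) _ *] convex_imp_contractible[OF convex_UNIV] by (metis UNIV_I)
  then show ?thesis by (intro that[of F]) (simp add: is_lift_iff)
qed

lemma is_lift_diff_constant:
  assumes L: "\<Lambda> \<in> unit_lattices" "\<Lambda>' \<in> unit_lattices" and F: "is_lift \<Lambda> \<Lambda>' F \<phi>" "is_lift \<Lambda> \<Lambda>' G \<phi>"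
  obtains c where "c \<in> \<Lambda>'" "\<And>x. G x = F x + c"
proof (rule that)
  have *: "G x - F x \<in> \<Lambda>'" for x
    using F by (simp add: is_lift_iff flip: tproj_eq_iff[OF L(2)])
  then show "G 0 - F 0 \<in> \<Lambda>'" .
  have "continuous_on UNIV (\<lambda>x. G x - F x)" using F by (auto simp: is_lift_iff intro: continuous_intros)
  then have "G x - F x = G 0 - F 0" for x
    using lattice_valued_constant[OF L(2) connected_UNIV, of "\<lambda>x. G x - F x"] * by blast
  then show "G x = F x + (G 0 - F 0)" for x by (metis diff_add_cancel add.commute)
qed

text \<open>The linear extension of the map induced on fundamental groups by the map of tori with lift \<open>F\<close>.\<close>

definition deck :: "(real^'n) set \<Rightarrow> (real^'n \<Rightarrow> real^'n) \<Rightarrow> real^'n^'n \<Rightarrow> bool" where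
  "deck \<Lambda> F A \<longleftrightarrow> (\<forall>x. \<forall>l\<in>\<Lambda>. F (x + l) = F x + A *v l)"

lemma deckD: "deck \<Lambda> F A \<Longrightarrow> l \<in> \<Lambda> \<Longrightarrow> F (x + l) = F x + A *v l"
  by (simp add: deck_def)

text \<open>The increment of \<open>F\<close> under translation by \<open>l\<close> covers equal
  points of the target torus, so it is lattice valued and continuous in x.\<close>

lemma lift_translation_constant:
  fixes F :: "real^'n \<Rightarrow> real^'n"
  assumes L: "\<Lambda> \<in> unit_lattices" "\<Lambda>' \<in> unit_lattices" and F: "is_lift \<Lambda> \<Lambda>' F \<phi>" and l: "l \<in> \<Lambda>"
  shows "F (x + l) - F x = F l - F 0" "F l - F 0 \<in> \<Lambda>'"
proof -
  have in': "F (x + l) - F x \<in> \<Lambda>'" for x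
  proof -
    have "tproj \<Lambda> (x + l) = tproj \<Lambda> x" using l by (simp add: tproj_eq_iff[OF L(1)])
    then have "tproj \<Lambda>' (F (x + l)) = tproj \<Lambda>' (F x)" using F by (simp add: is_lift_iff)
    then show ?thesis by (simp add: tproj_eq_iff[OF L(2)])
  qed
  have cF: "continuous_on UNIV F" using F by (simp add: is_lift_iff)
  have "continuous_on UNIV (\<lambda>x. F (x + l))"
    by (rule continuous_on_compose2[OF cF]) (auto intro: continuous_intros)
  then have "continuous_on UNIV (\<lambda>x. F (x + l) - F x)" using cF by (intro continuous_intros)
  then have "F (x + l) - F x = F (0 + l) - F 0"
    using lattice_valued_constant[OF L(2) connected_UNIV, of "\<lambda>x. F (x + l) - F x"] in' by blast
  then show "F (x + l) - F x = F l - F 0" by simp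
  show "F l - F 0 \<in> \<Lambda>'" using in'[of 0] by simp
qed

text \<open>Increments of \<open>F\<close> are additive along the lattice, so their values on a
  basis determine a linear map, and induction over integer combinations gives the identity for every
  lattice vector.\<close>

lemma deck_exists:
  fixes F :: "real^'n \<Rightarrow> real^'n"
  assumes L: "\<Lambda> \<in> unit_lattices" "\<Lambda>' \<in> unit_lattices" and F: "is_lift \<Lambda> \<Lambda>' F \<phi>"
  obtains A where "deck \<Lambda> F A"
proof -
  obtain M where M: "\<Lambda> = lattice_of M" "invertible M" using L(1) by (rule unit_latticeE)
  have Mb: "M *v axis i 1 \<in> \<Lambda>" for i unfolding M lattice_of_def using int_vectors_closed(4) by blast
  \<comment> \<open>The columns are the increments of \<open>F\<close> along the basis of the
    lattice; composing with \<open>matrix_inv M\<close> turns basis coordinates into standard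
    ones.\<close>
  define C where "C = (\<chi> i j. (F (M *v axis j 1) - F 0) $ i)"
  define A where "A = C ** matrix_inv M"
  have "A *v (M *v axis i 1) = C *v ((matrix_inv M ** M) *v axis i 1)" for i
    by (simp only: A_def matrix_vector_mul_assoc matrix_mul_assoc)
  then have "A *v (M *v axis i 1) = C *v axis i 1" for i
    by (simp only: matrix_inv_left_right[OF M(2)] matrix_vector_mul_lid)
  then have A: "A *v (M *v axis i 1) = F (M *v axis i 1) - F 0" for i
    unfolding matrix_vector_mult_basis[of C] by (simp add: C_def column_def vec_eq_iff)
  have step: "F (x + M *v axis i 1) = F x + A *v (M *v axis i 1)" for x i
    using lift_translation_constant(1)[OF L F Mb, of x i] unfolding A by (simp add: algebra_simps)
  have "\<forall>x. F (x + M *v z) = F x + A *v (M *v z)" if "z \<in> int_vectors" for z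
    using that
  proof (induction z rule: int_vectors_induct)
    case zero
    show ?case by simp
  next
    case (plus z i)
    have "F (x + M *v (z + axis i 1)) = F (x + M *v z + M *v axis i 1)" for x
      by (simp add: matrix_vector_right_distrib add.assoc)
    then show ?case unfolding step using plus by (simp add: matrix_vector_right_distrib add.assoc)
  next
    case (minus z i)
    have "F (x + M *v (z - axis i 1)) = F x + A *v (M *v (z - axis i 1))" for x
    proof -
      have "x + M *v z = (x + M *v (z - axis i 1)) + M *v axis i 1"
        by (simp add: matrix_vector_mult_diff_distrib)
      then have "F (x + M *v z) = F (x + M *v (z - axis i 1)) + A *v (M *v axis i 1)" by (metis step)
      then show ?thesis using minus by (simp add: matrix_vector_mult_diff_distrib algebra_simps)
    qed
    then show ?case by blast
  qed
  then have "deck \<Lambda> F A" unfolding deck_def M lattice_of_def by blast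
  then show ?thesis by (rule that)
qed

lemma matrix_eq_on_lattice:
  assumes L: "\<Lambda> \<in> unit_lattices" and eq: "\<And>l. l \<in> \<Lambda> \<Longrightarrow> A *v l = B *v l"
  shows "A = B"
proof -
  obtain M where M: "\<Lambda> = lattice_of M" "invertible M" using L by (rule unit_latticeE)
  have "(A ** M) *v axis i 1 = (B ** M) *v axis i 1" for i
    unfolding matrix_vector_mul_assoc[symmetric]
    by (rule eq) (auto simp: M lattice_of_def int_vectors_closed)
  then have "A ** M = B ** M" by (simp add: matrix_vector_mult_basis column_def vec_eq_iff)
  then have "A ** (M ** matrix_inv M) = B ** (M ** matrix_inv M)" by (simp only: matrix_mul_assoc)
  then show ?thesis by (simp add: matrix_inv_left_right[OF M(2)])
qed

lemma deck_unique:
  assumes "\<Lambda> \<in> unit_lattices" "deck \<Lambda> F A" "deck \<Lambda> F B"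
  shows "A = B"
  using assms(1) by (rule matrix_eq_on_lattice) (metis add_left_cancel assms(2,3) deckD)

lemma deck_in_lattice:
  assumes L: "\<Lambda> \<in> unit_lattices" "\<Lambda>' \<in> unit_lattices" and F: "is_lift \<Lambda> \<Lambda>' F \<phi>" and A: "deck \<Lambda> F A" and l: "l \<in> \<Lambda>"
  shows "A *v l \<in> \<Lambda>'"
  using lift_translation_constant(2)[OF L F l] deckD[OF A l, of 0] by simp

lemma is_lift_compose:
  assumes "is_lift \<Lambda> \<Lambda>' F \<phi>" "is_lift \<Lambda>' \<Lambda>'' G \<psi>"
  shows "is_lift \<Lambda> \<Lambda>'' (G \<circ> F) (\<psi> \<circ> \<phi>)"
  using assms unfolding is_lift_iff by (auto intro: continuous_on_compose2[of UNIV G])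

lemma deck_compose:
  assumes L: "\<Lambda> \<in> unit_lattices" "\<Lambda>' \<in> unit_lattices" and F: "is_lift \<Lambda> \<Lambda>' F \<phi>" "deck \<Lambda> F A" "deck \<Lambda>' G B"
  shows "deck \<Lambda> (G \<circ> F) (B ** A)"
  unfolding deck_def
  using deck_in_lattice[OF L F(1,2)] by (auto simp: deckD[OF F(2)] deckD[OF F(3)] matrix_vector_mul_assoc)

lemma is_lift_add_const:
  assumes L: "\<Lambda>' \<in> unit_lattices" and F: "is_lift \<Lambda> \<Lambda>' F \<phi>" and c: "c \<in> \<Lambda>'"
  shows "is_lift \<Lambda> \<Lambda>' (\<lambda>x. F x + c) \<phi>"
proof -
  have "tproj \<Lambda>' (F x + c) = tproj \<Lambda>' (F x)" for x using c by (simp add: tproj_eq_iff[OF L])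
  then show ?thesis using F unfolding is_lift_iff by (auto intro: continuous_intros)
qed

lemma is_lift_cong:
  assumes "is_lift \<Lambda> \<Lambda>' F \<phi>" "\<And>x. \<phi> (tproj \<Lambda> x) = \<psi> (tproj \<Lambda> x)"
  shows "is_lift \<Lambda> \<Lambda>' F \<psi>"
  using assms by (simp add: is_lift_iff)

text \<open>The homotopy is lifted on the whole strip. The increment along a fixed lattice vector is
  lattice valued and continuous in the time parameter, hence constant, and the two end slices differ
  from \<open>F\<close> and \<open>G\<close> only by translations.\<close>

lemma deck_homotopic:
  fixes F G :: "real^'n \<Rightarrow> real^'n"
  assumes L: "\<Lambda> \<in> unit_lattices" "\<Lambda>' \<in> unit_lattices"
    and hom: "homotopic_with (\<lambda>_. True) (torus_top \<Lambda>) (torus_top \<Lambda>') \<phi> \<psi>"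
    and F: "is_lift \<Lambda> \<Lambda>' F \<phi>" "deck \<Lambda> F A" and G: "is_lift \<Lambda> \<Lambda>' G \<psi>" "deck \<Lambda> G B"
  shows "A = B"
proof -
  obtain h where h: "continuous_map (prod_topology (top_of_set {0..1::real}) (torus_top \<Lambda>)) (torus_top \<Lambda>') h"
    "\<And>C. h (0, C) = \<phi> C" "\<And>C. h (1, C) = \<psi> C"
    using hom by (auto simp: homotopic_with_def)
  let ?U = "{0..1::real} \<times> (UNIV :: (real^'n) set)"
  let ?q = "\<lambda>(t, x). (t, tproj \<Lambda> x)"
  have hq: "continuous_map (top_of_set ?U) (torus_top \<Lambda>') (h \<circ> ?q)"
    using quotient_imp_continuous_map[OF quotient_map_interval_tproj[OF L(1)]] h(1) continuous_map_compose by blast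
  have cU: "convex ?U" by (intro convex_Times) auto
  obtain H where H: "continuous_on ?U H" "\<And>u. u \<in> ?U \<Longrightarrow> tproj \<Lambda>' (H u) = (h \<circ> ?q) u"
    using torus_map_lift[OF L(2) convex_imp_contractible[OF cU] hq] by blast
  have slice: "is_lift \<Lambda> \<Lambda>' (\<lambda>x. H (t, x)) (\<lambda>C. h (t, C))" if "t \<in> {0..1}" for t
    unfolding is_lift_iff
  proof (intro conjI allI)
    show "continuous_on UNIV (\<lambda>x. H (t, x))"
      by (rule continuous_on_compose2[OF H(1)]) (use that in \<open>auto intro!: continuous_intros\<close>)
    show "tproj \<Lambda>' (H (t, x)) = h (t, tproj \<Lambda> x)" for x using H(2)[of "(t, x)"] that by simp
  qed
  have const: "H (0, l) - H (0, 0) = H (1, l) - H (1, 0)" if l: "l \<in> \<Lambda>" for l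
  proof -
    let ?D = "\<lambda>t. H (t, l) - H (t, 0)"
    have "continuous_on {0..1} (\<lambda>t. H (t, x))" for x
      by (rule continuous_on_compose2[OF H(1)]) (auto intro!: continuous_intros)
    then have "continuous_on {0..1} ?D" by (intro continuous_intros)
    moreover have "?D t \<in> \<Lambda>'" if "t \<in> {0..1}" for t
      using lift_translation_constant(2)[OF L slice[OF that] l] .
    ultimately show ?thesis
      using lattice_valued_constant[OF L(2) connected_Icc, of 0 1 ?D 0 1] by simp
  qed
  have "is_lift \<Lambda> \<Lambda>' (\<lambda>x. H (0, x)) \<phi>" using slice[of 0] by (simp add: h(2))
  then obtain c where c: "\<And>x. H (0, x) = F x + c" using is_lift_diff_constant[OF L F(1)] by metis
  have "is_lift \<Lambda> \<Lambda>' (\<lambda>x. H (1, x)) \<psi>" using slice[of 1] by (simp add: h(3))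
  then obtain c' where c': "\<And>x. H (1, x) = G x + c'" using is_lift_diff_constant[OF L G(1)] by metis
  show "A = B"
    using const deckD[OF F(2), of _ 0] deckD[OF G(2), of _ 0]
    by (intro matrix_eq_on_lattice[OF L(1)]) (simp add: c c')
qed

text \<open>The straight-line homotopy of the lifts descends to the tori: a lattice translation
  moves \<open>F\<close> and \<open>G\<close> by the same vector, hence also every convex
  combination of them.\<close>

lemma homotopic_if_same_deck:
  fixes F G :: "real^'n \<Rightarrow> real^'n"
  assumes L: "\<Lambda> \<in> unit_lattices" "\<Lambda>' \<in> unit_lattices"
    and F: "is_lift \<Lambda> \<Lambda>' F \<phi>" "deck \<Lambda> F A" and G: "is_lift \<Lambda> \<Lambda>' G \<psi>" "deck \<Lambda> G A"
  shows "homotopic_with (\<lambda>_. True) (torus_top \<Lambda>) (torus_top \<Lambda>') \<phi> \<psi>"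
proof -
  let ?K = "\<lambda>t x. (1 - t) *\<^sub>R F x + t *\<^sub>R G x"
  let ?rep = "\<lambda>C. SOME x. tproj \<Lambda> x = C"
  let ?h = "\<lambda>(t, C). tproj \<Lambda>' (?K t (?rep C))"
  have h: "?h (t, tproj \<Lambda> x) = tproj \<Lambda>' (?K t x)" for t x
  proof -
    have "tproj \<Lambda> (?rep (tproj \<Lambda> x)) = tproj \<Lambda> x" by (rule someI[of _ x]) simp
    then have l: "?rep (tproj \<Lambda> x) - x \<in> \<Lambda>" (is "?l \<in> _") by (simp add: tproj_eq_iff[OF L(1)])
    define a where "a = A *v ?l"
    have "F (x + ?l) = F x + a" "G (x + ?l) = G x + a"
      unfolding a_def by (rule deckD[OF F(2) l], rule deckD[OF G(2) l])
    then have "F (?rep (tproj \<Lambda> x)) = F x + a" "G (?rep (tproj \<Lambda> x)) = G x + a" by simp_all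
    then have "?K t (?rep (tproj \<Lambda> x)) - ?K t x = a" by (simp add: algebra_simps)
    also have "a = A *v ?l" by (rule a_def)
    also have "\<dots> \<in> \<Lambda>'" using deck_in_lattice[OF L F l] .
    finally show ?thesis by (simp add: tproj_eq_iff[OF L(2)])
  qed
  have "continuous_map (prod_topology (top_of_set {0..1}) (torus_top \<Lambda>)) (torus_top \<Lambda>') ?h"
  proof (rule continuous_compose_quotient_map[OF quotient_map_interval_tproj[OF L(1)]])
    have "continuous_on UNIV F" "continuous_on UNIV G" using F G by (auto simp: is_lift_iff)
    then have "continuous_on ({0..1::real} \<times> UNIV) (\<lambda>p. F (snd p))" "continuous_on ({0..1::real} \<times> UNIV) (\<lambda>p. G (snd p))"
      by (auto intro!: continuous_on_compose2[of UNIV F] continuous_on_compose2[of UNIV G] continuous_intros)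
    then have "continuous_on ({0..1} \<times> UNIV) (\<lambda>(t, x). ?K t x)"
      unfolding case_prod_unfold by (intro continuous_intros)
    then have "continuous_map (top_of_set ({0..1} \<times> UNIV)) euclidean (\<lambda>(t, x). ?K t x)" by simp
    then have "continuous_map (top_of_set ({0..1} \<times> UNIV)) (torus_top \<Lambda>') (tproj \<Lambda>' \<circ> (\<lambda>(t, x). ?K t x))"
      using quotient_imp_continuous_map[OF quotient_map_tproj[OF L(2)]] continuous_map_compose by blast
    moreover have "tproj \<Lambda>' \<circ> (\<lambda>(t, x). ?K t x) = ?h \<circ> (\<lambda>(t, x). (t, tproj \<Lambda> x))"
      using h by auto
    ultimately show "continuous_map (top_of_set ({0..1} \<times> UNIV)) (torus_top \<Lambda>') (?h \<circ> (\<lambda>(t, x). (t, tproj \<Lambda> x)))"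
      by simp
  qed
  moreover have "?h (0, C) = \<phi> C" "?h (1, C) = \<psi> C" if C: "C \<in> range (tproj \<Lambda>)" for C
  proof -
    obtain x where x: "C = tproj \<Lambda> x" using C by blast
    show "?h (0, C) = \<phi> C" "?h (1, C) = \<psi> C" unfolding x h using F(1) G(1) by (simp_all add: is_lift_iff)
  qed
  ultimately show ?thesis
    by (subst homotopic_with) (auto simp: mspace_flat_torus[OF L(1)] intro!: exI[of _ ?h])
qed

text \<open>A lift of the inverse map can be normalized to be inverse to \<open>F\<close>; the deck
  matrices of the two lifts are then inverse by uniqueness of the deck matrix.\<close>

lemma is_lift_homeomorphism:
  fixes F :: "real^'n \<Rightarrow> real^'n"
  assumes L: "\<Lambda> \<in> unit_lattices" "\<Lambda>' \<in> unit_lattices"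
    and \<phi>: "homeomorphic_map (torus_top \<Lambda>) (torus_top \<Lambda>') \<phi>"
    and F: "is_lift \<Lambda> \<Lambda>' F \<phi>" "deck \<Lambda> F A"
  obtains G where "homeomorphism UNIV UNIV F G" "is_lift \<Lambda>' \<Lambda> G (inv_into (range (tproj \<Lambda>)) \<phi>)"
    "invertible A" "deck \<Lambda>' G (matrix_inv A)" "(*v) A ` \<Lambda> = \<Lambda>'"
proof -
  let ?\<psi> = "inv_into (range (tproj \<Lambda>)) \<phi>"
  have bij: "bij_betw \<phi> (range (tproj \<Lambda>)) (range (tproj \<Lambda>'))"
    using homeomorphic_imp_injective_map[OF \<phi>] homeomorphic_imp_surjective_map[OF \<phi>]
    by (simp add: bij_betw_def mspace_flat_torus L)
  have \<psi>\<phi>: "?\<psi> (\<phi> (tproj \<Lambda> x)) = tproj \<Lambda> x" for x using bij_betw_inv_into_left[OF bij] by simp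
  have \<phi>\<psi>: "\<phi> (?\<psi> (tproj \<Lambda>' x)) = tproj \<Lambda>' x" for x using bij_betw_inv_into_right[OF bij] by simp
  obtain \<theta> where \<theta>: "homeomorphic_maps (torus_top \<Lambda>) (torus_top \<Lambda>') \<phi> \<theta>"
    using \<phi> homeomorphic_map_maps by blast
  have "continuous_map (torus_top \<Lambda>') (torus_top \<Lambda>) ?\<psi>"
  proof (rule continuous_map_eq)
    show "continuous_map (torus_top \<Lambda>') (torus_top \<Lambda>) \<theta>" using \<theta> by (simp add: homeomorphic_maps_def)
    fix C assume "C \<in> topspace (torus_top \<Lambda>')"
    then obtain y where y: "C = tproj \<Lambda>' y" by (auto simp: mspace_flat_torus L)
    have "\<phi> (\<theta> C) = C" "\<theta> C \<in> range (tproj \<Lambda>)"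
      using \<theta> unfolding homeomorphic_maps_def y
      by (auto simp: mspace_flat_torus L image_subset_iff dest!: continuous_map_image_subset_topspace)
    then show "\<theta> C = ?\<psi> C" using bij by (metis bij_betw_inv_into_left)
  qed
  then obtain G0 where G0: "is_lift \<Lambda>' \<Lambda> G0 ?\<psi>" using is_lift_exists L by blast
  have "is_lift \<Lambda> \<Lambda> (G0 \<circ> F) (\<lambda>C. C)"
    by (rule is_lift_cong[OF is_lift_compose[OF F(1) G0]]) (simp add: \<psi>\<phi>)
  moreover have "is_lift \<Lambda> \<Lambda> (\<lambda>x. x) (\<lambda>C. C)" by (simp add: is_lift_iff continuous_intros)
  \<comment> \<open>The composite of the lifts covers the identity, so it is a translation by a
    lattice vector; absorbing that vector into \<open>G0\<close> makes \<open>G\<close> a left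
    inverse.\<close>
  ultimately obtain c where c: "c \<in> \<Lambda>" "\<And>x. x = (G0 \<circ> F) x + c"
    using is_lift_diff_constant[OF L(1,1)] by metis
  define G where "G x = G0 x + c" for x
  have GF: "G (F x) = x" for x using c(2)[of x] by (simp add: G_def)
  have liftG: "is_lift \<Lambda>' \<Lambda> G ?\<psi>" unfolding G_def[abs_def] by (rule is_lift_add_const[OF L(1) G0 c(1)])
  have "is_lift \<Lambda>' \<Lambda>' (F \<circ> G) (\<lambda>C. C)"
    by (rule is_lift_cong[OF is_lift_compose[OF liftG F(1)]]) (simp add: \<phi>\<psi>)
  moreover have id': "is_lift \<Lambda>' \<Lambda>' (\<lambda>x. x) (\<lambda>C. C)" by (simp add: is_lift_iff continuous_intros)
  ultimately obtain c' where c': "\<And>x. (F \<circ> G) x = x + c'"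
    using is_lift_diff_constant[OF L(2,2)] by metis
  \<comment> \<open>The other composite is a translation as well, and it fixes \<open>F 0\<close>
    because G is a left inverse.\<close>
  have "c' = 0" using c'[of "F 0"] by (simp add: GF)
  then have FG: "F (G x) = x" for x using c'[of x] by simp
  have cont: "continuous_on UNIV F" "continuous_on UNIV G" using F(1) liftG by (auto simp: is_lift_iff)
  have hF: "homeomorphism UNIV UNIV F G"
    unfolding homeomorphism_def using GF FG cont surjI[of F G] surjI[of G F] by simp
  obtain B where B: "deck \<Lambda>' G B" using deck_exists[OF L(2,1) liftG] .
  have "deck \<Lambda> (G \<circ> F) (B ** A)" by (rule deck_compose[OF L F B])
  moreover have "deck \<Lambda> (G \<circ> F) (mat 1)" by (simp add: deck_def GF)
  ultimately have BA: "B ** A = mat 1" by (rule deck_unique[OF L(1)])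
  then have AB: "A ** B = mat 1" by (simp add: matrix_left_right_inverse)
  have inv: "invertible A" unfolding invertible_def using AB BA by blast
  have "B = (matrix_inv A ** A) ** B" by (simp add: matrix_inv_left_right[OF inv])
  then have "B = matrix_inv A" unfolding matrix_mul_assoc[symmetric] AB by simp
  moreover have "(*v) A ` \<Lambda> = \<Lambda>'"
  proof
    show "(*v) A ` \<Lambda> \<subseteq> \<Lambda>'" using deck_in_lattice[OF L F] by blast
    show "\<Lambda>' \<subseteq> (*v) A ` \<Lambda>"
    proof
      fix l assume "l \<in> \<Lambda>'"
      then have "B *v l \<in> \<Lambda>" by (rule deck_in_lattice[OF L(2,1) liftG B])
      moreover have "l = A *v (B *v l)" by (simp add: matrix_vector_mul_assoc AB)
      ultimately show "l \<in> (*v) A ` \<Lambda>" by blast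
    qed
  qed
  ultimately show ?thesis using that[OF hF liftG inv] B by simp
qed

section \<open>Linear maps between tori, and Lipschitz estimates for lifts\<close>

lemma image_matrix_tproj: "(*v) A ` tproj \<Lambda> x = tproj ((*v) A ` \<Lambda>) (A *v x)"
  by (auto simp: tproj_def image_image matrix_vector_right_distrib)

lemma is_lift_matrix: "is_lift \<Lambda> ((*v) A ` \<Lambda>) ((*v) A) (image ((*v) A))"
  unfolding is_lift_iff image_matrix_tproj by (auto intro: continuous_intros)

lemma deck_matrix: "deck \<Lambda> ((*v) A) A"
  by (simp add: deck_def matrix_vector_right_distrib)

lemma image_matrix_inv:
  fixes A :: "real^'n^'n"
  assumes "invertible A"
  shows "(*v) (matrix_inv A) ` (*v) A ` S = S" "(*v) A ` (*v) (matrix_inv A) ` S = S"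
  by (auto simp: image_image matrix_vector_mul_assoc matrix_inv_left_right[OF assms])

lemma homeomorphic_map_matrix:
  fixes A :: "real^'n^'n"
  assumes L: "\<Lambda> \<in> unit_lattices" "(*v) A ` \<Lambda> \<in> unit_lattices" and A: "invertible A"
  shows "homeomorphic_map (torus_top \<Lambda>) (torus_top ((*v) A ` \<Lambda>)) (image ((*v) A))"
  unfolding homeomorphic_map_maps
proof (intro exI)
  have "is_lift ((*v) A ` \<Lambda>) \<Lambda> ((*v) (matrix_inv A)) (image ((*v) (matrix_inv A)))"
    using is_lift_matrix[of "(*v) A ` \<Lambda>" "matrix_inv A"] by (simp add: image_matrix_inv[OF A])
  then show "homeomorphic_maps (torus_top \<Lambda>) (torus_top ((*v) A ` \<Lambda>)) (image ((*v) A)) (image ((*v) (matrix_inv A)))"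
    unfolding homeomorphic_maps_def
    by (auto simp: image_matrix_inv[OF A] intro: is_lift_continuous[OF L is_lift_matrix] is_lift_continuous[OF L(2,1)])
qed

text \<open>The projections preserve small distances, so the bound on the tori gives the bound for
  \<open>F\<close> at small scale. Subdividing a segment and adding up the pieces gives it at all
  scales with the same constant.\<close>

lemma lift_Lipschitz:
  fixes F :: "real^'n \<Rightarrow> real^'n"
  assumes L: "\<Lambda> \<in> unit_lattices" "\<Lambda>' \<in> unit_lattices" and F: "is_lift \<Lambda> \<Lambda>' F \<phi>"
    and K: "0 \<le> K" "\<And>x y. mdist (flat_torus \<Lambda>') (\<phi> (tproj \<Lambda> x)) (\<phi> (tproj \<Lambda> y)) \<le> K * mdist (flat_torus \<Lambda>) (tproj \<Lambda> x) (tproj \<Lambda> y)"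
  shows "norm (F x - F y) \<le> K * norm (x - y)"
proof -
  obtain e where e: "e > 0" "\<And>l. l \<in> \<Lambda>' \<Longrightarrow> l \<noteq> 0 \<Longrightarrow> e \<le> norm l" using lattice_discrete[OF L(2)] by blast
  have Ff: "\<phi> (tproj \<Lambda> z) = tproj \<Lambda>' (F z)" for z using F by (simp add: is_lift_iff)
  \<comment> \<open>If \<open>F u - F v\<close> is shorter than e/2, then its nearest lattice vector
    is shorter than e and hence 0, so the torus distance is the Euclidean one.\<close>
  have close: "norm (F u - F v) \<le> K * norm (u - v)" if "norm (F u - F v) < e / 2" for u v
  proof -
    obtain l where l: "l \<in> \<Lambda>'" "infdist (F u - F v) \<Lambda>' = norm (F u - F v - l)" by (rule infdist_lattice_attained[OF L(2)])
    have le: "norm (F u - F v - l) \<le> norm (F u - F v)" using infdist_lattice_le[OF L(2)] l(2) by metis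
    have "norm l \<le> norm (F u - F v - l) + norm (F u - F v)" by norm
    then have "norm l < e" using le that by linarith
    then have "l = 0" using e(2) l(1) by force
    then have "norm (F u - F v) = mdist (flat_torus \<Lambda>') (\<phi> (tproj \<Lambda> u)) (\<phi> (tproj \<Lambda> v))"
      using l(2) by (simp add: Ff mdist_flat_torus[OF L(2)])
    also have "\<dots> \<le> K * infdist (u - v) \<Lambda>" using K(2)[of u v] by (simp add: mdist_flat_torus[OF L(1)])
    also have "\<dots> \<le> K * norm (u - v)" using K(1) by (intro mult_left_mono infdist_lattice_le[OF L(1)])
    finally show ?thesis .
  qed
  have "continuous_on (closed_segment x y) F" using F by (auto simp: is_lift_iff intro: continuous_on_subset)
  then have "uniformly_continuous_on (closed_segment x y) F"
    by (rule compact_uniformly_continuous) (rule compact_segment)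
  then obtain d where d: "d > 0" "\<And>u v. u \<in> closed_segment x y \<Longrightarrow> v \<in> closed_segment x y \<Longrightarrow> dist v u < d \<Longrightarrow> dist (F v) (F u) < e / 2"
    using e(1) unfolding uniformly_continuous_on_def by (metis half_gt_zero)
  obtain N :: nat where N: "norm (x - y) / d < real N" using reals_Archimedean2 by blast
  have N0: "N > 0" using N d(1) by (metis divide_nonneg_pos norm_ge_zero not_less of_nat_0 of_nat_0_less_iff order_less_le_trans gr0I)
  define p where "p k = y + (real k / real N) *\<^sub>R (x - y)" for k
  have pseg: "p k \<in> closed_segment x y" if "k \<le> N" for k
    unfolding closed_segment_commute[of x] in_segment p_def using that N0
    by (intro exI[of _ "real k / real N"]) (simp add: algebra_simps)
  have step: "norm (F (p (Suc k)) - F (p k)) \<le> K * (norm (x - y) / real N)" if k: "Suc k \<le> N" for k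
  proof -
    have diff: "p (Suc k) - p k = (1 / real N) *\<^sub>R (x - y)"
      by (simp add: p_def add_divide_distrib scaleR_add_left)
    then have nd: "norm (p (Suc k) - p k) = norm (x - y) / real N" using N0 by simp
    have "norm (x - y) / real N < d" using N d(1) N0 by (simp add: field_simps)
    then have "dist (F (p (Suc k))) (F (p k)) < e / 2" using k nd by (intro d pseg) (auto simp: dist_norm)
    then show ?thesis using close[of "p (Suc k)" "p k"] nd by (simp add: dist_norm)
  qed
  have "norm (F (p k) - F (p 0)) \<le> real k * (K * (norm (x - y) / real N))" if "k \<le> N" for k
    using that
  proof (induction k)
    case (Suc k)
    have "norm (F (p (Suc k)) - F (p 0)) \<le> norm (F (p (Suc k)) - F (p k)) + norm (F (p k) - F (p 0))" by norm
    also have "\<dots> \<le> K * (norm (x - y) / real N) + real k * (K * (norm (x - y) / real N))"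
      using Suc by (intro add_mono step) auto
    finally show ?case by (simp add: algebra_simps add_divide_distrib)
  qed simp
  from this[of N] N0 show ?thesis by (simp add: p_def)
qed

text \<open>The multiple m v lies within \<open>C\<close> of the lattice; after division by m the
  error is of order 1/m and disappears in the limit.\<close>

lemma norm_matrix_le_from_lattice:
  fixes A :: "real^'n^'n"
  assumes L: "\<Lambda> \<in> unit_lattices" and A: "\<And>l. l \<in> \<Lambda> \<Longrightarrow> norm (A *v l) \<le> K * norm l" and K: "0 \<le> K"
  shows "norm (A *v v) \<le> K * norm v"
proof -
  obtain C where C: "\<And>x. \<exists>l\<in>\<Lambda>. norm (x - l) \<le> C" using lattice_cobounded[OF L] by blast
  obtain B where B: "B > 0" "\<And>x. norm (A *v x) \<le> B * norm x"
    using linear_bounded_pos[OF matrix_vector_mul_linear] by blast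
  have "norm (A *v v) \<le> K * norm v + (K + B) * C * (1 / real (Suc m))" for m
  proof -
    let ?m = "real (Suc m)"
    obtain l where l: "l \<in> \<Lambda>" "norm (?m *\<^sub>R v - l) \<le> C" using C by blast
    have "A *v (?m *\<^sub>R v) = A *v l + A *v (?m *\<^sub>R v - l)" by (simp add: matrix_vector_mult_diff_distrib)
    then have "norm (A *v (?m *\<^sub>R v)) \<le> norm (A *v l) + norm (A *v (?m *\<^sub>R v - l))" by (metis norm_triangle_ineq)
    also have "\<dots> \<le> K * norm l + B * norm (?m *\<^sub>R v - l)" using A[OF l(1)] B(2) by (intro add_mono)
    also have "\<dots> \<le> K * (norm (?m *\<^sub>R v) + C) + B * C"
    proof (intro add_mono mult_left_mono)
      have "norm l \<le> norm (?m *\<^sub>R v) + norm (?m *\<^sub>R v - l)"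
        using norm_triangle_sub[of l "?m *\<^sub>R v"] by (simp only: norm_minus_commute)
      then show "norm l \<le> norm (?m *\<^sub>R v) + C" using l(2) by linarith
    qed (use l B K in auto)
    finally have "?m * norm (A *v v) \<le> ?m * (K * norm v) + (K + B) * C"
      by (simp add: matrix_vector_mult_scaleR del: of_nat_Suc) (simp only: algebra_simps)
    then show ?thesis by (simp add: field_simps)
  qed
  moreover have "(\<lambda>m. K * norm v + (K + B) * C * (1 / real (Suc m))) \<longlonglongrightarrow> K * norm v + (K + B) * C * 0"
    by (intro tendsto_intros LIMSEQ_Suc lim_1_over_n)
  ultimately show ?thesis using LIMSEQ_le_const by fastforce
qed

lemma invertible_matrix_inv: "invertible (A::real^'n^'n) \<Longrightarrow> invertible (matrix_inv A)"
  using matrix_inv_left_right unfolding invertible_def by blast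

lemma matrix_inv_unique:
  fixes A B :: "real^'n^'n"
  assumes "A ** B = mat 1"
  shows "matrix_inv A = B"
proof -
  have inv: "invertible A" using assms matrix_left_right_inverse unfolding invertible_def by blast
  have "matrix_inv A = matrix_inv A ** (A ** B)" by (simp add: assms)
  also have "\<dots> = B" unfolding matrix_mul_assoc by (simp add: matrix_inv_left_right[OF inv])
  finally show ?thesis .
qed

lemma matrix_inv_matrix_inv: "invertible (A::real^'n^'n) \<Longrightarrow> matrix_inv (matrix_inv A) = A"
  by (simp add: matrix_inv_unique matrix_inv_left_right)

section \<open>Period matrices and the Teichmueller space\<close>

lemma det_integer_entries:
  fixes A :: "real^'n^'n"
  assumes "\<And>i j. A $ i $ j \<in> \<int>"
  shows "det A \<in> \<int>"
  unfolding det_def by (intro Ints_sum Ints_mult Ints_prod assms) auto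

text \<open>\<open>N\<close> and its inverse both have integer entries, so \<open>det N\<close> is
  an integer with an integer inverse.\<close>

lemma det_lattice_automorphism:
  fixes N :: "real^'n^'n"
  assumes N: "(*v) N ` int_vectors = int_vectors" and inv: "invertible N"
  shows "\<bar>det N\<bar> = 1"
proof -
  have ent: "det A \<in> \<int>" if "(*v) A ` int_vectors = int_vectors" for A :: "real^'n^'n"
  proof (rule det_integer_entries)
    fix i j
    have "A *v axis j 1 \<in> int_vectors" using that int_vectors_closed(4) by blast
    then show "A $ i $ j \<in> \<int>" unfolding matrix_vector_mult_basis by (simp add: int_vectors_def column_def)
  qed
  have "(*v) (matrix_inv N) ` int_vectors = int_vectors" using image_matrix_inv(1)[OF inv, of int_vectors] N by simp
  then have "det (matrix_inv N) \<in> \<int>" "det N \<in> \<int>" using ent N by auto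
  moreover have "det N * det (matrix_inv N) = 1"
    using matrix_inv_left_right(1)[OF inv] by (metis det_I det_mul)
  ultimately obtain a b :: int where ab: "det N = of_int a" "of_int a * of_int b = (1::real)"
    by (metis Ints_cases)
  then have "a * b = 1" by (metis of_int_eq_1_iff of_int_mult)
  then have "\<bar>a\<bar> = 1" by (metis abs_of_pos abs_mult abs_1 abs_zmult_eq_1)
  then show ?thesis using ab(1) by (metis of_int_1 of_int_abs)
qed

text \<open>Justifies the definite description: lifts of the marking differ by constants, which
  cancel in the defining equation, and injectivity of a lift then determines the columns.\<close>

lemma period_matrix_deck:
  assumes L: "\<Lambda> \<in> unit_lattices" and f: "homeomorphic_map (torus_top \<Lambda>) (torus_top int_vectors) f"
    and F: "is_lift \<Lambda> int_vectors F f" "deck \<Lambda> F B"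
  shows "period_matrix (\<Lambda>, f) = matrix_inv B"
proof -
  note L' = int_vectors_unit_lattice
  obtain G where G: "homeomorphism UNIV UNIV F G" and inv: "invertible B" and im: "(*v) B ` \<Lambda> = int_vectors"
    using is_lift_homeomorphism[OF L L' f F] by metis
  have inj: "F x = F y \<Longrightarrow> x = y" for x y using G by (metis UNIV_I homeomorphism_apply1)
  have axis: "B *v column i (matrix_inv B) = axis i 1" for i
    unfolding matrix_vector_mult_basis[symmetric] by (simp only: matrix_vector_mul_assoc matrix_inv_left_right[OF inv] matrix_vector_mul_lid)
  have col: "column i (matrix_inv B) \<in> \<Lambda>" for i
  proof -
    obtain l where l: "l \<in> \<Lambda>" "axis i 1 = B *v l" using im int_vectors_closed(4) by (metis imageE)
    have "column i (matrix_inv B) = matrix_inv B *v axis i 1" by (simp add: matrix_vector_mult_basis)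
    also have "\<dots> = l" by (simp add: l matrix_vector_mul_assoc matrix_inv_left_right[OF inv])
    finally show ?thesis using l by simp
  qed
  have Fcol: "F (column i (matrix_inv B)) = F 0 + axis i 1" for i
    using deckD[OF F(2) col, of 0 i] axis by simp
  have "g = matrix_inv B" if F': "is_lift \<Lambda> int_vectors F' f" "\<forall>i. F' (column i g) = F' 0 + axis i 1" for g F'
  proof -
    obtain c where c: "\<And>x. F' x = F x + c" using is_lift_diff_constant[OF L L' F(1) F'(1)] by metis
    have "F (column i g) = F (column i (matrix_inv B))" for i using F'(2) Fcol by (simp add: c)
    then have "column i g = column i (matrix_inv B)" for i using inj by blast
    then show ?thesis by (simp add: column_def vec_eq_iff)
  qed
  then show ?thesis
    unfolding period_matrix_def case_prod_conv
    by (intro the_equality) (use F(1) Fcol in blast)+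
qed

lemma marked_torusE:
  assumes "p \<in> marked_tori"
  obtains F where "fst p \<in> unit_lattices" "homeomorphic_map (torus_top (fst p)) (torus_top int_vectors) (snd p)"
    "is_lift (fst p) int_vectors F (snd p)" "deck (fst p) F (matrix_inv (period_matrix p))"
    "invertible (period_matrix p)" "(*v) (period_matrix p) ` int_vectors = fst p"
    "\<bar>det (period_matrix p)\<bar> = 1"
proof -
  note L' = int_vectors_unit_lattice
  obtain \<Lambda> f F where p: "p = (\<Lambda>, f)" and L: "\<Lambda> \<in> unit_lattices"
    and f: "homeomorphic_map (torus_top \<Lambda>) (torus_top int_vectors) f" and F: "is_lift \<Lambda> int_vectors F f"
    using assms by (auto simp: marked_tori_def)
  obtain B where B: "deck \<Lambda> F B" using deck_exists[OF L L' F] .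
  have pm: "period_matrix p = matrix_inv B" unfolding p by (rule period_matrix_deck[OF L f F B])
  have inv: "invertible B" and im: "(*v) B ` \<Lambda> = int_vectors"
    using is_lift_homeomorphism[OF L L' f F B] by metis+
  have invp: "invertible (period_matrix p)" unfolding pm using inv by (rule invertible_matrix_inv)
  have Bp: "matrix_inv (period_matrix p) = B" by (simp add: pm matrix_inv_matrix_inv inv)
  have im': "(*v) (matrix_inv B) ` int_vectors = \<Lambda>" using image_matrix_inv(1)[OF inv, of \<Lambda>] im by simp
  obtain M where M: "\<Lambda> = lattice_of M" "\<bar>det M\<bar> = 1" "invertible M" using L by (rule unit_latticeE)
  \<comment> \<open>Both lattices have covolume 1, so comparing their bases through an automorphism
    of the integer vectors yields determinant of modulus 1.\<close>
  have "(*v) (B ** M) ` int_vectors = int_vectors"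
    using im by (simp add: M lattice_of_def image_image matrix_vector_mul_assoc)
  then have "\<bar>det (B ** M)\<bar> = 1" by (rule det_lattice_automorphism) (simp add: inv M invertible_mult)
  then have "\<bar>det B\<bar> = 1" using M(2) by (simp add: det_mul abs_mult)
  moreover have "det (matrix_inv B) * det B = 1" using matrix_inv_left_right(2)[OF inv] by (metis det_I det_mul)
  ultimately have "\<bar>det (matrix_inv B)\<bar> = 1" by (metis abs_1 abs_mult mult.right_neutral)
  then show ?thesis using that[of F] L f F B invp im' by (simp add: p[symmetric] Bp) (simp add: p pm[unfolded p])
qed

lemma gram_quadratic_form: "u \<bullet> (gram p *v u) = (norm (period_matrix p *v u))\<^sup>2"
  unfolding gram_def
  by (simp only: power2_norm_eq_inner inner_transpose_mult_vec flip: matrix_vector_mul_assoc)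

lemma gram_spd_space: assumes p: "p \<in> marked_tori" shows "gram p \<in> spd_space"
proof -
  have inv: "invertible (period_matrix p)" and d: "\<bar>det (period_matrix p)\<bar> = 1" using p by (auto elim: marked_torusE)
  have "posdef (transpose (period_matrix p) ** mat 1 ** transpose (transpose (period_matrix p)))"
    by (intro posdef_congruence posdef_mat_1 invertible_transposeI inv)
  moreover have "det (gram p) = \<bar>det (period_matrix p)\<bar>\<^sup>2" by (simp add: gram_def det_mul power2_eq_square)
  ultimately show ?thesis by (simp add: spd_space_iff gram_def d)
qed

text \<open>The linear map taking the marked basis of \<open>p\<close> to that of \<open>q\<close>;
  it is the deck matrix of every map in the homotopy class prescribed by the two markings.\<close>

definition transition :: "'n::finite marked_torus \<Rightarrow> 'n marked_torus \<Rightarrow> real^'n^'n" where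
  "transition p q = period_matrix q ** matrix_inv (period_matrix p)"

lemma transition_period: "p \<in> marked_tori \<Longrightarrow> transition p q ** period_matrix p = period_matrix q"
  by (metis marked_torusE matrix_inv_left_right(2) matrix_mul_assoc matrix_mul_rid transition_def)

lemma transition_inverse:
  assumes "p \<in> marked_tori" "q \<in> marked_tori"
  shows "transition q p ** transition p q = mat 1"
  using assms
  by (metis marked_torusE matrix_inv_left_right(1) matrix_mul_assoc transition_def transition_period)

lemma transition_invertible:
  assumes "p \<in> marked_tori" "q \<in> marked_tori"
  shows "invertible (transition p q)" "matrix_inv (transition p q) = transition q p"
proof -
  note t = transition_inverse[OF assms] transition_inverse[OF assms(2,1)]
  show inv: "invertible (transition p q)" unfolding invertible_def using t by blast
  show "matrix_inv (transition p q) = transition q p"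
    using t(2) by (rule matrix_inv_unique)
qed

lemma transition_image:
  assumes p: "p \<in> marked_tori" and q: "q \<in> marked_tori"
  shows "(*v) (transition p q) ` fst p = fst q"
proof -
  have "(*v) (period_matrix p) ` int_vectors = fst p" "(*v) (period_matrix q) ` int_vectors = fst q"
    using p q by (metis marked_torusE)+
  then show ?thesis
    by (simp only: image_image matrix_vector_mul_assoc transition_period[OF p] flip: \<open>_ = fst p\<close>)
qed

lemma transition_det: "p \<in> marked_tori \<Longrightarrow> q \<in> marked_tori \<Longrightarrow> \<bar>det (transition p q)\<bar> = 1"
  by (metis abs_mult det_mul marked_torusE mult.right_neutral transition_period)

text \<open>Maps of tori are homotopic exactly when their deck matrices agree, and the inverse of
  the marking of \<open>q\<close> after the marking of \<open>p\<close> has deck matrix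
  \<open>transition p q\<close>.\<close>

lemma marked_homeo_iff:
  assumes p: "p \<in> marked_tori" and q: "q \<in> marked_tori"
    and F: "is_lift (fst p) (fst q) F \<phi>" "deck (fst p) F A"
  shows "homotopic_with (\<lambda>_. True) (torus_top (fst p)) (torus_top (fst q))
     \<phi> (inv_into (mspace (flat_torus (fst q))) (snd q) \<circ> snd p) \<longleftrightarrow> A = transition p q"
proof -
  obtain Fp where Lp: "fst p \<in> unit_lattices" and Fp: "is_lift (fst p) int_vectors Fp (snd p)"
    "deck (fst p) Fp (matrix_inv (period_matrix p))" using p by (rule marked_torusE)
  obtain Fq where Lq: "fst q \<in> unit_lattices" and fq: "homeomorphic_map (torus_top (fst q)) (torus_top int_vectors) (snd q)"
    and Fq: "is_lift (fst q) int_vectors Fq (snd q)" "deck (fst q) Fq (matrix_inv (period_matrix q))"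
    and invq: "invertible (period_matrix q)"
    using q by (rule marked_torusE)
  note LZ = int_vectors_unit_lattice
  obtain G where G: "is_lift int_vectors (fst q) G (inv_into (range (tproj (fst q))) (snd q))"
    "deck int_vectors G (matrix_inv (matrix_inv (period_matrix q)))"
    using is_lift_homeomorphism[OF Lq LZ fq Fq] by metis
  have ii: "matrix_inv (matrix_inv (period_matrix q)) = period_matrix q"
    by (rule matrix_inv_matrix_inv[OF invq])
  have lift: "is_lift (fst p) (fst q) (G \<circ> Fp) (inv_into (mspace (flat_torus (fst q))) (snd q) \<circ> snd p)"
    using is_lift_compose[OF Fp(1) G(1)] by (simp add: mspace_flat_torus[OF Lq])
  have deck: "deck (fst p) (G \<circ> Fp) (transition p q)"
    using deck_compose[OF Lp LZ Fp G(2)] by (simp add: ii transition_def)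
  show ?thesis
    using deck_homotopic[OF Lp Lq _ F lift deck] homotopic_if_same_deck[OF Lp Lq F lift] deck by blast
qed

text \<open>Polarization: a symmetric matrix whose quadratic form vanishes has vanishing bilinear
  form.\<close>

lemma symmetric_eq_if_quadratic_form_eq:
  fixes X Y :: "real^'n^'n"
  assumes "transpose X = X" "transpose Y = Y" and eq: "\<And>u. u \<bullet> (X *v u) = u \<bullet> (Y *v u)"
  shows "X = Y"
proof -
  let ?D = "X - Y"
  have q: "u \<bullet> (?D *v u) = 0" for u using eq by (simp add: matrix_vector_mult_diff_rdistrib inner_diff_right)
  have sym: "transpose ?D = ?D" using assms by (simp add: transpose_def vec_eq_iff)
  have "u \<bullet> (?D *v v) = 0" for u v
  proof -
    have "(u + v) \<bullet> (?D *v (u + v)) = u \<bullet> (?D *v u) + v \<bullet> (?D *v v) + u \<bullet> (?D *v v) + v \<bullet> (?D *v u)"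
      by (simp add: matrix_vector_right_distrib inner_add_left inner_add_right)
    moreover have "v \<bullet> (?D *v u) = u \<bullet> (?D *v v)" by (metis inner_commute inner_symmetric_matrix sym)
    ultimately show ?thesis by (simp only: q)
  qed
  then have "?D *v v = 0 *v v" for v by (metis inner_eq_zero_iff matrix_vector_mult_0)
  then have "?D = 0" by (simp add: matrix_eq)
  then show ?thesis by simp
qed

text \<open>Equal Gram matrices mean that the two period matrices give equal lengths to every
  coefficient vector, that is, that the map between the two bases preserves norms.\<close>

lemma gram_eq_iff_transition_isometry:
  assumes p: "p \<in> marked_tori" and q: "q \<in> marked_tori"
  shows "gram p = gram q \<longleftrightarrow> (\<forall>v. norm (transition p q *v v) = norm v)"
proof
  have inv: "invertible (period_matrix p)" using p by (rule marked_torusE)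
  assume eq: "gram p = gram q"
  have n: "norm (period_matrix p *v u) = norm (period_matrix q *v u)" for u
    using gram_quadratic_form[of u p] gram_quadratic_form[of u q] eq by (metis norm_ge_zero power2_eq_imp_eq)
  show "\<forall>v. norm (transition p q *v v) = norm v"
  proof
    fix v
    have "transition p q *v v = period_matrix q *v (matrix_inv (period_matrix p) *v v)"
      by (simp add: transition_def matrix_vector_mul_assoc)
    then have "norm (transition p q *v v) = norm (period_matrix p *v (matrix_inv (period_matrix p) *v v))"
      by (simp only: n)
    then show "norm (transition p q *v v) = norm v"
      by (simp add: matrix_vector_mul_assoc matrix_inv_left_right[OF inv])
  qed
next
  assume iso: "\<forall>v. norm (transition p q *v v) = norm v"
  show "gram p = gram q"
  proof (rule symmetric_eq_if_quadratic_form_eq)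
    show "transpose (gram p) = gram p" "transpose (gram q) = gram q"
      by (simp_all add: gram_def matrix_transpose_mul)
    fix u
    have "norm (period_matrix q *v u) = norm (transition p q *v (period_matrix p *v u))"
      by (simp add: matrix_vector_mul_assoc transition_period[OF p])
    then show "u \<bullet> (gram p *v u) = u \<bullet> (gram q *v u)" using iso by (simp add: gram_quadratic_form)
  qed
qed

text \<open>By the hypothesis the straight homotopy from \<open>B\<close> to the identity preserves the complement of \<open>0\<close>.\<close>

lemma orientation_preserving_matrix:
  fixes B :: "real^'n^'n"
  assumes seg: "\<And>t v. 0 \<le> t \<Longrightarrow> t \<le> 1 \<Longrightarrow> (1 - t) *\<^sub>R (B *v v) + t *\<^sub>R v = 0 \<Longrightarrow> v = 0"
  shows "orientation_preserving ((*v) B)"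
proof -
  let ?h = "\<lambda>(t, v). (1 - t) *\<^sub>R (B *v v) + t *\<^sub>R v"
  have cont: "continuous_on ({0..1::real} \<times> UNIV) ?h"
    unfolding case_prod_unfold by (intro continuous_intros)
  have top: "prod_topology (top_of_set {0..1::real}) (euclidean :: (real^'n) topology) = top_of_set ({0..1} \<times> UNIV)"
    by (metis prod_topology_subtopology_eu subtopology_UNIV)
  have "homotopic_with (\<lambda>h. h \<in> - {0} \<rightarrow> - {0}) euclidean euclidean (\<lambda>v. B *v v) id"
    unfolding homotopic_with_def top
  proof (intro exI conjI allI ballI)
    show "continuous_map (top_of_set ({0..1} \<times> UNIV)) euclidean ?h" using cont by simp
    show "?h (0, v) = B *v v" "?h (1, v) = id v" for v by simp_all
    show "(\<lambda>v. ?h (t, v)) \<in> - {0} \<rightarrow> - {0}" if "t \<in> {0..1}" for t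
    proof (rule funcsetI)
      fix v :: "real^'n" assume "v \<in> - {0}"
      then show "?h (t, v) \<in> - {0}" using seg[of t v] that by auto
    qed
  qed
  then have eq: "hom_induced (int CARD('n)) euclidean (- {0}) euclidean (- {0}) (\<lambda>v. B *v v)
    = hom_induced (int CARD('n)) euclidean (- {0}) euclidean (- {0}) id"
    by (rule homology_homotopy_axiom)
  show ?thesis unfolding orientation_preserving_def by (simp add: eq hom_induced_id)
qed

text \<open>A torus with a linear marking; at \<open>tau_matrix \<tau>\<close> this is the
  representative used in \<open>tau_class\<close>.\<close>

definition matrix_torus :: "real^'n^'n \<Rightarrow> 'n::finite marked_torus" where
  "matrix_torus M = (lattice_of M, image ((*v) (matrix_inv M)))"

text \<open>The second hypothesis makes the segment from \<open>M\<close> to the identity consist of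
  invertible matrices. Substituting \<open>M *v w\<close> for v carries it over to the inverse of
  \<open>M\<close>, which is the lift of the marking and must preserve orientation.\<close>

lemma matrix_torus_marked:
  fixes M :: "real^'n^'n"
  assumes d: "\<bar>det M\<bar> = 1"
    and seg: "\<And>t v. 0 \<le> t \<Longrightarrow> t \<le> 1 \<Longrightarrow> (1 - t) *\<^sub>R v + t *\<^sub>R (M *v v) = 0 \<Longrightarrow> v = 0"
  shows "matrix_torus M \<in> marked_tori" "period_matrix (matrix_torus M) = M"
proof -
  have inv: "invertible M" using d by (auto simp: invertible_det_nz)
  have L: "lattice_of M \<in> unit_lattices" using d by (auto simp: unit_lattices_def)
  have im: "(*v) (matrix_inv M) ` lattice_of M = int_vectors"
    by (simp add: lattice_of_def image_matrix_inv[OF inv])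
  have inv': "invertible (matrix_inv M)" using inv by (rule invertible_matrix_inv)
  have homeo: "homeomorphic_map (torus_top (lattice_of M)) (torus_top int_vectors) (image ((*v) (matrix_inv M)))"
    using homeomorphic_map_matrix[OF L _ inv'] by (simp add: im int_vectors_unit_lattice)
  have lift: "is_lift (lattice_of M) int_vectors ((*v) (matrix_inv M)) (image ((*v) (matrix_inv M)))"
    using is_lift_matrix[of "lattice_of M" "matrix_inv M"] by (simp add: im)
  have "orientation_preserving ((*v) (matrix_inv M))"
  proof (rule orientation_preserving_matrix)
    fix t :: real and v :: "real^'n" assume t: "0 \<le> t" "t \<le> 1" and 0: "(1 - t) *\<^sub>R (matrix_inv M *v v) + t *\<^sub>R v = 0"
    have "M *v (matrix_inv M *v v) = v" by (simp add: matrix_vector_mul_assoc matrix_inv_left_right[OF inv])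
    then have "matrix_inv M *v v = 0" using seg[OF t, of "matrix_inv M *v v"] 0 by simp
    then show "v = 0" using invertible_mult_vec_eq_0[OF inv'] by simp
  qed
  then show "matrix_torus M \<in> marked_tori"
    unfolding matrix_torus_def marked_tori_def using L homeo lift by blast
  have "period_matrix (matrix_torus M) = matrix_inv (matrix_inv M)"
    unfolding matrix_torus_def by (rule period_matrix_deck[OF L homeo lift deck_matrix])
  also have "\<dots> = M" by (rule matrix_inv_matrix_inv[OF inv])
  finally show "period_matrix (matrix_torus M) = M" .
qed

text \<open>The symmetric positive square root R of \<open>X\<close> serves as period matrix: R^T R
  = X, and all convex combinations of R with the identity are positive definite, hence
  invertible.\<close>

lemma spd_space_gram_surj:
  fixes X :: "real^'n^'n"
  assumes X: "X \<in> spd_space"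
  obtains p where "p \<in> marked_tori" "gram p = X"
proof -
  obtain R where R: "posdef R" "R ** R = X" using posdef_sqrt X by (metis spd_space_iff)
  have "det R * det R = 1" using X R(2) by (metis det_mul spd_space_iff)
  then have d: "\<bar>det R\<bar> = 1" by (metis abs_1 abs_mult abs_mult_self_eq abs_square_eq_1 power2_eq_square)
  have seg: "v = 0" if "0 \<le> t" "t \<le> 1" "(1 - t) *\<^sub>R v + t *\<^sub>R (R *v v) = 0" for t v
  proof (rule ccontr)
    assume v: "v \<noteq> 0"
    have "0 = v \<bullet> ((1 - t) *\<^sub>R v + t *\<^sub>R (R *v v))" by (simp add: that(3))
    also have "\<dots> = (1 - t) * (v \<bullet> v) + t * (v \<bullet> (R *v v))" by (simp add: inner_add_right)
    also have "\<dots> > 0"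
    proof (cases "t = 0")
      case False
      then show ?thesis using that posdef_pos[OF R(1) v] by (intro add_nonneg_pos) auto
    qed (use v in simp)
    finally show False by simp
  qed
  have g: "gram (matrix_torus R) = X"
    using R by (simp add: gram_def matrix_torus_marked(2)[OF d seg] posdef_def)
  show ?thesis by (rule that[OF matrix_torus_marked(1)[OF d seg] g])
qed

lemma isometric_homeomorphic_map:
  assumes L: "\<Lambda> \<in> unit_lattices" "\<Lambda>' \<in> unit_lattices" and h: "torus_isometry \<Lambda> \<Lambda>' h"
  shows "homeomorphic_map (torus_top \<Lambda>) (torus_top \<Lambda>') h"
    "torus_isometry \<Lambda>' \<Lambda> (inv_into (range (tproj \<Lambda>)) h)"
proof -
  have cont: "continuous_map (torus_top \<Lambda>) (torus_top \<Lambda>') h" if "torus_isometry \<Lambda> \<Lambda>' h" for \<Lambda> \<Lambda>' :: "(real^'a) set" and h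
    using that unfolding torus_isometry_def
    by (intro Lipschitz_continuous_imp_continuous_map)
      (auto simp: Lipschitz_continuous_map_def bij_betw_def intro!: exI[of _ 1])
  let ?k = "inv_into (range (tproj \<Lambda>)) h"
  have bij: "bij_betw h (range (tproj \<Lambda>)) (range (tproj \<Lambda>'))"
    and dist: "\<And>x y. x \<in> range (tproj \<Lambda>) \<Longrightarrow> y \<in> range (tproj \<Lambda>) \<Longrightarrow> mdist (flat_torus \<Lambda>') (h x) (h y) = mdist (flat_torus \<Lambda>) x y"
    using h by (auto simp: torus_isometry_def mspace_flat_torus L)
  have kim: "?k x \<in> range (tproj \<Lambda>)" "h (?k x) = x" if "x \<in> range (tproj \<Lambda>')" for x
    using bij that by (metis bij_betw_def inv_into_into, metis bij_betw_inv_into_right)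
  show k: "torus_isometry \<Lambda>' \<Lambda> ?k"
    unfolding torus_isometry_def mspace_flat_torus[OF L(1)] mspace_flat_torus[OF L(2)]
    using bij_betw_inv_into[OF bij] dist[OF kim(1) kim(1)] kim(2) by auto
  have "homeomorphic_maps (torus_top \<Lambda>) (torus_top \<Lambda>') h ?k"
    unfolding homeomorphic_maps_def using cont[OF h] cont[OF k]
    by (auto simp: mspace_flat_torus L kim bij_betw_inv_into_left[OF bij])
  then show "homeomorphic_map (torus_top \<Lambda>) (torus_top \<Lambda>') h" using homeomorphic_map_maps by blast
qed

text \<open>A lift of an isometry is 1-Lipschitz, and its increments along lattice vectors are given
  by \<open>A\<close>. The same bound for the inverse isometry makes \<open>A\<close> norm
  preserving.\<close>

lemma torus_isometry_lift_norm_le: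
  assumes L: "\<Lambda> \<in> unit_lattices" "\<Lambda>' \<in> unit_lattices" and h: "torus_isometry \<Lambda> \<Lambda>' h"
    and H: "is_lift \<Lambda> \<Lambda>' H h" "deck \<Lambda> H A"
  shows "norm (A *v v) \<le> norm v"
proof -
  have "norm (H x - H y) \<le> 1 * norm (x - y)" for x y
    by (rule lift_Lipschitz[OF L H(1)]) (use h in \<open>auto simp: torus_isometry_def mspace_flat_torus[OF L(1)]\<close>)
  from this[of _ 0] have "norm (A *v l) \<le> 1 * norm l" if "l \<in> \<Lambda>" for l
    using deckD[OF H(2) that, of 0] by (metis add_0 add_diff_cancel_left' diff_zero)
  then have "norm (A *v v) \<le> 1 * norm v" by (rule norm_matrix_le_from_lattice[OF L(1)]) auto
  then show ?thesis by simp
qed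

text \<open>An isometry compatible with the markings has deck matrix \<open>transition p q\<close>,
  and this matrix and its inverse do not increase norms, so it is orthogonal. Conversely, an
  orthogonal transition matrix itself induces such an isometry.\<close>

theorem marking_equiv_iff:
  fixes p q :: "'n::finite marked_torus"
  shows "(p, q) \<in> marking_equiv \<longleftrightarrow> p \<in> marked_tori \<and> q \<in> marked_tori \<and> gram p = gram q"
proof -
  have "(\<exists>h. torus_isometry (fst p) (fst q) h \<and>
      homotopic_with (\<lambda>_. True) (torus_top (fst p)) (torus_top int_vectors) (snd q \<circ> h) (snd p))
      \<longleftrightarrow> gram p = gram q" (is "?lhs \<longleftrightarrow> _") if p: "p \<in> marked_tori" and q: "q \<in> marked_tori"
  proof -
    note LZ = int_vectors_unit_lattice
    let ?T = "transition p q" and ?P = "period_matrix p" and ?Q = "period_matrix q"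
    obtain Fp where Lp: "fst p \<in> unit_lattices" and Fp: "is_lift (fst p) int_vectors Fp (snd p)"
      "deck (fst p) Fp (matrix_inv ?P)" and invp: "invertible ?P" using p by (rule marked_torusE)
    obtain Fq where Lq: "fst q \<in> unit_lattices" and Fq: "is_lift (fst q) int_vectors Fq (snd q)"
      "deck (fst q) Fq (matrix_inv ?Q)" and invq: "invertible ?Q" using q by (rule marked_torusE)
    have dT: "matrix_inv ?Q ** ?T = matrix_inv ?P"
      by (simp add: transition_def matrix_mul_assoc matrix_inv_left_right[OF invq])
    have Tim: "(*v) ?T ` fst p = fst q" using transition_image[OF p q] .
    show ?thesis unfolding gram_eq_iff_transition_isometry[OF p q]
    proof
      assume ?lhs
      then obtain h where h: "torus_isometry (fst p) (fst q) h"
        and hom: "homotopic_with (\<lambda>_. True) (torus_top (fst p)) (torus_top int_vectors) (snd q \<circ> h) (snd p)" by blast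
      note homeo = isometric_homeomorphic_map[OF Lp Lq h]
      obtain H where H: "is_lift (fst p) (fst q) H h"
        using is_lift_exists[OF Lp Lq] homeomorphic_imp_continuous_map[OF homeo(1)] by blast
      obtain A where A: "deck (fst p) H A" using deck_exists[OF Lp Lq H] .
      obtain G where G: "is_lift (fst q) (fst p) G (inv_into (range (tproj (fst p))) h)"
        "deck (fst q) G (matrix_inv A)" and invA: "invertible A"
        using is_lift_homeomorphism[OF Lp Lq homeo(1) H A] by metis
      have "matrix_inv ?Q ** A = matrix_inv ?P"
        by (rule deck_homotopic[OF Lp LZ hom is_lift_compose[OF H Fq(1)] deck_compose[OF Lp Lq H A Fq(2)] Fp])
      then have "?Q ** (matrix_inv ?Q ** A) = ?T" by (simp add: transition_def)
      then have AT: "A = ?T" by (simp add: matrix_mul_assoc matrix_inv_left_right[OF invq])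
      show "\<forall>v. norm (?T *v v) = norm v"
      proof
        fix v
        have "norm (A *v v) \<le> norm v" by (rule torus_isometry_lift_norm_le[OF Lp Lq h H A])
        moreover have "norm (matrix_inv A *v (A *v v)) \<le> norm (A *v v)"
          by (rule torus_isometry_lift_norm_le[OF Lq Lp homeo(2) G])
        ultimately show "norm (?T *v v) = norm v"
          by (simp add: AT[symmetric] matrix_vector_mul_assoc matrix_inv_left_right[OF invA])
      qed
    next
      assume iso: "\<forall>v. norm (?T *v v) = norm v"
      have inf: "infdist (?T *v x) (fst q) = infdist x (fst p)" for x
        unfolding infdist_def Tim[symmetric] image_image dist_norm
        by (simp add: iso flip: matrix_vector_mult_diff_distrib)
      have hm: "homeomorphic_map (torus_top (fst p)) (torus_top (fst q)) (image ((*v) ?T))"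
        using homeomorphic_map_matrix[OF Lp _ transition_invertible(1)[OF p q]] Lq by (simp add: Tim)
      have "torus_isometry (fst p) (fst q) (image ((*v) ?T))"
        unfolding torus_isometry_def
      proof (intro conjI ballI)
        show "bij_betw (image ((*v) ?T)) (mspace (flat_torus (fst p))) (mspace (flat_torus (fst q)))"
          using homeomorphic_imp_injective_map[OF hm] homeomorphic_imp_surjective_map[OF hm] by (simp add: bij_betw_def)
        fix C D assume "C \<in> mspace (flat_torus (fst p))" "D \<in> mspace (flat_torus (fst p))"
        then obtain x y where "C = tproj (fst p) x" "D = tproj (fst p) y" by (auto simp: mspace_flat_torus[OF Lp])
        then show "mdist (flat_torus (fst q)) ((*v) ?T ` C) ((*v) ?T ` D) = mdist (flat_torus (fst p)) C D"
          by (simp add: image_matrix_tproj Tim mdist_flat_torus Lp Lq inf flip: matrix_vector_mult_diff_distrib)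
      qed
      moreover have T: "is_lift (fst p) (fst q) ((*v) ?T) (image ((*v) ?T))"
        using is_lift_matrix[of "fst p" ?T] by (simp add: Tim)
      have "homotopic_with (\<lambda>_. True) (torus_top (fst p)) (torus_top int_vectors) (snd q \<circ> image ((*v) ?T)) (snd p)"
        using homotopic_if_same_deck[OF Lp LZ is_lift_compose[OF T Fq(1)] deck_compose[OF Lp Lq T deck_matrix Fq(2)]] Fp
        by (simp add: dT)
      ultimately show ?lhs by blast
    qed
  qed
  moreover have "(p, q) \<in> marking_equiv \<longleftrightarrow> p \<in> marked_tori \<and> q \<in> marked_tori \<and>
    (\<exists>h. torus_isometry (fst p) (fst q) h \<and>
      homotopic_with (\<lambda>_. True) (torus_top (fst p)) (torus_top int_vectors) (snd q \<circ> h) (snd p))"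
    by (cases p; cases q) (simp add: marking_equiv_def)
  ultimately show ?thesis by blast
qed

lemma marking_class: "p \<in> marked_tori \<Longrightarrow> marking_equiv `` {p} = {q \<in> marked_tori. gram q = gram p}"
  by (auto simp: marking_equiv_iff)

lemma teichE:
  assumes "C \<in> teich"
  obtains p where "p \<in> marked_tori" "C = marking_equiv `` {p}" "teich_to_spd C = gram p"
proof -
  obtain p where p: "p \<in> marked_tori" "C = marking_equiv `` {p}"
    using assms by (auto simp: teich_def elim: quotientE)
  have "gram ` C = {gram p}" unfolding p(2) marking_class[OF p(1)] using p(1) by auto
  then show ?thesis using that p by (simp add: teich_to_spd_def)
qed

lemma teich_to_spd_class: "p \<in> marked_tori \<Longrightarrow> teich_to_spd (marking_equiv `` {p}) = gram p"
proof -
  assume p: "p \<in> marked_tori"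
  have "gram ` (marking_equiv `` {p}) = {gram p}" unfolding marking_class[OF p] using p by auto
  then show ?thesis by (simp add: teich_to_spd_def)
qed

theorem bij_betw_teich_to_spd: "bij_betw teich_to_spd (teich :: 'n::finite marked_torus set set) spd_space"
  unfolding bij_betw_def
proof
  show "inj_on teich_to_spd (teich :: 'n marked_torus set set)"
  proof (rule inj_onI)
    fix C D :: "'n marked_torus set"
    assume "C \<in> teich" "D \<in> teich" and eq: "teich_to_spd C = teich_to_spd D"
    then obtain p q where pq: "p \<in> marked_tori" "C = marking_equiv `` {p}" "teich_to_spd C = gram p"
      "q \<in> marked_tori" "D = marking_equiv `` {q}" "teich_to_spd D = gram q" by (metis teichE)
    then show "C = D" using eq by (simp add: marking_class)
  qed
  show "teich_to_spd ` (teich :: 'n marked_torus set set) = spd_space"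
  proof
    show "teich_to_spd ` (teich :: 'n marked_torus set set) \<subseteq> spd_space"
      using gram_spd_space by (auto elim!: teichE)
    show "spd_space \<subseteq> teich_to_spd ` (teich :: 'n marked_torus set set)"
    proof
      fix X :: "real^'n^'n" assume "X \<in> spd_space"
      then obtain p where p: "p \<in> marked_tori" "gram p = X" by (rule spd_space_gram_surj)
      then have "X = teich_to_spd (marking_equiv `` {p})" by (simp add: teich_to_spd_class)
      moreover have "marking_equiv `` {p} \<in> teich" unfolding teich_def using p(1) by (rule quotientI)
      ultimately show "X \<in> teich_to_spd ` teich" by blast
    qed
  qed
qed

text \<open>\<open>gram\<close> is constant on each class, so the set of values in
  \<open>on_classes\<close> is a singleton and \<open>the_elem\<close> is meaningful.\<close>

lemma on_classes_teich:
  assumes C: "C \<in> teich" and D: "D \<in> teich"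
    and d: "\<And>p q. p \<in> marked_tori \<Longrightarrow> q \<in> marked_tori \<Longrightarrow> d p q = f (gram p) (gram q)"
  shows "on_classes d C D = f (teich_to_spd C) (teich_to_spd D)"
proof -
  obtain p where p: "p \<in> marked_tori" "C = marking_equiv `` {p}" "teich_to_spd C = gram p" using C by (rule teichE)
  obtain q where q: "q \<in> marked_tori" "D = marking_equiv `` {q}" "teich_to_spd D = gram q" using D by (rule teichE)
  have "(\<lambda>(p, q). d p q) ` (C \<times> D) = (\<lambda>_. f (gram p) (gram q)) ` (C \<times> D)"
    unfolding p(2) q(2) marking_class[OF p(1)] marking_class[OF q(1)] by (rule image_cong) (auto simp: d)
  moreover have "(p, q) \<in> C \<times> D"
    unfolding p(2) q(2) marking_class[OF p(1)] marking_class[OF q(1)] using p(1) q(1) by simp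
  ultimately have "(\<lambda>(p, q). d p q) ` (C \<times> D) = {f (gram p) (gram q)}" by (simp add: image_constant)
  then show ?thesis by (simp add: on_classes_def p(3) q(3))
qed

lemma on_spd_teich:
  assumes X: "X \<in> spd_space" and Y: "Y \<in> spd_space"
    and d: "\<And>C D. C \<in> teich \<Longrightarrow> D \<in> teich \<Longrightarrow> d C D = f (teich_to_spd C) (teich_to_spd D)"
  shows "on_spd d X Y = f X Y"
proof -
  have im: "teich_to_spd ` (teich :: 'a marked_torus set set) = spd_space"
    using bij_betw_teich_to_spd by (rule bij_betw_imp_surj_on)
  show ?thesis
    unfolding on_spd_def using X Y by (simp add: d inv_into_into[where f = teich_to_spd] f_inv_into_f[where f = teich_to_spd] flip: im)
qed

section \<open>The Thurston metric\<close>

lemma rayleigh_pos: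
  fixes X A :: "real^'n^'n"
  assumes "posdef X" "posdef A" shows "0 < rayleigh X A"
proof -
  obtain u :: "real^'n" where u: "u \<noteq> 0" using vector_choose_size[of 1] by (metis norm_zero zero_neq_one zero_le_one)
  have "0 < rayleigh X A * (u \<bullet> (X *v u))"
    using posdef_pos[OF assms(2) u] rayleigh_bound[OF assms(1), of u A] by linarith
  then show ?thesis using posdef_pos[OF assms(1) u] by (simp add: zero_less_mult_iff)
qed

lemma posdef_gram: "p \<in> marked_tori \<Longrightarrow> posdef (gram p)"
  by (metis gram_spd_space spd_space_iff)

text \<open>In the coordinates of the marked basis of \<open>p\<close>, the squared stretch of the
  transition map is the quotient of the two Gram forms. Together with
  \<open>sqrt_rayleigh_gram_le\<close>, this identifies its operator norm with the square root of
  \<open>rayleigh\<close>.\<close>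

lemma norm_transition_le:
  assumes p: "p \<in> marked_tori" and q: "q \<in> marked_tori"
  shows "norm (transition p q *v v) \<le> sqrt (rayleigh (gram p) (gram q)) * norm v"
proof -
  have inv: "invertible (period_matrix p)" using p by (rule marked_torusE)
  let ?u = "matrix_inv (period_matrix p) *v v"
  have v: "v = period_matrix p *v ?u" by (simp add: matrix_vector_mul_assoc matrix_inv_left_right[OF inv])
  have "transition p q *v v = period_matrix q *v ?u" by (simp add: transition_def matrix_vector_mul_assoc)
  then have "(norm (transition p q *v v))\<^sup>2 \<le> rayleigh (gram p) (gram q) * (norm v)\<^sup>2"
    using rayleigh_bound[OF posdef_gram[OF p], of ?u "gram q"] v by (simp only: gram_quadratic_form)
  then have "sqrt ((norm (transition p q *v v))\<^sup>2) \<le> sqrt (rayleigh (gram p) (gram q) * (norm v)\<^sup>2)"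
    by (rule real_sqrt_le_mono)
  then show ?thesis by (simp add: real_sqrt_mult)
qed

lemma sqrt_rayleigh_gram_le:
  assumes p: "p \<in> marked_tori" and q: "q \<in> marked_tori"
    and K: "0 \<le> K" "\<And>v. norm (transition p q *v v) \<le> K * norm v"
  shows "sqrt (rayleigh (gram p) (gram q)) \<le> K"
proof -
  have "rayleigh (gram p) (gram q) \<le> K\<^sup>2"
  proof (rule rayleigh_le[OF posdef_gram[OF p]])
    fix u
    have "norm (period_matrix q *v u) \<le> K * norm (period_matrix p *v u)"
      using K(2)[of "period_matrix p *v u"] by (simp add: matrix_vector_mul_assoc transition_period[OF p])
    then show "u \<bullet> (gram q *v u) \<le> K\<^sup>2 * (u \<bullet> (gram p *v u))"
      unfolding gram_quadratic_form power_mult_distrib[symmetric] by (rule power_mono) simp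
  qed
  then show ?thesis using K(1) by (simp add: real_le_lsqrt)
qed

text \<open>Guarantees distinct points, so that the supremum defining \<open>lipschitz_const\<close>
  is over a nonempty set.\<close>

lemma flat_torus_nontrivial:
  assumes L: "\<Lambda> \<in> unit_lattices"
  obtains x where "tproj \<Lambda> x \<noteq> tproj \<Lambda> 0"
proof -
  obtain e where e: "e > 0" "\<And>l. l \<in> \<Lambda> \<Longrightarrow> l \<noteq> 0 \<Longrightarrow> e \<le> norm l" using lattice_discrete[OF L] by metis
  obtain x :: "real^'a" where x: "norm x = e / 2" using vector_choose_size[of "e / 2"] e(1) by auto
  have "x \<notin> \<Lambda>" using e(1) e(2)[of x] x by force
  then have "tproj \<Lambda> x \<noteq> tproj \<Lambda> 0" by (simp add: tproj_eq_iff[OF L])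
  then show ?thesis by (rule that)
qed

text \<open>The real-valued \<open>Sup\<close> is a genuine upper bound only for a set that is
  bounded above, and this is what the Lipschitz assumption provides.\<close>

lemma lipschitz_const_bound:
  assumes L: "\<Lambda> \<in> unit_lattices" and \<phi>: "Lipschitz_continuous_map (flat_torus \<Lambda>) (flat_torus \<Lambda>') \<phi>"
  shows "0 \<le> lipschitz_const \<Lambda> \<Lambda>' \<phi>"
    "mdist (flat_torus \<Lambda>') (\<phi> (tproj \<Lambda> x)) (\<phi> (tproj \<Lambda> y)) \<le> lipschitz_const \<Lambda> \<Lambda>' \<phi> * mdist (flat_torus \<Lambda>) (tproj \<Lambda> x) (tproj \<Lambda> y)"
proof -
  let ?r = "\<lambda>x y. mdist (flat_torus \<Lambda>') (\<phi> x) (\<phi> y) / mdist (flat_torus \<Lambda>) x y"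
  let ?S = "{?r x y |x y. x \<in> mspace (flat_torus \<Lambda>) \<and> y \<in> mspace (flat_torus \<Lambda>) \<and> x \<noteq> y}"
  obtain B where B: "\<And>x y. x \<in> mspace (flat_torus \<Lambda>) \<Longrightarrow> y \<in> mspace (flat_torus \<Lambda>) \<Longrightarrow>
      mdist (flat_torus \<Lambda>') (\<phi> x) (\<phi> y) \<le> B * mdist (flat_torus \<Lambda>) x y"
    using \<phi> unfolding Lipschitz_continuous_map_def by blast
  have pos: "0 < mdist (flat_torus \<Lambda>) x y" if "x \<in> mspace (flat_torus \<Lambda>)" "y \<in> mspace (flat_torus \<Lambda>)" "x \<noteq> y" for x y
    using that mdist_zero[of x _ y] mdist_nonneg[of _ x y] by (metis less_eq_real_def)
  have bdd: "bdd_above ?S"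
  proof (rule bdd_aboveI)
    fix r assume "r \<in> ?S"
    then obtain x y where "r = ?r x y" "x \<in> mspace (flat_torus \<Lambda>)" "y \<in> mspace (flat_torus \<Lambda>)" "x \<noteq> y" by blast
    then show "r \<le> B" using B pos by (simp add: divide_le_eq)
  qed
  have le: "?r x y \<le> lipschitz_const \<Lambda> \<Lambda>' \<phi>" if "x \<in> mspace (flat_torus \<Lambda>)" "y \<in> mspace (flat_torus \<Lambda>)" "x \<noteq> y" for x y
    unfolding lipschitz_const_def by (rule cSup_upper[OF _ bdd]) (use that in blast)
  obtain z where "tproj \<Lambda> z \<noteq> tproj \<Lambda> 0" using flat_torus_nontrivial[OF L] .
  then have "?r (tproj \<Lambda> z) (tproj \<Lambda> 0) \<le> lipschitz_const \<Lambda> \<Lambda>' \<phi>"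
    by (intro le) (auto simp: mspace_flat_torus[OF L])
  then show "0 \<le> lipschitz_const \<Lambda> \<Lambda>' \<phi>" by (meson divide_nonneg_nonneg mdist_nonneg order_trans)
  show "mdist (flat_torus \<Lambda>') (\<phi> (tproj \<Lambda> x)) (\<phi> (tproj \<Lambda> y)) \<le> lipschitz_const \<Lambda> \<Lambda>' \<phi> * mdist (flat_torus \<Lambda>) (tproj \<Lambda> x) (tproj \<Lambda> y)"
  proof (cases "tproj \<Lambda> x = tproj \<Lambda> y")
    case True
    have "\<phi> (tproj \<Lambda> y) \<in> mspace (flat_torus \<Lambda>')"
      using Lipschitz_continuous_map_image[OF \<phi>] by (auto simp: mspace_flat_torus[OF L])
    then have "mdist (flat_torus \<Lambda>') (\<phi> (tproj \<Lambda> y)) (\<phi> (tproj \<Lambda> y)) = 0" by simp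
    moreover have "mdist (flat_torus \<Lambda>) (tproj \<Lambda> y) (tproj \<Lambda> y) = 0" by (simp add: mspace_flat_torus[OF L])
    ultimately show ?thesis unfolding True by simp
  next
    case False
    then show ?thesis using le[of "tproj \<Lambda> x" "tproj \<Lambda> y"] pos[of "tproj \<Lambda> x" "tproj \<Lambda> y"]
      by (simp add: mspace_flat_torus[OF L] divide_le_eq)
  qed
qed

lemma transition_map:
  fixes p q :: "'n::finite marked_torus"
  assumes p: "p \<in> marked_tori" and q: "q \<in> marked_tori"
  defines "T \<equiv> transition p q"
  shows "is_lift (fst p) (fst q) ((*v) T) (image ((*v) T))" "marked_homeo p q (image ((*v) T))"
proof -
  have Lp: "fst p \<in> unit_lattices" and Lq: "fst q \<in> unit_lattices" using p q by (metis marked_torusE)+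
  have Tim: "(*v) T ` fst p = fst q" unfolding T_def by (rule transition_image[OF p q])
  show lift: "is_lift (fst p) (fst q) ((*v) T) (image ((*v) T))"
    using is_lift_matrix[of "fst p" T] by (simp add: Tim)
  have "homeomorphic_map (torus_top (fst p)) (torus_top (fst q)) (image ((*v) T))"
    using homeomorphic_map_matrix[OF Lp, of T] Lq transition_invertible(1)[OF p q, folded T_def] by (simp add: Tim)
  then show "marked_homeo p q (image ((*v) T))"
    using marked_homeo_iff[OF p q lift deck_matrix] by (simp add: marked_homeo_def case_prod_unfold T_def)
qed

lemma marked_homeo_deck:
  assumes p: "p \<in> marked_tori" and q: "q \<in> marked_tori"
    and \<phi>: "marked_homeo p q \<phi>" and F: "is_lift (fst p) (fst q) F \<phi>"
  shows "deck (fst p) F (transition p q)"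
proof -
  have Lp: "fst p \<in> unit_lattices" and Lq: "fst q \<in> unit_lattices" using p q by (metis marked_torusE)+
  obtain A where A: "deck (fst p) F A" using deck_exists[OF Lp Lq F] .
  then have "A = transition p q" using marked_homeo_iff[OF p q F A] \<phi> by (simp add: marked_homeo_def case_prod_unfold)
  then show ?thesis using A by simp
qed

theorem thurston_marked_eq:
  fixes p q :: "'n::finite marked_torus"
  assumes p: "p \<in> marked_tori" and q: "q \<in> marked_tori"
  shows "thurston_marked p q = 1/4 * ln (rayleigh (gram p) (gram q))"
proof -
  let ?T = "transition p q" and ?s = "sqrt (rayleigh (gram p) (gram q))"
  have Lp: "fst p \<in> unit_lattices" and Lq: "fst q \<in> unit_lattices" using p q by (metis marked_torusE)+
  have rpos: "0 < rayleigh (gram p) (gram q)" by (rule rayleigh_pos[OF posdef_gram[OF p] posdef_gram[OF q]])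
  have lower: "?s \<le> lipschitz_const (fst p) (fst q) \<phi>"
    if \<phi>: "marked_homeo p q \<phi>" "Lipschitz_continuous_map (flat_torus (fst p)) (flat_torus (fst q)) \<phi>" for \<phi>
  proof -
    let ?K = "lipschitz_const (fst p) (fst q) \<phi>"
    note K = lipschitz_const_bound[OF Lp \<phi>(2)]
    have cont: "continuous_map (torus_top (fst p)) (torus_top (fst q)) \<phi>"
      using \<phi>(2) by (rule Lipschitz_continuous_imp_continuous_map)
    obtain F where F: "is_lift (fst p) (fst q) F \<phi>" using is_lift_exists[OF Lp Lq cont] .
    have dF: "deck (fst p) F ?T" by (rule marked_homeo_deck[OF p q \<phi>(1) F])
    have "norm (F x - F y) \<le> ?K * norm (x - y)" for x y by (rule lift_Lipschitz[OF Lp Lq F K])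
    from this[of _ 0] have "norm (?T *v l) \<le> ?K * norm l" if "l \<in> fst p" for l
      using deckD[OF dF that, of 0] by (metis add_0 add_diff_cancel_left' diff_zero)
    then have "norm (?T *v v) \<le> ?K * norm v" for v by (rule norm_matrix_le_from_lattice[OF Lp _ K(1)])
    then show ?thesis by (rule sqrt_rayleigh_gram_le[OF p q K(1)])
  qed
  let ?\<phi> = "image ((*v) ?T)"
  note T = transition_map[OF p q]
  have dist: "mdist (flat_torus (fst q)) (?\<phi> C) (?\<phi> D) \<le> ?s * mdist (flat_torus (fst p)) C D"
    if CD: "C \<in> mspace (flat_torus (fst p))" "D \<in> mspace (flat_torus (fst p))" for C D
  proof -
    obtain x y where xy: "C = tproj (fst p) x" "D = tproj (fst p) y" using CD by (auto simp: mspace_flat_torus[OF Lp])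
    obtain l where l: "l \<in> fst p" "infdist (x - y) (fst p) = norm (x - y - l)" by (rule infdist_lattice_attained[OF Lp])
    \<comment> \<open>The lattice vector nearest to \<open>x - y\<close> is carried into the target
      lattice, where it witnesses the upper bound for the distance.\<close>
    have "?T *v l \<in> fst q" using l(1) transition_image[OF p q] by blast
    then have "infdist (?T *v x - ?T *v y) (fst q) \<le> dist (?T *v x - ?T *v y) (?T *v l)" by (rule infdist_le)
    also have "\<dots> = norm (?T *v (x - y - l))" by (simp add: dist_norm matrix_vector_mult_diff_distrib)
    also have "\<dots> \<le> ?s * norm (x - y - l)" by (rule norm_transition_le[OF p q])
    finally show ?thesis
      unfolding xy image_matrix_tproj transition_image[OF p q] mdist_flat_torus[OF Lp] mdist_flat_torus[OF Lq] l(2) .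
  qed
  have Lip: "Lipschitz_continuous_map (flat_torus (fst p)) (flat_torus (fst q)) ?\<phi>"
    unfolding Lipschitz_continuous_map_def
  proof (intro conjI exI ballI)
    show "?\<phi> \<in> mspace (flat_torus (fst p)) \<rightarrow> mspace (flat_torus (fst q))"
      by (auto simp: mspace_flat_torus Lp Lq image_matrix_tproj transition_image[OF p q])
  qed (rule dist)
  have "lipschitz_const (fst p) (fst q) ?\<phi> \<le> ?s"
    unfolding lipschitz_const_def
  proof (rule cSup_least)
    obtain z where "tproj (fst p) z \<noteq> tproj (fst p) 0" using flat_torus_nontrivial[OF Lp] .
    then show "{mdist (flat_torus (fst q)) (?\<phi> x) (?\<phi> y) / mdist (flat_torus (fst p)) x y |x y.
       x \<in> mspace (flat_torus (fst p)) \<and> y \<in> mspace (flat_torus (fst p)) \<and> x \<noteq> y} \<noteq> {}"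
      by (auto simp: mspace_flat_torus[OF Lp])
    fix r assume "r \<in> {mdist (flat_torus (fst q)) (?\<phi> x) (?\<phi> y) / mdist (flat_torus (fst p)) x y |x y.
       x \<in> mspace (flat_torus (fst p)) \<and> y \<in> mspace (flat_torus (fst p)) \<and> x \<noteq> y}"
    then obtain C D where CD: "r = mdist (flat_torus (fst q)) (?\<phi> C) (?\<phi> D) / mdist (flat_torus (fst p)) C D"
      "C \<in> mspace (flat_torus (fst p))" "D \<in> mspace (flat_torus (fst p))" "C \<noteq> D" by blast
    have "0 < mdist (flat_torus (fst p)) C D"
      using CD mdist_zero[OF CD(2,3)] mdist_nonneg[of "flat_torus (fst p)" C D] by linarith
    then show "r \<le> ?s" using dist[OF CD(2,3)] CD(1) by (simp add: divide_le_eq)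
  qed
  then have "lipschitz_const (fst p) (fst q) ?\<phi> = ?s" using lower[OF T(2) Lip] by linarith
  then have "Inf {lipschitz_const (fst p) (fst q) \<phi> |\<phi>.
     marked_homeo p q \<phi> \<and> Lipschitz_continuous_map (flat_torus (fst p)) (flat_torus (fst q)) \<phi>} = ?s"
    using lower T(2) Lip by (intro cInf_eq_minimum) force+
  then show ?thesis using rpos by (simp add: thurston_marked_def ln_sqrt)
qed

theorem thurston_eq:
  assumes "C \<in> teich" "D \<in> teich"
  shows "thurston C D = 1/4 * ln (rayleigh (teich_to_spd C) (teich_to_spd D))"
  unfolding thurston_def using assms by (rule on_classes_teich) (rule thurston_marked_eq)

lemma on_spd_thurston:
  assumes "X \<in> spd_space" "Y \<in> spd_space"
  shows "on_spd thurston X Y = 1/4 * ln (rayleigh X Y)"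
  using assms by (rule on_spd_teich) (rule thurston_eq)

section \<open>Change of variables and absolutely continuous functions\<close>

text \<open>The change of variables theorem of the library requires a well-ordered index type; the
  isomorphic copy \<open>'n wo\<close> of \<open>'n\<close> serves to remove this restriction.\<close>

typedef 'n wo = "UNIV :: 'n set" by auto

instance wo :: (finite) finite
proof
  show "finite (UNIV :: 'a wo set)"
    by (subst type_definition.univ[OF type_definition_wo]) simp
qed

instantiation wo :: (finite) linorder
begin
definition less_eq_wo :: "'a wo \<Rightarrow> 'a wo \<Rightarrow> bool" where "less_eq_wo x y \<longleftrightarrow> to_nat (Rep_wo x) \<le> to_nat (Rep_wo y)"
definition less_wo :: "'a wo \<Rightarrow> 'a wo \<Rightarrow> bool" where "less_wo x y \<longleftrightarrow> to_nat (Rep_wo x) < to_nat (Rep_wo y)"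
instance
proof
  fix x y z :: "'a wo"
  show "x < y \<longleftrightarrow> x \<le> y \<and> \<not> y \<le> x" unfolding less_eq_wo_def less_wo_def by linarith
  show "x \<le> x" unfolding less_eq_wo_def by (rule le_refl)
  show "x \<le> z" if "x \<le> y" "y \<le> z" using that unfolding less_eq_wo_def by linarith
  show "x = y" if "x \<le> y" "y \<le> x"
  proof -
    have "to_nat (Rep_wo x) = to_nat (Rep_wo y)" using that unfolding less_eq_wo_def by linarith
    then have "Rep_wo x = Rep_wo y" by (rule injD[OF inj_to_nat])
    then show ?thesis by (simp only: Rep_wo_inject)
  qed
  show "x \<le> y \<or> y \<le> x" unfolding less_eq_wo_def by linarith
qed
end

instance wo :: (finite) wellorder
proof
  fix P :: "'a wo \<Rightarrow> bool" and a :: "'a wo"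
  assume step: "\<And>x. (\<And>y. y < x \<Longrightarrow> P y) \<Longrightarrow> P x"
  have "\<forall>b. to_nat (Rep_wo b) < m \<longrightarrow> P b" for m
  proof (induction m)
    case (Suc m)
    then show ?case unfolding less_Suc_eq_le using step unfolding less_wo_def
      by (meson less_le_trans)
  qed auto
  then show "P a" by blast
qed

section \<open>Invariance of integrals and determinants under relabelling of coordinates\<close>

definition reindex :: "('m \<Rightarrow> 'n) \<Rightarrow> real^'n \<Rightarrow> real^'m" where
  "reindex \<sigma> x = (\<chi> i. x $ \<sigma> i)"

lemma reindex_nth [simp]: "reindex \<sigma> x $ i = x $ \<sigma> i"
  by (simp add: reindex_def)

lemma reindex_inv [simp]:
  assumes "bij \<sigma>" shows "reindex \<sigma> (reindex (inv_into UNIV \<sigma>) x) = x" "reindex (inv_into UNIV \<sigma>) (reindex \<sigma> y) = y"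
  using assms by (simp_all add: vec_eq_iff bij_is_inj bij_is_surj surj_f_inv_f)

lemma linear_reindex: "linear (reindex \<sigma>)"
  by (intro linearI) (simp_all add: vec_eq_iff)

lemma norm_reindex:
  fixes \<sigma> :: "'m::finite \<Rightarrow> 'n::finite"
  assumes "bij \<sigma>" shows "norm (reindex \<sigma> x) = norm x"
proof -
  have "(\<Sum>i\<in>UNIV. (x $ \<sigma> i)\<^sup>2) = (\<Sum>i\<in>UNIV. (x $ i)\<^sup>2)"
    using sum.reindex_bij_betw[OF assms, of "\<lambda>i. (x $ i)\<^sup>2"] .
  then show ?thesis by (simp add: norm_vec_def L2_set_def)
qed

lemma reindex_image_cbox:
  fixes \<sigma> :: "'m::finite \<Rightarrow> 'n::finite"
  assumes \<sigma>: "bij \<sigma>" shows "reindex \<sigma> ` cbox a b = cbox (reindex \<sigma> a) (reindex \<sigma> b)"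
proof
  show "reindex \<sigma> ` cbox a b \<subseteq> cbox (reindex \<sigma> a) (reindex \<sigma> b)" by (auto simp: mem_box_cart)
  show "cbox (reindex \<sigma> a) (reindex \<sigma> b) \<subseteq> reindex \<sigma> ` cbox a b"
  proof
    fix y assume y: "y \<in> cbox (reindex \<sigma> a) (reindex \<sigma> b)"
    have "a $ j \<le> y $ inv_into UNIV \<sigma> j \<and> y $ inv_into UNIV \<sigma> j \<le> b $ j" for j
      using y \<sigma> by (auto simp: mem_box_cart dest!: spec[of _ "inv_into UNIV \<sigma> j"] simp: bij_is_surj surj_f_inv_f)
    then have "reindex (inv_into UNIV \<sigma>) y \<in> cbox a b" by (simp add: mem_box_cart)
    moreover have "y = reindex \<sigma> (reindex (inv_into UNIV \<sigma>) y)" by (simp add: \<sigma>)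
    ultimately show "y \<in> reindex \<sigma> ` cbox a b" by blast
  qed
qed

lemma content_reindex:
  fixes \<sigma> :: "'m::finite \<Rightarrow> 'n::finite"
  assumes \<sigma>: "bij \<sigma>" shows "measure lborel (reindex \<sigma> ` cbox a b) = measure lborel (cbox a b)"
proof (cases "cbox a b = {}")
  case False
  then have "cbox (reindex \<sigma> a) (reindex \<sigma> b) \<noteq> {}" using reindex_image_cbox[OF \<sigma>, of a b] by auto
  then show ?thesis
    using False prod.reindex_bij_betw[OF \<sigma>, of "\<lambda>i. b $ i - a $ i"]
    by (simp add: reindex_image_cbox[OF \<sigma>] content_cbox_cart)
qed simp

text \<open>Relabelling coordinates maps boxes to boxes of the same content and preserves norms, so
  gauge integrals transfer box by box.\<close>

lemma has_integral_reindex: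
  fixes \<sigma> :: "'m::finite \<Rightarrow> 'n::finite" and h :: "real^'m \<Rightarrow> real"
  assumes \<sigma>: "bij \<sigma>" and h: "(h has_integral m) (reindex \<sigma> ` S)"
  shows "((\<lambda>x. h (reindex \<sigma> x)) has_integral m) S"
proof (subst has_integral', intro allI impI)
  fix e :: real assume "e > 0"
  then obtain B where B: "B > 0" "\<And>a b. ball 0 B \<subseteq> cbox a b \<Longrightarrow>
      \<exists>z. ((\<lambda>x. if x \<in> reindex \<sigma> ` S then h x else 0) has_integral z) (cbox a b) \<and> norm (z - m) < e"
    using iffD1[OF has_integral' h, rule_format, OF \<open>e > 0\<close>] by metis
  have inj: "inj (reindex \<sigma>)" by (rule inj_on_inverseI[of _ "reindex (inv_into UNIV \<sigma>)"]) (simp add: \<sigma>)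
  show "\<exists>B>0. \<forall>a b. ball 0 B \<subseteq> cbox a b \<longrightarrow>
      (\<exists>z. ((\<lambda>x. if x \<in> S then h (reindex \<sigma> x) else 0) has_integral z) (cbox a b) \<and> norm (z - m) < e)"
  proof (rule exI[of _ B], rule conjI[OF B(1)], intro allI impI)
    fix a b :: "real^'n" assume ab: "ball 0 B \<subseteq> cbox a b"
    have "ball 0 B \<subseteq> cbox (reindex \<sigma> a) (reindex \<sigma> b)"
    proof
      fix y :: "real^'m" assume "y \<in> ball 0 B"
      then have "reindex (inv_into UNIV \<sigma>) y \<in> ball 0 B" by (simp add: norm_reindex bij_imp_bij_inv \<sigma>)
      then have "reindex \<sigma> (reindex (inv_into UNIV \<sigma>) y) \<in> reindex \<sigma> ` cbox a b" using ab by blast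
      then show "y \<in> cbox (reindex \<sigma> a) (reindex \<sigma> b)" by (simp add: \<sigma> reindex_image_cbox)
    qed
    from B(2)[OF this] obtain z where z: "((\<lambda>x. if x \<in> reindex \<sigma> ` S then h x else 0) has_integral z) (cbox (reindex \<sigma> a) (reindex \<sigma> b))"
      "norm (z - m) < e" by blast
    \<comment> \<open>The factor 1 / 1 is the ratio of contents demanded by the substitution
      rule.\<close>
    have "((\<lambda>x. if reindex \<sigma> x \<in> reindex \<sigma> ` S then h (reindex \<sigma> x) else 0) has_integral (1 / 1) *\<^sub>R z)
       (reindex (inv_into UNIV \<sigma>) ` cbox (reindex \<sigma> a) (reindex \<sigma> b))"
    proof (rule has_integral_twiddle[OF _ _ _ _ _ _ _ z(1)])
      show "continuous (at x) (reindex \<sigma>)" for x :: "real^'n" by (simp add: linear_continuous_at linear_linear linear_reindex)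
      show "\<exists>w z. reindex \<sigma> ` cbox u v = cbox w z" for u v using reindex_image_cbox[OF \<sigma>] by blast
      show "\<exists>w z. reindex (inv_into UNIV \<sigma>) ` cbox u v = cbox w z" for u v using reindex_image_cbox[OF bij_imp_bij_inv[OF \<sigma>]] by blast
    qed (simp_all add: \<sigma> content_reindex)
    moreover have "reindex (inv_into UNIV \<sigma>) ` cbox (reindex \<sigma> a) (reindex \<sigma> b) = cbox a b"
      by (simp add: reindex_image_cbox bij_imp_bij_inv \<sigma>)
    ultimately have "((\<lambda>x. if x \<in> S then h (reindex \<sigma> x) else 0) has_integral z) (cbox a b)"
      by (simp add: inj_image_mem_iff[OF inj])
    then show "\<exists>z. ((\<lambda>x. if x \<in> S then h (reindex \<sigma> x) else 0) has_integral z) (cbox a b) \<and> norm (z - m) < e"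
      using z(2) by blast
  qed
qed

lemma has_integral_reindex_iff:
  fixes \<sigma> :: "'m::finite \<Rightarrow> 'n::finite" and h :: "real^'m \<Rightarrow> real"
  assumes \<sigma>: "bij \<sigma>"
  shows "((\<lambda>x. h (reindex \<sigma> x)) has_integral m) S \<longleftrightarrow> (h has_integral m) (reindex \<sigma> ` S)"
proof
  assume "((\<lambda>x. h (reindex \<sigma> x)) has_integral m) S"
  moreover have "S = reindex (inv_into UNIV \<sigma>) ` reindex \<sigma> ` S" by (simp add: image_image \<sigma>)
  ultimately have "((\<lambda>x. h (reindex \<sigma> x)) has_integral m) (reindex (inv_into UNIV \<sigma>) ` reindex \<sigma> ` S)" by simp
  from has_integral_reindex[OF bij_imp_bij_inv[OF \<sigma>] this] show "(h has_integral m) (reindex \<sigma> ` S)"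
    by (simp add: \<sigma>)
qed (rule has_integral_reindex[OF \<sigma>])

text \<open>The Leibniz sums correspond under conjugation of permutations by
  \<open>\<sigma>\<close>, which preserves the sign.\<close>

lemma det_reindex:
  fixes \<sigma> :: "'m::finite \<Rightarrow> 'n::finite" and A :: "real^'n^'n"
  assumes \<sigma>: "bij \<sigma>"
  shows "det (\<chi> i j. A $ \<sigma> i $ \<sigma> j) = det A"
proof -
  have mp: "map_permutation UNIV \<sigma> p = \<sigma> \<circ> p \<circ> inv_into UNIV \<sigma>" for p
    using \<sigma> by (simp add: map_permutation_def restrict_id_def bij_is_surj o_def)
  have inv: "inv_into UNIV \<sigma> (\<sigma> x) = x" "\<sigma> (inv_into UNIV \<sigma> y) = y" for x y using \<sigma> by (simp_all add: bij_is_inj bij_is_surj surj_f_inv_f)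
  show ?thesis unfolding det_def
  proof (rule sum.reindex_bij_witness[of _ "\<lambda>q. inv_into UNIV \<sigma> \<circ> q \<circ> \<sigma>" "\<lambda>p. \<sigma> \<circ> p \<circ> inv_into UNIV \<sigma>"])
    fix p :: "'m \<Rightarrow> 'm" assume "p \<in> {p. p permutes UNIV}"
    then have p: "p permutes UNIV" by simp
    show "inv_into UNIV \<sigma> \<circ> (\<sigma> \<circ> p \<circ> inv_into UNIV \<sigma>) \<circ> \<sigma> = p" by (simp add: fun_eq_iff inv)
    have "map_permutation UNIV \<sigma> p permutes UNIV" by (rule map_permutation_permutes[OF \<sigma> p])
    then show "\<sigma> \<circ> p \<circ> inv_into UNIV \<sigma> \<in> {p. p permutes UNIV}" by (simp add: mp)
    have "sign (\<sigma> \<circ> p \<circ> inv_into UNIV \<sigma>) = sign p"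
      using sign_map_permutation[of \<sigma> UNIV p] \<sigma> p by (simp add: mp bij_is_inj)
    moreover have "(\<Prod>i\<in>UNIV. A $ i $ (\<sigma> \<circ> p \<circ> inv_into UNIV \<sigma>) i) = (\<Prod>k\<in>UNIV. A $ \<sigma> k $ \<sigma> (p k))"
      using prod.reindex_bij_betw[OF \<sigma>, of "\<lambda>i. A $ i $ (\<sigma> \<circ> p \<circ> inv_into UNIV \<sigma>) i"] by (simp add: inv)
    ultimately show "of_int (sign (\<sigma> \<circ> p \<circ> inv_into UNIV \<sigma>)) * (\<Prod>i\<in>UNIV. A $ i $ (\<sigma> \<circ> p \<circ> inv_into UNIV \<sigma>) i)
       = of_int (sign p) * (\<Prod>i\<in>UNIV. (\<chi> i j. A $ \<sigma> i $ \<sigma> j) $ i $ p i)" by simp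
  next
    fix q :: "'n \<Rightarrow> 'n" assume "q \<in> {p. p permutes UNIV}"
    then have "bij (inv_into UNIV \<sigma> \<circ> q \<circ> \<sigma>)" using \<sigma> by (intro bij_comp bij_imp_bij_inv) (simp_all add: permutes_bij)
    then show "inv_into UNIV \<sigma> \<circ> q \<circ> \<sigma> \<in> {p. p permutes UNIV}" using bij_imp_permutes[of _ UNIV] by auto
    show "\<sigma> \<circ> (inv_into UNIV \<sigma> \<circ> q \<circ> \<sigma>) \<circ> inv_into UNIV \<sigma> = q" by (simp add: fun_eq_iff inv)
  qed
qed

lemma measure_eq_iff_has_integral:
  "S \<in> lmeasurable \<and> measure lebesgue S = m \<longleftrightarrow> ((\<lambda>x. 1::real) has_integral m) S"
  by (auto simp: has_integral_iff lmeasurable_iff_integrable_on lmeasure_integral)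

text \<open>\<open>F\<close> is conjugated by a relabelling of the coordinates; measures,
  derivatives and determinants all transfer back.\<close>

theorem has_measure_differentiable_image_finite:
  fixes F :: "real^'n::finite \<Rightarrow> real^'n"
  assumes S: "S \<in> sets borel" and F: "\<And>x. x \<in> S \<Longrightarrow> (F has_derivative F' x) (at x within S)" and inj: "inj_on F S"
  shows "F ` S \<in> lmeasurable \<and> measure lebesgue (F ` S) = m
     \<longleftrightarrow> ((\<lambda>x. \<bar>det (matrix (F' x))\<bar>) has_integral m) S"
proof -
  define \<sigma> :: "'n wo \<Rightarrow> 'n" where "\<sigma> = Rep_wo"
  have \<sigma>: "bij \<sigma>" unfolding \<sigma>_def by (metis Abs_wo_inverse Rep_wo_inverse UNIV_I bijI')
  let ?P = "reindex \<sigma>" and ?R = "reindex (inv_into UNIV \<sigma>)"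
  let ?S = "?P ` S" and ?G = "\<lambda>y. ?P (F (?R y))" and ?G' = "\<lambda>y v. ?P (F' (?R y) (?R v))"
  have blP: "bounded_linear ?P" and blR: "bounded_linear ?R" by (simp_all add: linear_linear linear_reindex)
  have "?S = ?R -` S" using \<sigma> by (auto simp: image_iff) (metis reindex_inv(1))
  moreover have "?R \<in> borel_measurable borel" using blR by (simp add: borel_measurable_continuous_onI linear_continuous_on)
  ultimately have "?S \<in> sets lborel" using measurable_sets[of ?R borel borel S] S by simp
  then have S': "?S \<in> sets lebesgue" by simp
  have G: "(?G has_derivative ?G' y) (at y within ?S)" if y: "y \<in> ?S" for y
  proof -
    obtain x where x: "x \<in> S" "y = ?P x" using y by blast
    have RS: "?R ` ?S = S" by (simp add: image_image \<sigma>)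
    have "(?R has_derivative ?R) (at y within ?S)" using blR by (rule bounded_linear_imp_has_derivative)
    moreover have "(F has_derivative F' (?R y)) (at (?R y) within ?R ` ?S)" unfolding RS using F[OF x(1)] by (simp add: x \<sigma>)
    ultimately have "(F \<circ> ?R has_derivative F' (?R y) \<circ> ?R) (at y within ?S)" by (rule diff_chain_within)
    from bounded_linear.has_derivative[OF blP this] show ?thesis by (simp add: o_def)
  qed
  have injG: "inj_on ?G ?S"
    using inj by (auto simp: inj_on_def \<sigma>) (metis \<sigma> reindex_inv(2))
  have mat: "matrix (?G' y) = (\<chi> i j. matrix (F' (?R y)) $ \<sigma> i $ \<sigma> j)" for y
  proof -
    have ax: "?R (axis j 1) = axis (\<sigma> j) 1" for j
      using \<sigma> by (simp add: vec_eq_iff axis_def) (metis \<sigma> bij_inv_eq_iff)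
    show ?thesis by (simp add: matrix_def ax)
  qed
  have "?G ` ?S = ?P ` F ` S" by (simp add: image_image \<sigma>)
  then have "F ` S \<in> lmeasurable \<and> measure lebesgue (F ` S) = m \<longleftrightarrow> ?G ` ?S \<in> lmeasurable \<and> measure lebesgue (?G ` ?S) = m"
    unfolding measure_eq_iff_has_integral using has_integral_reindex_iff[OF \<sigma>, of "\<lambda>_. 1" m "F ` S"] by simp
  also have "\<dots> \<longleftrightarrow> ((\<lambda>y. \<bar>det (matrix (?G' y))\<bar>) has_integral m) ?S"
    by (rule has_measure_differentiable_image[OF S' G injG])
  also have "\<dots> \<longleftrightarrow> ((\<lambda>x. \<bar>det (matrix (?G' (?P x)))\<bar>) has_integral m) S"
    by (rule has_integral_reindex_iff[OF \<sigma>, symmetric])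
  also have "\<dots> \<longleftrightarrow> ((\<lambda>x. \<bar>det (matrix (F' x))\<bar>) has_integral m) S"
  proof -
    have "matrix (\<lambda>v. ?P (F' x (?R v))) = (\<chi> i j. matrix (F' x) $ \<sigma> i $ \<sigma> j)" for x
      using mat[of "?P x"] by (simp add: \<sigma>)
    then show ?thesis by (simp add: det_reindex[OF \<sigma>] \<sigma>)
  qed
  finally show ?thesis .
qed

text \<open>The Henstock gauge is taken fine near the exceptional null set, where absolute continuity makes
  the increments small, and controls the difference quotients elsewhere.\<close>

lemma absolutely_continuous_has_integral:
  fixes u :: "real \<Rightarrow> 'a::euclidean_space"
  assumes ab: "a \<le> b" and ac: "absolutely_continuous_on_interval a b u"
    and N: "negligible N"
    and u': "\<And>t. t \<in> {a..b} - N \<Longrightarrow> (u has_vector_derivative u' t) (at t)"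
  shows "(u' has_integral (u b - u a)) {a..b}"
proof -
  \<comment> \<open>Putting the value 0 on the exceptional set makes tags in it contribute nothing
    to the Riemann sum, so only the increments of \<open>u\<close> remain there.\<close>
  define v where "v t = (if t \<in> N then 0 else u' t)" for t
  have "(v has_integral (u b - u a)) {a..b}"
  proof (cases "a = b")
    case True
    then show ?thesis using has_integral_refl(1)[of v a] by simp
  next
    case False
    then have "a < b" using ab by simp
    show ?thesis
      unfolding has_integral_factor_content_real
    proof (intro allI impI)
      fix e :: real assume "e > 0"
      \<comment> \<open>Half of the permitted error, one half for the tags in \<open>N\<close> and
        one for all other tags.\<close>
      define c where "c = e * (b - a) / 2"
      have "c > 0" using \<open>a < b\<close> \<open>e > 0\<close> by (simp add: c_def)
      obtain d where d: "d > 0" "\<forall>D. finite D \<and> (\<forall>(s, t) \<in> D. a \<le> s \<and> s \<le> t \<and> t \<le> b) \<and>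
          pairwise (\<lambda>(s, t) (s', t'). disjnt {s<..<t} {s'<..<t'}) D \<and>
          (\<Sum>(s, t) \<in> D. t - s) < d \<longrightarrow> (\<Sum>(s, t) \<in> D. norm (u t - u s)) < c"
        using ac[unfolded absolutely_continuous_on_interval_def, THEN spec, THEN mp, OF \<open>c > 0\<close>] by (elim exE conjE)
      obtain T where T: "open T" "N \<subseteq> T" "T \<in> lmeasurable" "measure lebesgue T < d"
      proof -
        have Nm: "N \<in> lmeasurable" using N by (rule negligible_imp_measurable)
        obtain T where T: "open T" "N \<subseteq> T" "T - N \<in> lmeasurable" "emeasure lebesgue (T - N) < ennreal d"
          using sets_lebesgue_outer_open[OF fmeasurableD[OF Nm] d(1)] by metis
        have TN: "T = N \<union> (T - N)" using T(2) by auto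
        have "N \<union> (T - N) \<in> lmeasurable" using Nm T(3) by (rule fmeasurable.Un)
        then have Tm: "T \<in> lmeasurable" by (simp only: TN[symmetric])
        have "measure lebesgue T \<le> measure lebesgue N + measure lebesgue (T - N)"
          by (subst TN, rule measure_Un_le) (use Nm T(3) in auto)
        also have "measure lebesgue N = 0" by (rule negligible_imp_measure0[OF N])
        finally have "ennreal (measure lebesgue T) \<le> ennreal (measure lebesgue (T - N))" by (simp add: ennreal_leI)
        also have "\<dots> < ennreal d" using T(3,4) by (simp add: emeasure_eq_measure2)
        finally have "measure lebesgue T < d" using d(1) by (simp add: ennreal_less_iff)
        then show ?thesis by (rule that[OF T(1,2) Tm])
      qed
      have "\<exists>r>0. (t \<in> N \<longrightarrow> ball t r \<subseteq> T) \<and>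
         (t \<in> {a..b} - N \<longrightarrow> (\<forall>s. \<bar>s - t\<bar> < r \<longrightarrow> norm (u s - u t - (s - t) *\<^sub>R u' t) \<le> e / 2 * \<bar>s - t\<bar>))" for t
      proof (cases "t \<in> N")
        case True
        then obtain r where "r > 0" "ball t r \<subseteq> T" using T open_contains_ball by blast
        then show ?thesis using True by blast
      next
        case notN: False
        show ?thesis
        proof (cases "t \<in> {a..b}")
          case True
          then have "(u has_derivative (\<lambda>h. h *\<^sub>R u' t)) (at t)" using u'[of t] notN by (simp add: has_vector_derivative_def)
          then obtain r where "r > 0" "\<And>s. norm (s - t) < r \<Longrightarrow> norm (u s - u t - (s - t) *\<^sub>R u' t) \<le> e / 2 * norm (s - t)"
            unfolding has_derivative_at_alt using \<open>e > 0\<close> by (metis half_gt_zero)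
          then show ?thesis using notN by auto
        qed (use notN in \<open>auto intro: exI[of _ 1]\<close>)
      qed
      then obtain r where r: "\<And>t. r t > 0" "\<And>t. t \<in> N \<Longrightarrow> ball t (r t) \<subseteq> T"
         "\<And>t s. t \<in> {a..b} - N \<Longrightarrow> \<bar>s - t\<bar> < r t \<Longrightarrow> norm (u s - u t - (s - t) *\<^sub>R u' t) \<le> e / 2 * \<bar>s - t\<bar>"
        by metis
      show "\<exists>\<gamma>. gauge \<gamma> \<and> (\<forall>p. p tagged_division_of {a..b} \<and> \<gamma> fine p \<longrightarrow>
          norm ((\<Sum>(x, K)\<in>p. measure lborel K *\<^sub>R v x) - (u b - u a)) \<le> e * measure lborel {a..b})"
      proof (intro exI[of _ "\<lambda>t. ball t (r t)"] conjI allI impI)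
        show "gauge (\<lambda>t. ball t (r t))" using r(1) by (auto simp: gauge_def)
        fix p assume "p tagged_division_of {a..b} \<and> (\<lambda>t. ball t (r t)) fine p"
        then have p: "p tagged_division_of {a..b}" and fine: "(\<lambda>t. ball t (r t)) fine p" by auto
        have fin: "finite p" using p by blast
        define lo hi where "lo K = Inf K" and "hi K = Sup K" for K :: "real set"
        have K: "K = {lo K..hi K}" "lo K \<le> hi K" "a \<le> lo K" "hi K \<le> b" "x \<in> {lo K..hi K}" "{lo K..hi K} \<subseteq> ball x (r x)"
          "x \<in> {a..b}" if xK: "(x, K) \<in> p" for x K
        proof -
          obtain s t where st: "K = cbox s t" using tagged_division_ofD(4)[OF p xK] by blast
          have x: "x \<in> K" and sub: "K \<subseteq> {a..b}" using tagged_division_ofD(2,3)[OF p xK] by auto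
          then have "s \<le> t" using st by auto
          then have lh: "lo K = s" "hi K = t" by (simp_all add: lo_def hi_def st)
          have Kst: "K = {s..t}" using st by simp
          show "K = {lo K..hi K}" "lo K \<le> hi K" "x \<in> {lo K..hi K}" unfolding lh using Kst \<open>s \<le> t\<close> x by blast+
          show "a \<le> lo K" "hi K \<le> b" "x \<in> {a..b}" unfolding lh using sub Kst \<open>s \<le> t\<close> x by auto
          show "{lo K..hi K} \<subseteq> ball x (r x)" unfolding lh Kst[symmetric] using fine xK by (auto simp: fine_def)
        qed
        have cont: "measure lborel K = hi K - lo K" if "(x, K) \<in> p" for x K
          using K(1,2)[OF that] by (metis measure_lborel_Icc)
        have total: "(\<Sum>(x, K)\<in>p. hi K - lo K) = b - a"
          using additive_tagged_division_1[OF ab p, of "\<lambda>x. x"] by (simp add: lo_def hi_def)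
        have tele: "(\<Sum>(x, K)\<in>p. u (hi K) - u (lo K)) = u b - u a"
          using additive_tagged_division_1[OF ab p, of u] by (simp add: lo_def hi_def)
        let ?p1 = "{(x, K) \<in> p. x \<in> N}" and ?p2 = "{(x, K) \<in> p. x \<notin> N}"
        have split: "p = ?p1 \<union> ?p2" "?p1 \<inter> ?p2 = {}" "finite ?p1" "finite ?p2" using fin by (auto intro: finite_subset[OF _ fin])
        let ?t = "\<lambda>(x, K). u (hi K) - u (lo K) - measure lborel K *\<^sub>R v x"
        have "norm (\<Sum>z\<in>?p2. ?t z) \<le> (\<Sum>(x, K)\<in>?p2. e / 2 * (hi K - lo K))"
        proof (rule sum_norm_le)
          fix z assume "z \<in> ?p2"
          then obtain x K where z: "z = (x, K)" "(x, K) \<in> p" "x \<notin> N" by auto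
          note K' = K[OF z(2)]
          have mem: "\<bar>hi K - x\<bar> < r x" "\<bar>lo K - x\<bar> < r x"
            using subsetD[OF K'(6), of "hi K"] subsetD[OF K'(6), of "lo K"] K'(2)
            by (simp_all add: dist_real_def abs_minus_commute)
          have 1: "norm (u (hi K) - u x - (hi K - x) *\<^sub>R u' x) \<le> e / 2 * \<bar>hi K - x\<bar>"
            using K'(7) z(3) mem(1) by (intro r(3)) auto
          have 2: "norm (u (lo K) - u x - (lo K - x) *\<^sub>R u' x) \<le> e / 2 * \<bar>lo K - x\<bar>"
            using K'(7) z(3) mem(2) by (intro r(3)) auto
          have eq: "u (hi K) - u (lo K) - (hi K - lo K) *\<^sub>R u' x
            = (u (hi K) - u x - (hi K - x) *\<^sub>R u' x) - (u (lo K) - u x - (lo K - x) *\<^sub>R u' x)"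
            by (simp add: algebra_simps)
          have "norm (u (hi K) - u (lo K) - (hi K - lo K) *\<^sub>R u' x) \<le> e / 2 * \<bar>hi K - x\<bar> + e / 2 * \<bar>lo K - x\<bar>"
            unfolding eq using 1 2 norm_triangle_ineq4[of "u (hi K) - u x - (hi K - x) *\<^sub>R u' x" "u (lo K) - u x - (lo K - x) *\<^sub>R u' x"]
            by linarith
          also have "\<dots> = e / 2 * (hi K - lo K)" using K'(5) by (simp add: field_simps)
          finally show "norm (?t z) \<le> (case z of (x, K) \<Rightarrow> e / 2 * (hi K - lo K))"
            using z by (simp add: v_def cont)
        qed
        also have "\<dots> \<le> (\<Sum>(x, K)\<in>p. e / 2 * (hi K - lo K))"
          using \<open>e > 0\<close> K(2) by (intro sum_mono2 fin) auto
        also have "\<dots> = e / 2 * (\<Sum>(x, K)\<in>p. hi K - lo K)" by (simp add: sum_distrib_left case_prod_unfold)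
        finally have n2: "norm (\<Sum>z\<in>?p2. ?t z) \<le> c" by (simp add: total c_def)
        \<comment> \<open>Degenerate intervals are discarded: they contribute nothing, and without
          them an interval is determined by its endpoints, so the sum may be indexed by endpoint
          pairs.\<close>
        let ?nd = "{(x, K) \<in> ?p1. lo K < hi K}"
        let ?D = "(\<lambda>(x, K). (lo K, hi K)) ` ?nd"
        have disj: "{lo K<..<hi K} \<inter> {lo K'<..<hi K'} = {}"
          if "(x, K) \<in> p" "(x', K') \<in> p" "(x, K) \<noteq> (x', K')" for x K x' K'
        proof -
          have "interior {lo K..hi K} \<inter> interior {lo K'..hi K'} = {}"
            using tagged_division_ofD(5)[OF p that] K(1)[OF that(1)] K(1)[OF that(2)] by simp
          then show ?thesis by simp
        qed
        have injD: "inj_on (\<lambda>(x, K). (lo K, hi K)) ?nd"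
        proof (rule inj_onI, clarify)
          fix x K x' K' assume *: "(x, K) \<in> p" "(x', K') \<in> p" "lo K = lo K'" "hi K = hi K'" "lo K < hi K"
          show "x = x' \<and> K = K'"
          proof (rule ccontr)
            assume "\<not> (x = x' \<and> K = K')"
            then have "{lo K<..<hi K} = {}" using disj[OF *(1,2)] * by auto
            then show False using *(5) by simp
          qed
        qed
        have finnd: "finite ?nd" by (rule finite_subset[OF _ fin]) auto
        have "(\<Sum>(s, t)\<in>?D. norm (u t - u s)) < c"
        proof (rule d(2)[THEN spec, THEN mp], intro conjI)
          show "finite ?D" using finnd by simp
          show "\<forall>(s, t)\<in>?D. a \<le> s \<and> s \<le> t \<and> t \<le> b" using K by fastforce
          show "pairwise (\<lambda>(s, t) (s', t'). disjnt {s<..<t} {s'<..<t'}) ?D"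
            unfolding pairwise_def disjnt_def using disj by fastforce
          have "(\<Sum>(s, t)\<in>?D. t - s) = (\<Sum>(x, K)\<in>?nd. hi K - lo K)"
            by (subst sum.reindex[OF injD]) (simp add: case_prod_unfold)
          also have "\<dots> = (\<Sum>z\<in>?nd. measure lebesgue {lo (snd z)<..<hi (snd z)})"
            by (intro sum.cong) auto
          also have "\<dots> = measure lebesgue (\<Union>z\<in>?nd. {lo (snd z)<..<hi (snd z)})"
            using disj by (intro measure_UNION'[symmetric] finnd) (auto simp: pairwise_def disjnt_def)
          also have "\<dots> \<le> measure lebesgue T"
          proof (rule measure_mono_fmeasurable)
            show "(\<Union>z\<in>?nd. {lo (snd z)<..<hi (snd z)}) \<subseteq> T"
            proof clarsimp
              fix x K y assume "(x, K) \<in> p" "x \<in> N" "lo K < y" "y < hi K"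
              then have "y \<in> ball x (r x)" using K(6)[of x K] by (auto simp: subset_iff)
              then show "y \<in> T" using r(2) \<open>x \<in> N\<close> by blast
            qed
          qed (use T finnd in \<open>auto intro!: sets.finite_UN\<close>)
          finally show "(\<Sum>(s, t)\<in>?D. t - s) < d" using T(4) by linarith
        qed
        also have "(\<Sum>(s, t)\<in>?D. norm (u t - u s)) = (\<Sum>(x, K)\<in>?nd. norm (u (hi K) - u (lo K)))"
          by (subst sum.reindex[OF injD]) (simp add: case_prod_unfold)
        also have "\<dots> = (\<Sum>(x, K)\<in>?p1. norm (u (hi K) - u (lo K)))"
          using K(2) split(3) by (intro sum.mono_neutral_left) (auto simp: less_le)
        finally have n1: "(\<Sum>(x, K)\<in>?p1. norm (u (hi K) - u (lo K))) < c" .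
        have "norm (\<Sum>z\<in>?p1. ?t z) \<le> (\<Sum>(x, K)\<in>?p1. norm (u (hi K) - u (lo K)))"
          by (rule sum_norm_le) (auto simp: v_def)
        then have n1': "norm (\<Sum>z\<in>?p1. ?t z) \<le> c" using n1 by linarith
        have "(\<Sum>z\<in>p. ?t z) = (u b - u a) - (\<Sum>(x, K)\<in>p. measure lborel K *\<^sub>R v x)"
          unfolding tele[symmetric] by (simp add: case_prod_unfold sum_subtractf)
        then have "norm ((\<Sum>(x, K)\<in>p. measure lborel K *\<^sub>R v x) - (u b - u a)) = norm (\<Sum>z\<in>p. ?t z)"
          by (simp add: norm_minus_commute)
        also have "(\<Sum>z\<in>p. ?t z) = (\<Sum>z\<in>?p1. ?t z) + (\<Sum>z\<in>?p2. ?t z)"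
          using sum.union_disjoint[OF split(3,4,2), of ?t] split(1) by simp
        also have "norm \<dots> \<le> c + c" using n1' n2 by (rule norm_triangle_le[OF add_mono])
        also have "\<dots> = e * measure lborel {a..b}" using ab by (simp add: c_def)
        finally show "norm ((\<Sum>(x, K)\<in>p. measure lborel K *\<^sub>R v x) - (u b - u a)) \<le> e * measure lborel {a..b}" .
      qed
    qed
  qed
  then show ?thesis by (rule has_integral_spike[OF N, rotated]) (simp add: v_def)
qed

section \<open>The Teichmueller metric\<close>

lemma lborel_integral_translation:
  fixes f :: "'a::euclidean_space \<Rightarrow> real"
  assumes [measurable]: "f \<in> borel_measurable borel"
  shows "(\<integral>x. f (c + x) \<partial>lborel) = (\<integral>x. f x \<partial>lborel)"
    "integrable lborel (\<lambda>x. f (c + x)) \<longleftrightarrow> integrable lborel f"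
proof -
  have "(\<integral>x. f x \<partial>distr lborel borel ((+) c)) = (\<integral>x. f (c + x) \<partial>lborel)" by (rule integral_distr) simp_all
  then show "(\<integral>x. f (c + x) \<partial>lborel) = (\<integral>x. f x \<partial>lborel)" by (simp add: lborel_distr_plus)
  have "integrable (distr lborel borel ((+) c)) f \<longleftrightarrow> integrable lborel (\<lambda>x. f (c + x))" by (rule integrable_distr_eq) simp_all
  then show "integrable lborel (\<lambda>x. f (c + x)) \<longleftrightarrow> integrable lborel f" by (simp add: lborel_distr_plus)
qed

text \<open>Line integrals are averaged over all starting points x in the cube. Substituting y = x +
  t e, each y in the cube is reached from the cube for parameters t filling an interval of length
  \<open>R\<close>, which explains the factor and avoids splitting off one coordinate.\<close>

lemma integral_over_lines:
  fixes h :: "real^'n \<Rightarrow> real" and i :: 'n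
  assumes h: "integrable lborel h" and R: "R > 0"
  defines "Q \<equiv> cbox 0 (R *\<^sub>R (\<chi> j. 1)) :: (real^'n) set" and "e \<equiv> axis i (1::real)"
  assumes h0: "\<And>y. y \<notin> Q \<Longrightarrow> h y = 0"
  shows "AE x in lborel. integrable lborel (\<lambda>t. indicator Q x * h (x + t *\<^sub>R e))"
    "integrable lborel (\<lambda>x. \<integral>t. indicator Q x * h (x + t *\<^sub>R e) \<partial>lborel)"
    "(\<integral>x. (\<integral>t. indicator Q x * h (x + t *\<^sub>R e) \<partial>lborel) \<partial>lborel) = R * (\<integral>y. h y \<partial>lborel)"
proof -
  have hb[measurable]: "h \<in> borel_measurable borel" using h by (simp add: integrable_iff_bounded)
  have Qb[measurable]: "Q \<in> sets borel" by (simp add: Q_def)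
  define H2 where "H2 y t = indicator Q (y - t *\<^sub>R e) * h y" for y t
  define H where "H x t = indicator Q x * h (x + t *\<^sub>R e)" for x t
  have H2m[measurable]: "(\<lambda>(y, t). H2 y t) \<in> borel_measurable (lborel \<Otimes>\<^sub>M lborel)" unfolding H2_def by measurable
  have Hm[measurable]: "(\<lambda>(y, t). H y t) \<in> borel_measurable (lborel \<Otimes>\<^sub>M lborel)" unfolding H_def by measurable
  have Hm'[measurable]: "(\<lambda>(t, x). H x t) \<in> borel_measurable (lborel \<Otimes>\<^sub>M lborel)" unfolding H_def by measurable
  have line: "H2 y t = indicator {y $ i - R..y $ i} t * h y" for y t
  proof (cases "y \<in> Q")
    case True
    have "y - t *\<^sub>R e \<in> Q \<longleftrightarrow> t \<in> {y $ i - R..y $ i}"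
    proof
      assume "y - t *\<^sub>R e \<in> Q"
      then have "0 \<le> (y - t *\<^sub>R e) $ i \<and> (y - t *\<^sub>R e) $ i \<le> R" by (simp add: Q_def mem_box_cart)
      then show "t \<in> {y $ i - R..y $ i}" by (simp add: e_def axis_def)
    next
      assume "t \<in> {y $ i - R..y $ i}"
      then show "y - t *\<^sub>R e \<in> Q" using True by (auto simp: Q_def mem_box_cart e_def axis_def)
    qed
    then show ?thesis by (auto simp: H2_def indicator_def)
  qed (simp add: H2_def h0)
  have "integrable lborel (indicat_real {a..b})" for a b :: real
    by (rule integrable_real_indicator) (auto simp: emeasure_lborel_Icc_eq)
  then have int_ind: "integrable lborel (\<lambda>t. indicator {a..b} t * c)" "(\<integral>t. indicator {y $ i - R..y $ i} t * c \<partial>lborel) = R * c"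
    for a b c :: real and y using R by simp_all
  have H2n: "(\<integral>t. norm (H2 y t) \<partial>lborel) = R * norm (h y)" for y
    using int_ind(2)[of y "norm (h y)"] by (simp add: line abs_mult)
  have "integrable lborel (\<lambda>t. H2 y t)" for y unfolding line by (rule int_ind)
  then have H2i: "integrable (lborel \<Otimes>\<^sub>M lborel) (\<lambda>(y, t). H2 y t)"
    using h H2n by (intro lborel_pair.Fubini_integrable[OF H2m]) auto
  have shift: "H x t = H2 (t *\<^sub>R e + x) t" for x t by (simp add: H_def H2_def add.commute)
  have H2t[measurable]: "(\<lambda>y. H2 y t) \<in> borel_measurable borel" for t unfolding H2_def by measurable
  have "integrable lborel (\<lambda>t. \<integral>y. norm (H2 y t) \<partial>lborel)"
    using lborel_pair.integrable_snd[of "\<lambda>y t. norm (H2 y t)"] integrable_norm[OF H2i] by (simp add: case_prod_unfold)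
  moreover have "(\<integral>x. norm (H x t) \<partial>lborel) = (\<integral>y. norm (H2 y t) \<partial>lborel)" for t
    unfolding shift by (rule lborel_integral_translation(1)[of "\<lambda>y. norm (H2 y t)"]) simp
  moreover have "AE t in lborel. integrable lborel (\<lambda>x. H x t)"
    unfolding shift lborel_integral_translation(2)[OF H2t] using lborel_pair.AE_integrable_snd[OF H2i] .
  ultimately have "integrable (lborel \<Otimes>\<^sub>M lborel) (\<lambda>(t, x). H x t)"
    by (intro lborel_pair.Fubini_integrable) (auto simp: case_prod_unfold)
  from lborel_pair.integrable_product_swap[OF this]
  have Hi: "integrable (lborel \<Otimes>\<^sub>M lborel) (\<lambda>(x, t). H x t)" by (simp add: case_prod_unfold)
  show "AE x in lborel. integrable lborel (\<lambda>t. indicator Q x * h (x + t *\<^sub>R e))"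
    using lborel_pair.AE_integrable_fst[OF Hi] by (simp add: H_def)
  show "integrable lborel (\<lambda>x. \<integral>t. indicator Q x * h (x + t *\<^sub>R e) \<partial>lborel)"
    using lborel_pair.integrable_fst[OF Hi] by (simp add: H_def)
  have "(\<integral>x. (\<integral>t. H x t \<partial>lborel) \<partial>lborel) = (\<integral>t. (\<integral>x. H x t \<partial>lborel) \<partial>lborel)"
    using lborel_pair.Fubini_integral[OF Hi] by simp
  also have "\<dots> = (\<integral>t. (\<integral>y. H2 y t \<partial>lborel) \<partial>lborel)"
    unfolding shift lborel_integral_translation(1)[OF H2t] ..
  also have "\<dots> = (\<integral>y. (\<integral>t. H2 y t \<partial>lborel) \<partial>lborel)"
    using lborel_pair.Fubini_integral[OF H2i] .
  also have "\<dots> = R * (\<integral>y. h y \<partial>lborel)" using R by (simp add: line)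
  finally show "(\<integral>x. (\<integral>t. indicator Q x * h (x + t *\<^sub>R e) \<partial>lborel) \<partial>lborel) = R * (\<integral>y. h y \<partial>lborel)"
    by (simp add: H_def)
qed

text \<open>For each fixed t the translate of a null set is null; Fubini exchanges the two
  almost-everywhere quantifiers.\<close>

lemma AE_line_AE:
  fixes e :: "real^'n"
  assumes N: "N \<in> null_sets lborel"
  shows "AE x in lborel. AE t in lborel. x + t *\<^sub>R e \<notin> N"
proof -
  have Nb[measurable]: "N \<in> sets borel" using N by auto
  have N0: "AE y in lborel. y \<notin> N" using N by (rule AE_not_in)
  have "AE x in lborel. x + t *\<^sub>R e \<notin> N" for t
  proof -
    have "AE y in distr lborel borel ((+) (t *\<^sub>R e)). y \<notin> N" unfolding lborel_distr_plus by (rule N0)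
    then show ?thesis by (subst (asm) AE_distr_iff) (simp_all add: add.commute)
  qed
  then have "AE t in lborel. AE x in lborel. x + t *\<^sub>R e \<notin> N" by simp
  moreover have "{p \<in> space (lborel \<Otimes>\<^sub>M lborel). snd p + fst p *\<^sub>R e \<notin> N} \<in> sets (lborel \<Otimes>\<^sub>M lborel)"
    by measurable
  ultimately show ?thesis
    using lborel_pair.AE_commute[of "\<lambda>t x. x + t *\<^sub>R e \<notin> N"] by simp
qed

lemma has_derivative_along_line:
  fixes F :: "real^'n \<Rightarrow> 'a::real_normed_vector"
  assumes "(F has_derivative D) (at (x + t *\<^sub>R v))"
  shows "((\<lambda>s. F (x + s *\<^sub>R v)) has_vector_derivative D v) (at t)"
proof -
  have "((\<lambda>s. x + s *\<^sub>R v) has_derivative (\<lambda>h. h *\<^sub>R v)) (at t)" by (auto intro!: derivative_eq_intros)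
  from diff_chain_at[OF this assms] have "((\<lambda>s. F (x + s *\<^sub>R v)) has_derivative (\<lambda>h. D (h *\<^sub>R v))) (at t)" by (simp add: o_def)
  moreover have "D (h *\<^sub>R v) = h *\<^sub>R D v" for h using has_derivative_linear[OF assms] by (rule linear_cmul)
  ultimately show ?thesis by (simp add: has_vector_derivative_def)
qed

text \<open>A pointwise limit of continuous difference quotients, with value 0 on the Borel set
  \<open>N\<close>.\<close>

lemma directional_derivative_borel_measurable:
  fixes F :: "real^'n \<Rightarrow> real^'m"
  assumes F: "continuous_on UNIV F" and N[measurable]: "N \<in> sets borel"
    and D: "\<And>x. x \<notin> N \<Longrightarrow> (F has_derivative D x) (at x)"
  shows "(\<lambda>x. if x \<in> N then 0 else D x v) \<in> borel_measurable borel"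
proof (rule borel_measurable_LIMSEQ_metric)
  have [measurable]: "F \<in> borel_measurable borel" using F by (rule borel_measurable_continuous_onI)
  show "(\<lambda>x. if x \<in> N then 0 else real (Suc m) *\<^sub>R (F (x + (1 / real (Suc m)) *\<^sub>R v) - F x)) \<in> borel_measurable borel" for m
    by measurable
  fix x :: "real^'n"
  show "(\<lambda>m. if x \<in> N then 0 else real (Suc m) *\<^sub>R (F (x + (1 / real (Suc m)) *\<^sub>R v) - F x)) \<longlonglongrightarrow> (if x \<in> N then 0 else D x v)"
  proof (cases "x \<in> N")
    case False
    have "((\<lambda>s. F (x + s *\<^sub>R v)) has_vector_derivative D x v) (at 0)"
      using D[OF False] by (intro has_derivative_along_line) simp
    then have "((\<lambda>s. F (x + s *\<^sub>R v)) has_derivative (\<lambda>h. h *\<^sub>R D x v)) (at 0)" by (simp add: has_vector_derivative_def)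
    then have lim: "((\<lambda>s. norm (F (x + s *\<^sub>R v) - F x - s *\<^sub>R D x v) / norm s) \<longlongrightarrow> 0) (at 0)"
      by (simp add: has_derivative_iff_norm)
    have "(\<lambda>m. norm (real (Suc m) *\<^sub>R (F (x + (1 / real (Suc m)) *\<^sub>R v) - F x) - D x v)) \<longlonglongrightarrow> 0"
    proof -
      have "filterlim (\<lambda>m. 1 / real (Suc m)) (at 0) sequentially"
        using LIMSEQ_inverse_real_of_nat by (simp add: filterlim_at inverse_eq_divide del: of_nat_Suc)
      from filterlim_compose[OF lim this]
      have "(\<lambda>m. norm (F (x + (1 / real (Suc m)) *\<^sub>R v) - F x - (1 / real (Suc m)) *\<^sub>R D x v) / norm (1 / real (Suc m))) \<longlonglongrightarrow> 0" .
      moreover have "norm (F y - F x - (1 / real (Suc m)) *\<^sub>R w) / norm (1 / real (Suc m))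
        = norm (real (Suc m) *\<^sub>R (F y - F x) - w)" for m y w
      proof -
        have "real (Suc m) *\<^sub>R (F y - F x) - w = real (Suc m) *\<^sub>R (F y - F x - (1 / real (Suc m)) *\<^sub>R w)"
          by (simp add: scaleR_diff_right del: of_nat_Suc)
        then show ?thesis by (simp del: of_nat_Suc)
      qed
      ultimately show ?thesis by simp
    qed
    then show ?thesis using False by (simp add: LIM_zero_iff tendsto_norm_zero_iff)
  qed simp
qed

lemma max_stretch_bound:
  fixes D :: "real^'n \<Rightarrow> real^'m"
  assumes "linear D"
  shows "norm (D v) \<le> max_stretch D * norm v"
proof (cases "v = 0")
  case True
  then show ?thesis using linear_0[OF assms] by simp
next
  case False
  obtain B where B: "\<And>x. norm (D x) \<le> B * norm x" using linear_bounded[OF assms] by blast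
  have "norm (D ((1 / norm v) *\<^sub>R v)) \<le> max_stretch D"
    unfolding max_stretch_def
  proof (rule cSUP_upper)
    show "bdd_above ((\<lambda>x. norm (D x)) ` sphere 0 1)" using B by (intro bdd_aboveI2[of _ _ B]) (metis mem_sphere_0 mult.right_neutral)
  qed (use False in simp)
  then have "norm (D v) / norm v \<le> max_stretch D" by (simp add: linear_cmul[OF assms])
  then show ?thesis using False by (simp add: divide_le_eq)
qed

lemma measure_matrix_image_cbox:
  fixes A :: "real^'n^'n"
  assumes "invertible A"
  shows "(*v) A ` cbox a b \<in> lmeasurable" "measure lebesgue ((*v) A ` cbox a b) = \<bar>det A\<bar> * measure lborel (cbox a b)"
proof -
  have "inj_on ((*v) A) (cbox a b)"
    by (rule inj_on_inverseI[of _ "(*v) (matrix_inv A)"]) (simp add: matrix_vector_mul_assoc matrix_inv_left_right[OF assms])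
  moreover have "((*v) A has_derivative (*v) A) (at x within cbox a b)" for x
    by (rule bounded_linear_imp_has_derivative) simp
  moreover have "((\<lambda>x. \<bar>det (matrix ((*v) A))\<bar>) has_integral \<bar>det A\<bar> * measure lborel (cbox a b)) (cbox a b)"
    using has_integral_const[of "\<bar>det A\<bar>" a b] by (simp add: mult.commute)
  ultimately have "(*v) A ` cbox a b \<in> lmeasurable \<and> measure lebesgue ((*v) A ` cbox a b) = \<bar>det A\<bar> * measure lborel (cbox a b)"
    by (subst has_measure_differentiable_image_finite) auto
  then show "(*v) A ` cbox a b \<in> lmeasurable" "measure lebesgue ((*v) A ` cbox a b) = \<bar>det A\<bar> * measure lborel (cbox a b)" by auto
qed

text \<open>The tangent line of r^n at r = L lies below the graph; after integration this plays the
  role of Jensen's inequality.\<close>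

lemma power_tangent_bound:
  fixes r L :: real
  assumes "0 \<le> r" "0 < L"
  shows "L ^ n * (1 + real n * (r / L - 1)) \<le> r ^ n"
proof -
  have "1 + real n * (r / L - 1) \<le> (1 + (r / L - 1)) ^ n"
    using assms by (intro Bernoulli_inequality) simp
  also have "\<dots> = r ^ n / L ^ n" by (simp add: power_divide)
  finally show ?thesis using assms by (simp add: pos_le_divide_eq mult.commute)
qed

text \<open>Let \<open>F\<close> be quasiconformal and at bounded distance from \<open>A\<close>.  Over a large cube the mean of the
  derivative of \<open>F\<close> is close to \<open>A\<close>, by absolute continuity on lines, and the mean of the Jacobian is at
  most about \<open>1\<close>, the image having about the volume of the cube.  Integrating
  \<open>L(F')\<^sup>n \<le> K J\<close> after linearizing the power by Bernoulli's inequality gives \<open>L(A)\<^sup>n \<le> K\<close> in the limit.\<close>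

context
  fixes F G :: "real^'n \<Rightarrow> real^'n" and A :: "real^'n^'n" and C K :: real
  assumes homeo: "homeomorphism UNIV UNIV F G"
    and near: "\<And>x. norm (F x - A *v x) \<le> C"
    and detA: "\<bar>det A\<bar> = 1"
    and acl: "ACL F"
    and diff: "AE x in lebesgue. F differentiable (at x)"
    and dil: "AE x in lebesgue. max_stretch (dif F x) ^ CARD('n) \<le> K * \<bar>jacobian F x\<bar>"
    and K: "0 \<le> K"
begin

private lemma exceptional_set:
  obtains N where "N \<in> null_sets lborel" "\<And>x. x \<notin> N \<Longrightarrow> (F has_derivative dif F x) (at x)"
    "\<And>x. x \<notin> N \<Longrightarrow> max_stretch (dif F x) ^ CARD('n) \<le> K * \<bar>jacobian F x\<bar>"
proof -
  have "AE x in lborel. F differentiable (at x) \<and> max_stretch (dif F x) ^ CARD('n) \<le> K * \<bar>jacobian F x\<bar>"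
    using diff dil by (simp add: AE_completion_iff)
  then obtain N where "{x \<in> space lborel. \<not> (F differentiable (at x) \<and> max_stretch (dif F x) ^ CARD('n) \<le> K * \<bar>jacobian F x\<bar>)} \<subseteq> N"
    "emeasure lborel N = 0" "N \<in> sets lborel" by (rule AE_E)
  then show ?thesis
    by (intro that[of N]) (auto simp: null_sets_def frechet_derivative_works[symmetric])
qed

text \<open>Along a line crossing the cube, the integral of the derivative is the increment of
  \<open>F\<close> over length \<open>R\<close>. It differs from R times
  \<open>A *v axis i 1\<close> by at most 2 C, one \<open>C\<close> for each endpoint; averaging
  over the lines divides this by \<open>R\<close>.\<close>

private lemma average_derivative:
  fixes i :: 'n and R :: real
  assumes N: "N \<in> null_sets lborel" and DN: "\<And>x. x \<notin> N \<Longrightarrow> (F has_derivative dif F x) (at x)"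
    and R: "R > 0" and w: "norm w = 1"
  defines "Q \<equiv> cbox 0 (R *\<^sub>R (\<chi> j. 1)) :: (real^'n) set"
  defines "h \<equiv> \<lambda>x. indicator Q x * (w \<bullet> (if x \<in> N then 0 else dif F x (axis i 1)))"
  assumes h: "integrable lborel h"
  shows "\<bar>(\<integral>x. h x \<partial>lborel) - R ^ CARD('n) * (w \<bullet> (A *v axis i 1))\<bar> \<le> R ^ CARD('n) * (2 * C / R)"
proof -
  let ?e = "axis i 1 :: real^'n"
  let ?g = "\<lambda>x. if x \<in> N then 0 else dif F x ?e"
  have h0: "\<And>y. y \<notin> cbox 0 (R *\<^sub>R (\<chi> j. 1)) \<Longrightarrow> h y = 0" by (simp add: h_def Q_def)
  have lines: "AE x in lborel. integrable lborel (\<lambda>t. indicator Q x * h (x + t *\<^sub>R ?e))"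
    "integrable lborel (\<lambda>x. \<integral>t. indicator Q x * h (x + t *\<^sub>R ?e) \<partial>lborel)"
    "(\<integral>x. (\<integral>t. indicator Q x * h (x + t *\<^sub>R ?e) \<partial>lborel) \<partial>lborel) = R * (\<integral>y. h y \<partial>lborel)"
    unfolding Q_def by (rule integral_over_lines[OF h R], erule h0)+
  define I where "I x = (\<integral>t. indicator Q x * h (x + t *\<^sub>R ?e) \<partial>lborel)" for x
  have Qm: "measure lborel Q = R ^ CARD('n)"
    using R by (auto simp: Q_def content_cbox_if_cart interval_eq_empty_cart)
  have Qe: "emeasure lborel Q < \<infinity>" unfolding Q_def by (intro emeasure_bounded_finite bounded_cbox)
  have "AE x in lebesgue. \<forall>a b. absolutely_continuous_on_interval a b (\<lambda>t. F (x + t *\<^sub>R ?e))" using acl by (simp add: ACL_def)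
  then have acl': "AE x in lborel. \<forall>a b. absolutely_continuous_on_interval a b (\<lambda>t. F (x + t *\<^sub>R ?e))" by (simp add: AE_completion_iff)
  have "AE x in lborel. \<bar>I x - indicator Q x * (R * (w \<bullet> (A *v ?e)))\<bar> \<le> indicator Q x * (2 * C)"
    using acl' AE_line_AE[OF N, of ?e] lines(1)
  proof eventually_elim
    fix x
    assume ac: "\<forall>a b. absolutely_continuous_on_interval a b (\<lambda>t. F (x + t *\<^sub>R ?e))"
      and notN: "AE t in lborel. x + t *\<^sub>R ?e \<notin> N"
      and int: "integrable lborel (\<lambda>t. indicator Q x * h (x + t *\<^sub>R ?e))"
    show "\<bar>I x - indicator Q x * (R * (w \<bullet> (A *v ?e)))\<bar> \<le> indicator Q x * (2 * C)"
    proof (cases "x \<in> Q")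
      case True
      let ?a = "- x $ i" and ?b = "R - x $ i"
      have ab: "?a \<le> ?b" using R by simp
      have inQ: "x + t *\<^sub>R ?e \<in> Q \<longleftrightarrow> t \<in> {?a..?b}" for t
      proof
        assume "x + t *\<^sub>R ?e \<in> Q"
        then have "0 \<le> (x + t *\<^sub>R ?e) $ i \<and> (x + t *\<^sub>R ?e) $ i \<le> R"
          by (auto simp: Q_def mem_box_cart dest!: spec[of _ i])
        then show "t \<in> {?a..?b}" by auto
      next
        assume "t \<in> {?a..?b}"
        then show "x + t *\<^sub>R ?e \<in> Q" using True by (auto simp: Q_def mem_box_cart axis_def)
      qed
      let ?M = "{t. x + t *\<^sub>R ?e \<in> N}"
      have neg: "negligible ?M"
      proof -
        have "N \<in> sets borel" using N by auto
        then have "?M \<in> sets lborel" by measurable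
        then have "?M \<in> null_sets lborel" using notN by (simp add: AE_iff_null_sets)
        then show ?thesis by (simp add: negligible_iff_null_sets null_sets_completionI)
      qed
      have vd: "((\<lambda>t. F (x + t *\<^sub>R ?e)) has_vector_derivative ?g (x + t *\<^sub>R ?e)) (at t)" if "t \<in> {?a..?b} - ?M" for t
        using that DN by (auto intro: has_derivative_along_line)
      have "((\<lambda>t. ?g (x + t *\<^sub>R ?e)) has_integral (F (x + ?b *\<^sub>R ?e) - F (x + ?a *\<^sub>R ?e))) {?a..?b}"
        by (rule absolutely_continuous_has_integral[OF ab ac[rule_format] neg vd])
      then have "((\<lambda>t. w \<bullet> ?g (x + t *\<^sub>R ?e)) has_integral (w \<bullet> (F (x + ?b *\<^sub>R ?e) - F (x + ?a *\<^sub>R ?e)))) {?a..?b}"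
        by (rule has_integral_linear[OF _ bounded_linear_inner_right, unfolded o_def])
      then have "((\<lambda>t. if t \<in> {?a..?b} then w \<bullet> ?g (x + t *\<^sub>R ?e) else 0) has_integral (w \<bullet> (F (x + ?b *\<^sub>R ?e) - F (x + ?a *\<^sub>R ?e)))) UNIV"
        by (subst has_integral_restrict_UNIV)
      moreover have "(\<lambda>t. if t \<in> {?a..?b} then w \<bullet> ?g (x + t *\<^sub>R ?e) else 0) = (\<lambda>t. indicator Q x * h (x + t *\<^sub>R ?e))"
        using True inQ by (auto simp: h_def indicator_def fun_eq_iff)
      ultimately have "((\<lambda>t. indicator Q x * h (x + t *\<^sub>R ?e)) has_integral (w \<bullet> (F (x + ?b *\<^sub>R ?e) - F (x + ?a *\<^sub>R ?e)))) UNIV" by simp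
      moreover have "((\<lambda>t. indicator Q x * h (x + t *\<^sub>R ?e)) has_integral I x) UNIV"
        unfolding I_def by (rule has_integral_integral_lborel[OF int])
      ultimately have Ix: "I x = w \<bullet> (F (x + ?b *\<^sub>R ?e) - F (x + ?a *\<^sub>R ?e))" by (rule has_integral_unique[symmetric])
      let ?y = "x + ?b *\<^sub>R ?e" and ?z = "x + ?a *\<^sub>R ?e"
      have "?y - ?z = R *\<^sub>R ?e" by (simp add: algebra_simps)
      then have "A *v ?y - A *v ?z = R *\<^sub>R (A *v ?e)" by (metis matrix_vector_mult_diff_distrib matrix_vector_mult_scaleR)
      then have "I x - R * (w \<bullet> (A *v ?e)) = w \<bullet> ((F ?y - A *v ?y) - (F ?z - A *v ?z))"
        unfolding Ix by (simp add: inner_diff_right algebra_simps flip: inner_scaleR_right)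
      also have "\<bar>\<dots>\<bar> \<le> norm w * norm ((F ?y - A *v ?y) - (F ?z - A *v ?z))" by (rule Cauchy_Schwarz_ineq2)
      also have "\<dots> \<le> norm (F ?y - A *v ?y) + norm (F ?z - A *v ?z)" using w norm_triangle_ineq4 by simp
      also have "\<dots> \<le> 2 * C" using near[of ?y] near[of ?z] by simp
      finally show ?thesis using True by simp
    qed (simp add: I_def)
  qed
  then have le: "AE x in lborel. \<bar>I x - indicator Q x * (R * (w \<bullet> (A *v ?e)))\<bar> \<le> indicator Q x * (2 * C)" .
  have intQ: "integrable lborel (indicat_real Q)" using Qe by (intro integrable_real_indicator) (auto simp: Q_def)
  have intI: "integrable lborel I" unfolding I_def by (rule lines(2))
  have Ival: "(\<integral>x. I x \<partial>lborel) = R * (\<integral>x. h x \<partial>lborel)" unfolding I_def by (rule lines(3))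
  let ?c = "R * (w \<bullet> (A *v ?e))"
  have intd: "integrable lborel (\<lambda>x. I x - indicator Q x * ?c)" using intI intQ by (intro Bochner_Integration.integrable_diff integrable_mult_left)
  have "(\<integral>x. I x - indicator Q x * ?c \<partial>lborel) = R * (\<integral>x. h x \<partial>lborel) - R ^ CARD('n) * ?c"
    using intI intQ Ival by (subst Bochner_Integration.integral_diff) (auto simp: Qm)
  moreover have "\<bar>\<integral>x. I x - indicator Q x * ?c \<partial>lborel\<bar> \<le> (\<integral>x. \<bar>I x - indicator Q x * ?c\<bar> \<partial>lborel)"
    using integral_norm_bound[of lborel "\<lambda>x. I x - indicator Q x * ?c"] by simp
  moreover have "\<dots> \<le> (\<integral>x. indicator Q x * (2 * C) \<partial>lborel)"
    using intd intQ le by (intro integral_mono_AE) auto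
  moreover have "(\<integral>x. indicator Q x * (2 * C) \<partial>lborel) = R ^ CARD('n) * (2 * C)" by (simp add: Qm)
  ultimately have "\<bar>R * (\<integral>x. h x \<partial>lborel) - R ^ CARD('n) * ?c\<bar> \<le> R ^ CARD('n) * (2 * C)" by linarith
  moreover have "R * \<bar>(\<integral>x. h x \<partial>lborel) - R ^ CARD('n) * (w \<bullet> (A *v ?e))\<bar> = \<bar>R * (\<integral>x. h x \<partial>lborel) - R ^ CARD('n) * ?c\<bar>"
  proof -
    have "R * \<bar>(\<integral>x. h x \<partial>lborel) - R ^ CARD('n) * (w \<bullet> (A *v ?e))\<bar> = \<bar>R * ((\<integral>x. h x \<partial>lborel) - R ^ CARD('n) * (w \<bullet> (A *v ?e)))\<bar>"
      unfolding abs_mult using R by simp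
    then show ?thesis by (simp add: algebra_simps)
  qed
  ultimately have "R * \<bar>(\<integral>x. h x \<partial>lborel) - R ^ CARD('n) * (w \<bullet> (A *v ?e))\<bar> \<le> R * (R ^ CARD('n) * (2 * C / R))"
    using R by simp
  then show ?thesis using R by (rule mult_left_le_imp_le)
qed

text \<open>The change of variables formula turns the integral into the volume of the image. Since F
  x = A (x + A^-1 (F x - A x)), that image lies in the A-image of the cube enlarged on each side by
  |B| C, and \<open>A\<close> preserves volume.\<close>

private lemma jacobian_mass:
  fixes R :: real
  assumes N: "N \<in> null_sets lborel" and DN: "\<And>x. x \<notin> N \<Longrightarrow> (F has_derivative dif F x) (at x)"
    and R: "R > 0" and c: "\<And>y. norm (matrix_inv A *v y) \<le> B * norm y"
  defines "Q \<equiv> cbox 0 (R *\<^sub>R (\<chi> j. 1)) :: (real^'n) set"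
  obtains m where "((\<lambda>x. \<bar>jacobian F x\<bar>) has_integral m) (Q - N)" "m \<le> (R + 2 * (\<bar>B\<bar> * C)) ^ CARD('n)"
proof -
  have inv: "invertible A" using detA by (auto simp: invertible_det_nz)
  have Nb: "N \<in> sets borel" using N by auto
  have S: "Q - N \<in> sets borel" using Nb by (auto simp: Q_def)
  have contG: "continuous_on UNIV G" and contF: "continuous_on UNIV F" using homeo by (auto simp: homeomorphism_def)
  have GF: "G (F x) = x" and FG: "F (G x) = x" for x using homeo by (auto simp: homeomorphism_def)
  \<comment> \<open>As a preimage under the continuous inverse, the image is a Borel set.\<close>
  have "F ` (Q - N) = G -` (Q - N)"
  proof
    show "F ` (Q - N) \<subseteq> G -` (Q - N)" using GF by auto
    show "G -` (Q - N) \<subseteq> F ` (Q - N)"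
    proof
      fix y assume "y \<in> G -` (Q - N)"
      then show "y \<in> F ` (Q - N)" using FG[of y] by (intro image_eqI[of y F "G y"]) auto
    qed
  qed
  moreover have "G \<in> borel_measurable borel" using contG by (rule borel_measurable_continuous_onI)
  ultimately have FSb: "F ` (Q - N) \<in> sets borel" using measurable_sets[of G borel borel "Q - N"] S by simp
  define b where "b = \<bar>B\<bar> * C"
  have C0: "0 \<le> C" using near[of 0] norm_ge_zero order_trans by blast
  have sub: "F ` (Q - N) \<subseteq> (*v) A ` cbox (- b *\<^sub>R (\<chi> j. 1)) ((R + b) *\<^sub>R (\<chi> j. 1))"
  proof
    fix y assume "y \<in> F ` (Q - N)"
    then obtain x where x: "x \<in> Q" "y = F x" by auto
    let ?z = "matrix_inv A *v (F x - A *v x)"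
    have "norm ?z \<le> B * norm (F x - A *v x)" by (rule c)
    also have "\<dots> \<le> \<bar>B\<bar> * norm (F x - A *v x)" by (intro mult_right_mono) auto
    also have "\<dots> \<le> b" unfolding b_def using near by (intro mult_left_mono) auto
    finally have z: "\<bar>?z $ j\<bar> \<le> b" for j using component_le_norm_cart[of ?z j] by linarith
    have "A *v (x + ?z) = y"
      by (simp add: x matrix_vector_right_distrib matrix_vector_mul_assoc matrix_inv_left_right[OF inv])
    moreover have "x + ?z \<in> cbox (- b *\<^sub>R (\<chi> j. 1)) ((R + b) *\<^sub>R (\<chi> j. 1))"
      unfolding mem_box_cart
    proof
      fix j
      have "0 \<le> x $ j \<and> x $ j \<le> R" using x(1) by (simp add: Q_def mem_box_cart)
      then show "(- b *\<^sub>R (\<chi> j. 1)) $ j \<le> (x + ?z) $ j \<and> (x + ?z) $ j \<le> ((R + b) *\<^sub>R (\<chi> j. 1)) $ j"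
        using z[of j] by (simp add: abs_le_iff)
    qed
    ultimately show "y \<in> (*v) A ` cbox (- b *\<^sub>R (\<chi> j. 1)) ((R + b) *\<^sub>R (\<chi> j. 1))" by blast
  qed
  note im = measure_matrix_image_cbox[OF inv, of "- b *\<^sub>R (\<chi> j. 1)" "(R + b) *\<^sub>R (\<chi> j. 1)"]
  have FS: "F ` (Q - N) \<in> lmeasurable"
    by (rule fmeasurableI2[OF im(1) sub]) (use FSb in simp)
  have "b \<ge> 0" using C0 by (simp add: b_def)
  have "measure lebesgue (F ` (Q - N)) \<le> measure lebesgue ((*v) A ` cbox (- b *\<^sub>R (\<chi> j. 1)) ((R + b) *\<^sub>R (\<chi> j. 1)))"
    by (rule measure_mono_fmeasurable[OF sub _ im(1)]) (use FSb in simp)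
  also have "\<dots> = (R + 2 * b) ^ CARD('n)"
    unfolding im(2) detA using R \<open>b \<ge> 0\<close>
    by (simp add: content_cbox_if_cart interval_eq_empty_cart not_less) (simp add: algebra_simps)
  finally have le: "measure lebesgue (F ` (Q - N)) \<le> (R + 2 * b) ^ CARD('n)" .
  have "inj_on F (Q - N)" by (rule inj_on_inverseI[of _ G]) (rule GF)
  moreover have "(F has_derivative dif F x) (at x within Q - N)" if "x \<in> Q - N" for x
    using DN[of x] that by (auto intro: has_derivative_at_withinI)
  ultimately have "((\<lambda>x. \<bar>det (matrix (dif F x))\<bar>) has_integral measure lebesgue (F ` (Q - N))) (Q - N)"
    using has_measure_differentiable_image_finite[OF S, of F "dif F"] FS by blast
  then show ?thesis using that le by (simp add: jacobian_def b_def)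
qed

lemma outer_dilatation_bound:
  assumes u: "norm u = 1"
  shows "norm (A *v u) ^ CARD('n) \<le> K"
proof (cases "A *v u = 0")
  case True
  then show ?thesis using K by (simp add: zero_power)
next
  case False
  define L where "L = norm (A *v u)"
  define n where "n = CARD('n)"
  \<comment> \<open>The direction of \<open>A *v u\<close>: pairing with it replaces the
    vector-valued mean of the derivative by a scalar whose target value is exactly
    \<open>L\<close>.\<close>
  define w where "w = (1 / L) *\<^sub>R (A *v u)"
  have L: "L > 0" and w: "norm w = 1" using False by (simp_all add: L_def w_def)
  have wAu: "w \<bullet> (A *v u) = L" using L by (simp add: w_def L_def flip: power2_norm_eq_inner) (simp add: power2_eq_square)
  obtain N where N: "N \<in> null_sets lborel" and DN: "\<And>x. x \<notin> N \<Longrightarrow> (F has_derivative dif F x) (at x)"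
    and dilN: "\<And>x. x \<notin> N \<Longrightarrow> max_stretch (dif F x) ^ n \<le> K * \<bar>jacobian F x\<bar>"
    unfolding n_def using exceptional_set by metis
  have Nb[measurable]: "N \<in> sets borel" using N by auto
  obtain B where B: "\<And>y. norm (matrix_inv A *v y) \<le> B * norm y"
    using linear_bounded[OF matrix_vector_mul_linear] by blast
  have contF: "continuous_on UNIV F" using homeo by (auto simp: homeomorphism_def)
  have lin: "linear (dif F x)" if "x \<notin> N" for x using DN[OF that] by (rule has_derivative_linear)
  define g where "g i x = (if x \<in> N then 0 else dif F x (axis i 1))" for i x
  have gm[measurable]: "g i \<in> borel_measurable borel" for i
    unfolding g_def[abs_def] by (rule directional_derivative_borel_measurable[OF contF Nb DN])
  \<comment> \<open>The estimate for a cube of side R. The error in the mean derivative and the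
    excess volume of the image both enter only through multiples of 1/R.\<close>
  have key: "L ^ n * (1 + real n * ((L - (\<Sum>i\<in>UNIV. \<bar>u $ i\<bar> * (2 * C / R))) / L - 1)) \<le> K * (1 + 2 * (\<bar>B\<bar> * C) / R) ^ n" if R: "R > 0" for R
  proof -
    let ?Q = "cbox 0 (R *\<^sub>R (\<chi> j. 1)) :: (real^'n) set"
    obtain m where m: "((\<lambda>x. \<bar>jacobian F x\<bar>) has_integral m) (?Q - N)" "m \<le> (R + 2 * (\<bar>B\<bar> * C)) ^ n"
      unfolding n_def using jacobian_mass[OF N DN R B] by metis
    have "(\<lambda>x. \<bar>jacobian F x\<bar>) absolutely_integrable_on (?Q - N)"
      using m(1) by (intro nonnegative_absolutely_integrable_1) auto
    then have Jint: "integrable lebesgue (\<lambda>x. indicat_real (?Q - N) x * \<bar>jacobian F x\<bar>)" by (simp add: set_integrable_def)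
    have "?Q - N \<in> lmeasurable" using Nb by (intro fmeasurable_Diff) auto
    then have Iint: "integrable lebesgue (indicat_real (?Q - N))" by (simp add: lmeasurable_iff_integrable)
    define h where "h i x = indicat_real ?Q x * (w \<bullet> g i x)" for i x
    \<comment> \<open>Integrability of the derivative: a stretch r satisfies r <= 1 + r^n, and r^n
      is dominated by \<open>K\<close> times the Jacobian, which is integrable.\<close>
    have hb: "\<bar>h i x\<bar> \<le> indicat_real (?Q - N) x + K * (indicat_real (?Q - N) x * \<bar>jacobian F x\<bar>)" for i x
    proof (cases "x \<in> ?Q - N")
      case True
      let ?r = "max_stretch (dif F x)"
      have "\<bar>w \<bullet> g i x\<bar> \<le> norm w * norm (g i x)" by (rule Cauchy_Schwarz_ineq2)
      also have "\<dots> \<le> ?r" using max_stretch_bound[OF lin, of x "axis i 1"] True w by (simp add: g_def)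
      finally have gr: "\<bar>w \<bullet> g i x\<bar> \<le> ?r" .
      then have r0: "?r \<ge> 0" using abs_ge_zero order_trans by blast
      have "?r \<le> 1 + ?r ^ n"
      proof (cases "?r \<le> 1")
        case False
        then show ?thesis using self_le_power[of ?r n] by (simp add: n_def)
      qed (use r0 in \<open>simp add: add_increasing2\<close>)
      then have "\<bar>w \<bullet> g i x\<bar> \<le> 1 + K * \<bar>jacobian F x\<bar>" using dilN[of x] True gr by simp
      then show ?thesis using True by (simp add: h_def)
    next
      case False
      then show ?thesis by (auto simp: h_def g_def indicator_def)
    qed
    have hint: "integrable lborel (h i)" for i
    proof -
      have hm: "h i \<in> borel_measurable borel" unfolding h_def[abs_def] by measurable
      have "integrable lebesgue (h i)"
      proof (rule Bochner_Integration.integrable_bound)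
        show "integrable lebesgue (\<lambda>x. indicat_real (?Q - N) x + K * (indicat_real (?Q - N) x * \<bar>jacobian F x\<bar>))"
          using Iint Jint by (intro Bochner_Integration.integrable_add integrable_mult_right)
        show "h i \<in> borel_measurable lebesgue" using hm by (simp add: measurable_completion)
        show "AE x in lebesgue. norm (h i x) \<le> norm (indicat_real (?Q - N) x + K * (indicat_real (?Q - N) x * \<bar>jacobian F x\<bar>))"
        proof (rule AE_I2)
          fix x show "norm (h i x) \<le> norm (indicat_real (?Q - N) x + K * (indicat_real (?Q - N) x * \<bar>jacobian F x\<bar>))"
            unfolding real_norm_def using hb[of i x] by linarith
        qed
      qed
      \<comment> \<open>The dominating Jacobian is integrable for \<open>lebesgue\<close>, while the
        line integrals use \<open>lborel\<close>; \<open>h i\<close> is Borel, so its integrability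
        transfers.\<close>
      then show ?thesis using integrable_completion[of "h i" lborel] hm by simp
    qed
    have avg: "\<bar>(\<integral>x. h i x \<partial>lborel) - R ^ n * (w \<bullet> (A *v axis i 1))\<bar> \<le> R ^ n * (2 * C / R)" for i
      using average_derivative[OF N DN R w, of i] hint[of i] unfolding h_def[abs_def] g_def n_def by simp
    define p where "p x = (\<Sum>i\<in>UNIV. u $ i * h i x)" for x
    have pint: "integrable lborel p" unfolding p_def[abs_def] using hint by (intro Bochner_Integration.integrable_sum integrable_mult_right)
    have "R ^ n * L = (\<Sum>i\<in>UNIV. u $ i * (R ^ n * (w \<bullet> (A *v axis i 1))))"
    proof -
      have "A *v u = A *v (\<Sum>i\<in>UNIV. u $ i *\<^sub>R axis i 1)" by (simp add: basis_expansion[of u, unfolded scalar_mult_eq_scaleR])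
      also have "\<dots> = (\<Sum>i\<in>UNIV. u $ i *\<^sub>R (A *v axis i 1))"
        by (simp add: linear_sum[OF matrix_vector_mul_linear] matrix_vector_mult_scaleR)
      finally have "L = (\<Sum>i\<in>UNIV. u $ i * (w \<bullet> (A *v axis i 1)))" using wAu by (simp add: inner_sum_right)
      then show ?thesis by (simp add: sum_distrib_left mult_ac)
    qed
    moreover have "(\<integral>x. p x \<partial>lborel) = (\<Sum>i\<in>UNIV. u $ i * (\<integral>x. h i x \<partial>lborel))"
      unfolding p_def using hint by (subst Bochner_Integration.integral_sum) (auto intro: integrable_mult_right)
    ultimately have "R ^ n * L - (\<integral>x. p x \<partial>lborel) = (\<Sum>i\<in>UNIV. u $ i * (R ^ n * (w \<bullet> (A *v axis i 1)) - (\<integral>x. h i x \<partial>lborel)))"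
      by (simp add: sum_subtractf right_diff_distrib)
    also have "\<dots> \<le> (\<Sum>i\<in>UNIV. \<bar>u $ i\<bar> * (R ^ n * (2 * C / R)))"
    proof (rule sum_mono)
      fix i
      have "u $ i * (R ^ n * (w \<bullet> (A *v axis i 1)) - (\<integral>x. h i x \<partial>lborel)) \<le> \<bar>u $ i\<bar> * \<bar>R ^ n * (w \<bullet> (A *v axis i 1)) - (\<integral>x. h i x \<partial>lborel)\<bar>"
        by (metis abs_ge_self abs_mult)
      also have "\<dots> \<le> \<bar>u $ i\<bar> * (R ^ n * (2 * C / R))"
        using avg[of i] by (intro mult_left_mono) (auto simp: abs_minus_commute)
      finally show "u $ i * (R ^ n * (w \<bullet> (A *v axis i 1)) - (\<integral>x. h i x \<partial>lborel)) \<le> \<bar>u $ i\<bar> * (R ^ n * (2 * C / R))" .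
    qed
    also have "\<dots> = R ^ n * (\<Sum>i\<in>UNIV. \<bar>u $ i\<bar> * (2 * C / R))" by (simp add: sum_distrib_left mult_ac)
    finally have plow: "R ^ n * (L - (\<Sum>i\<in>UNIV. \<bar>u $ i\<bar> * (2 * C / R))) \<le> (\<integral>x. p x \<partial>lborel)" by (simp add: algebra_simps)
    \<comment> \<open>The integrated form of \<open>power_tangent_bound\<close>: the tangent line at
      L is evaluated at the directional derivative \<open>p x\<close>, which is at most the stretch
      of the derivative.\<close>
    let ?T = "\<lambda>x. L ^ n * (indicat_real (?Q - N) x + real n * (p x / L - indicat_real (?Q - N) x))"
    have pw: "?T x \<le> K * (indicat_real (?Q - N) x * \<bar>jacobian F x\<bar>)" for x
    proof (cases "x \<in> ?Q - N")
      case True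
      let ?r = "max_stretch (dif F x)"
      have "dif F x u = dif F x (\<Sum>i\<in>UNIV. u $ i *\<^sub>R axis i 1)" by (simp add: basis_expansion[of u, unfolded scalar_mult_eq_scaleR])
      also have "\<dots> = (\<Sum>i\<in>UNIV. u $ i *\<^sub>R dif F x (axis i 1))"
        using True lin by (simp add: linear_sum linear_cmul)
      finally have "p x = w \<bullet> dif F x u" using True by (simp add: p_def h_def g_def inner_sum_right)
      also have "\<dots> \<le> norm w * norm (dif F x u)" by (rule norm_cauchy_schwarz)
      also have "\<dots> \<le> ?r" using max_stretch_bound[OF lin, of x u] True w u by simp
      finally have pr: "p x \<le> ?r" .
      have "norm (dif F x u) \<le> ?r" using max_stretch_bound[OF lin, of x u] True u by simp
      then have r0: "0 \<le> ?r" by (rule order_trans[OF norm_ge_zero])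
      have "?T x \<le> L ^ n * (1 + real n * (?r / L - 1))"
        using True pr L by (intro mult_left_mono add_mono mult_mono diff_mono divide_right_mono) auto
      also have "\<dots> \<le> ?r ^ n" using r0 L by (rule power_tangent_bound)
      also have "\<dots> \<le> K * \<bar>jacobian F x\<bar>" using dilN True by blast
      finally show ?thesis using True by simp
    next
      case False
      then have "h i x = 0" for i by (auto simp: h_def g_def indicator_def)
      then show ?thesis using False by (simp add: p_def)
    qed
    have pint': "integrable lebesgue p" using pint integrable_completion[of p lborel] by (simp add: integrable_iff_bounded)
    have Tint: "integrable lebesgue ?T" using pint' Iint by (intro integrable_mult_right Bochner_Integration.integrable_add Bochner_Integration.integrable_diff integrable_divide_zero) auto
    have QN: "(\<integral>x. indicat_real (?Q - N) x \<partial>lebesgue) = R ^ n"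
    proof -
      have "measure lebesgue (?Q - N) = measure lebesgue ?Q"
        using N by (intro measure_Diff_null_set) (auto intro: null_sets_completionI)
      also have "\<dots> = R ^ n" using R by (simp add: content_cbox_if_cart interval_eq_empty_cart n_def)
      finally show ?thesis by simp
    qed
    have Jval: "(\<integral>x. indicat_real (?Q - N) x * \<bar>jacobian F x\<bar> \<partial>lebesgue) = m"
    proof -
      have "((\<lambda>x. indicat_real (?Q - N) x * \<bar>jacobian F x\<bar>) has_integral (\<integral>x. indicat_real (?Q - N) x * \<bar>jacobian F x\<bar> \<partial>lebesgue)) UNIV"
        by (rule has_integral_integral_lebesgue[OF Jint])
      moreover have "((\<lambda>x. indicat_real (?Q - N) x * \<bar>jacobian F x\<bar>) has_integral m) UNIV"
      proof -
        have "((\<lambda>x. if x \<in> ?Q - N then \<bar>jacobian F x\<bar> else 0) has_integral m) UNIV"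
          using m(1) by (subst has_integral_restrict_UNIV)
        moreover have "(\<lambda>x. if x \<in> ?Q - N then \<bar>jacobian F x\<bar> else 0) = (\<lambda>x. indicat_real (?Q - N) x * \<bar>jacobian F x\<bar>)"
          by (auto simp: indicator_def)
        ultimately show ?thesis by simp
      qed
      ultimately show ?thesis by (rule has_integral_unique)
    qed
    have "(\<integral>x. ?T x \<partial>lebesgue) \<le> (\<integral>x. K * (indicat_real (?Q - N) x * \<bar>jacobian F x\<bar>) \<partial>lebesgue)"
      by (rule integral_mono[OF Tint integrable_mult_right[OF Jint] pw])
    also have "\<dots> = K * m" by (simp add: Jval)
    also have "\<dots> \<le> K * (R + 2 * (\<bar>B\<bar> * C)) ^ n" using m(2) K by (rule mult_left_mono)
    also have "(\<integral>x. ?T x \<partial>lebesgue) = L ^ n * (R ^ n + real n * ((\<integral>x. p x \<partial>lborel) / L - R ^ n))"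
    proof (rule has_bochner_integral_integral_eq)
      have "has_bochner_integral lebesgue p (\<integral>x. p x \<partial>lborel)"
        using pint' integral_completion[of p lborel] borel_measurable_integrable[OF pint] by (simp add: has_bochner_integral_iff)
      moreover have "has_bochner_integral lebesgue (indicat_real (?Q - N)) (R ^ n)"
        unfolding has_bochner_integral_iff using Iint QN by blast
      ultimately show "has_bochner_integral lebesgue ?T (L ^ n * (R ^ n + real n * ((\<integral>x. p x \<partial>lborel) / L - R ^ n)))"
        by (intro has_bochner_integral_mult_right has_bochner_integral_add has_bochner_integral_diff has_bochner_integral_divide_zero) auto
    qed
    finally have fin: "L ^ n * (R ^ n + real n * ((\<integral>x. p x \<partial>lborel) / L - R ^ n)) \<le> K * (R + 2 * (\<bar>B\<bar> * C)) ^ n" .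
    let ?s = "L - (\<Sum>i\<in>UNIV. \<bar>u $ i\<bar> * (2 * C / R))"
    have "R ^ n * (L ^ n * (1 + real n * (?s / L - 1))) = L ^ n * (R ^ n + real n * ((R ^ n * ?s) / L - R ^ n))"
      by (simp add: algebra_simps)
    also have "\<dots> \<le> L ^ n * (R ^ n + real n * ((\<integral>x. p x \<partial>lborel) / L - R ^ n))"
      using plow L by (intro mult_left_mono add_mono diff_mono divide_right_mono) auto
    also note fin
    also have "K * (R + 2 * (\<bar>B\<bar> * C)) ^ n = R ^ n * (K * (1 + 2 * (\<bar>B\<bar> * C) / R) ^ n)"
    proof -
      have "R + 2 * (\<bar>B\<bar> * C) = R * (1 + 2 * (\<bar>B\<bar> * C) / R)" using R by (simp add: field_simps)
      then show ?thesis by (metis mult.left_commute power_mult_distrib)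
    qed
    finally show ?thesis by (rule mult_left_le_imp_le) (use R in simp)
  qed
  \<comment> \<open>The limit of \<open>key\<close> along R = k + 1, with 0 in the places of
    1/R.\<close>
  have "L ^ n * (1 + real n * ((L - (\<Sum>i\<in>UNIV. \<bar>u $ i\<bar> * (2 * C * 0))) / L - 1)) \<le> K * (1 + 2 * (\<bar>B\<bar> * C) * 0) ^ n"
  proof (rule LIMSEQ_le)
    have z: "(\<lambda>k. 1 / real (Suc k)) \<longlonglongrightarrow> 0" using LIMSEQ_inverse_real_of_nat by (simp add: inverse_eq_divide)
    show "(\<lambda>k. L ^ n * (1 + real n * ((L - (\<Sum>i\<in>UNIV. \<bar>u $ i\<bar> * (2 * C * (1 / real (Suc k))))) / L - 1)))
      \<longlonglongrightarrow> L ^ n * (1 + real n * ((L - (\<Sum>i\<in>UNIV. \<bar>u $ i\<bar> * (2 * C * 0))) / L - 1))"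
      using L by (intro tendsto_intros z) auto
    show "(\<lambda>k. K * (1 + 2 * (\<bar>B\<bar> * C) * (1 / real (Suc k))) ^ n) \<longlonglongrightarrow> K * (1 + 2 * (\<bar>B\<bar> * C) * 0) ^ n"
      by (intro tendsto_intros z)
    show "\<exists>N. \<forall>k\<ge>N. L ^ n * (1 + real n * ((L - (\<Sum>i\<in>UNIV. \<bar>u $ i\<bar> * (2 * C * (1 / real (Suc k))))) / L - 1))
      \<le> K * (1 + 2 * (\<bar>B\<bar> * C) * (1 / real (Suc k))) ^ n"
      using key[of "real (Suc _)"] by (intro exI[of _ 0] allI impI) (simp add: mult.assoc)
  qed
  then show ?thesis using L by (simp add: L_def n_def)
qed

end

section \<open>Dilatations of a quasiconformal lift and of its inverse\<close>

lemma min_stretch_bound: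
  fixes D :: "real^'n \<Rightarrow> real^'m"
  assumes "linear D"
  shows "min_stretch D * norm v \<le> norm (D v)" and "0 \<le> min_stretch D"
proof -
  show "0 \<le> min_stretch D" unfolding min_stretch_def using sphere_0_1_nonempty by (intro cINF_greatest) auto
  show "min_stretch D * norm v \<le> norm (D v)"
  proof (cases "v = 0")
    case False
    have "min_stretch D \<le> norm (D ((1 / norm v) *\<^sub>R v))"
      unfolding min_stretch_def
    proof (rule cINF_lower)
      show "bdd_below ((\<lambda>x. norm (D x)) ` sphere 0 1)" by (rule bdd_belowI2[of _ 0]) simp
    qed (use False in simp)
    then have "min_stretch D \<le> norm (D v) / norm v" by (simp add: linear_cmul[OF assms])
    then show ?thesis using False by (simp add: le_divide_eq)
  qed simp
qed

lemma max_stretch_nonneg: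
  fixes D :: "real^'n \<Rightarrow> real^'m"
  assumes "linear D" shows "0 \<le> max_stretch D"
proof -
  obtain u :: "real^'n" where u: "norm u = 1" using vector_choose_size[of 1] by auto
  have "norm (D u) \<le> max_stretch D" using max_stretch_bound[OF assms, of u] u by simp
  then show ?thesis by (rule order_trans[OF norm_ge_zero])
qed

lemma max_stretch_le:
  fixes D :: "real^'n \<Rightarrow> real^'m"
  assumes "\<And>v. norm (D v) \<le> c * norm v" shows "max_stretch D \<le> c"
  unfolding max_stretch_def
proof (rule cSUP_least)
  fix v :: "real^'n" assume "v \<in> sphere 0 1"
  then show "norm (D v) \<le> c" using assms[of v] by simp
qed (rule sphere_0_1_nonempty)

lemma min_stretch_ge:
  fixes D :: "real^'n \<Rightarrow> real^'m"
  assumes "\<And>v. c * norm v \<le> norm (D v)" shows "c \<le> min_stretch D"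
  unfolding min_stretch_def
proof (rule cINF_greatest)
  fix v :: "real^'n" assume "v \<in> sphere 0 1"
  then show "c \<le> norm (D v)" using assms[of v] by simp
qed (rule sphere_0_1_nonempty)

text \<open>By the chain rule the two derivatives compose to the identity, so the smallest stretch
  of one bounds the largest stretch of the other and the Jacobians are reciprocal.\<close>

lemma inverse_derivatives:
  fixes F G :: "real^'n \<Rightarrow> real^'n"
  assumes FG: "\<And>y. F (G y) = y" and F: "(F has_derivative dif F (G y)) (at (G y))" and G: "(G has_derivative dif G y) (at y)"
  shows "max_stretch (dif G y) * min_stretch (dif F (G y)) \<le> 1" "\<bar>jacobian F (G y)\<bar> * \<bar>jacobian G y\<bar> = 1"
proof -
  note linF = has_derivative_linear[OF F] and linG = has_derivative_linear[OF G]
  have "(F \<circ> G has_derivative dif F (G y) \<circ> dif G y) (at y)" using G F by (rule diff_chain_at)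
  moreover have "(F \<circ> G has_derivative id) (at y)" using FG by (simp add: o_def id_def)
  ultimately have id: "dif F (G y) \<circ> dif G y = id" by (rule has_derivative_unique)
  have ap: "dif F (G y) (dif G y v) = v" for v using fun_cong[OF id, of v] by simp
  let ?l = "min_stretch (dif F (G y))"
  show "max_stretch (dif G y) * ?l \<le> 1"
  proof (cases "?l = 0")
    case False
    then have l: "?l > 0" using min_stretch_bound(2)[OF linF] by simp
    have "max_stretch (dif G y) \<le> 1 / ?l"
    proof (rule max_stretch_le)
      fix v
      have "?l * norm (dif G y v) \<le> norm v" using min_stretch_bound(1)[OF linF, of "dif G y v"] by (simp add: ap)
      then show "norm (dif G y v) \<le> 1 / ?l * norm v" using l by (simp add: field_simps)
    qed
    then show ?thesis using l by (simp add: field_simps)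
  qed simp
  have "matrix (dif F (G y)) ** matrix (dif G y) = mat 1"
    by (rule matrix_eq[THEN iffD2]) (simp add: matrix_works linF linG ap flip: matrix_vector_mul_assoc)
  then have "jacobian F (G y) * jacobian G y = 1" unfolding jacobian_def by (metis det_I det_mul)
  then show "\<bar>jacobian F (G y)\<bar> * \<bar>jacobian G y\<bar> = 1" by (metis abs_1 abs_mult)
qed

text \<open>Points over the exceptional set of \<open>F\<close> do not matter: by the change of variables formula the
  Jacobian of \<open>G\<close> vanishes almost everywhere there.\<close>

lemma outer_dilatation_of_inverse:
  fixes F G :: "real^'n \<Rightarrow> real^'n"
  assumes homeo: "homeomorphism UNIV UNIV F G"
    and dF: "AE x in lebesgue. F differentiable (at x)" and dG: "AE y in lebesgue. G differentiable (at y)"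
    and inner: "AE x in lebesgue. \<bar>jacobian F x\<bar> \<le> K * min_stretch (dif F x) ^ CARD('n)"
    and outer: "AE y in lebesgue. max_stretch (dif G y) ^ CARD('n) \<le> K' * \<bar>jacobian G y\<bar>"
    and K: "0 \<le> K"
  shows "AE y in lebesgue. max_stretch (dif G y) ^ CARD('n) \<le> K * \<bar>jacobian G y\<bar>"
proof -
  have contG: "continuous_on UNIV G" and contF: "continuous_on UNIV F" using homeo by (auto simp: homeomorphism_def)
  have GF: "G (F x) = x" and FG: "F (G x) = x" for x using homeo by (auto simp: homeomorphism_def)
  have "AE x in lborel. F differentiable (at x) \<and> \<bar>jacobian F x\<bar> \<le> K * min_stretch (dif F x) ^ CARD('n)"
    using dF inner by (simp add: AE_completion_iff)
  then obtain N where N: "{x \<in> space lborel. \<not> (F differentiable (at x) \<and> \<bar>jacobian F x\<bar> \<le> K * min_stretch (dif F x) ^ CARD('n))} \<subseteq> N"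
    "emeasure lborel N = 0" "N \<in> sets lborel" by (rule AE_E)
  have "AE y in lborel. G differentiable (at y) \<and> max_stretch (dif G y) ^ CARD('n) \<le> K' * \<bar>jacobian G y\<bar>"
    using dG outer by (simp add: AE_completion_iff)
  then obtain N' where N': "{y \<in> space lborel. \<not> (G differentiable (at y) \<and> max_stretch (dif G y) ^ CARD('n) \<le> K' * \<bar>jacobian G y\<bar>)} \<subseteq> N'"
    "emeasure lborel N' = 0" "N' \<in> sets lborel" by (rule AE_E)
  have DF: "(F has_derivative dif F x) (at x)" "\<bar>jacobian F x\<bar> \<le> K * min_stretch (dif F x) ^ CARD('n)" if "x \<notin> N" for x
    using N(1) that by (auto simp: frechet_derivative_works[symmetric])
  have DG: "(G has_derivative dif G y) (at y)" "max_stretch (dif G y) ^ CARD('n) \<le> K' * \<bar>jacobian G y\<bar>" if "y \<notin> N'" for y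
    using N'(1) that by (auto simp: frechet_derivative_works[symmetric])
  define M where "M = G -` N - N'"
  have [measurable]: "G \<in> borel_measurable borel" using contG by (rule borel_measurable_continuous_onI)
  have "G -` N \<in> sets borel" using measurable_sets[of G borel borel N] N(3) by simp
  then have Mb: "M \<in> sets borel" using N'(3) by (auto simp: M_def)
  have "N \<in> null_sets lebesgue" using N(2,3) by (intro null_sets_completionI) auto
  then have "negligible N" by (simp add: negligible_iff_null_sets)
  then have GM: "negligible (G ` M)" by (rule negligible_subset) (auto simp: M_def)
  have "inj_on G M" by (rule inj_on_inverseI[of _ F]) (rule FG)
  moreover have "(G has_derivative dif G y) (at y within M)" if "y \<in> M" for y
    using DG(1)[of y] that by (auto simp: M_def intro: has_derivative_at_withinI)
  ultimately have "((\<lambda>y. \<bar>jacobian G y\<bar>) has_integral 0) M"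
    using has_measure_differentiable_image_finite[OF Mb, of G "dif G" 0] GM
    by (simp add: jacobian_def negligible_imp_measurable negligible_imp_measure0)
  moreover from this have "(\<lambda>y. \<bar>jacobian G y\<bar>) absolutely_integrable_on M"
    by (intro nonnegative_absolutely_integrable_1) auto
  then have Jint: "integrable lebesgue (\<lambda>y. indicat_real M y * \<bar>jacobian G y\<bar>)" by (simp add: set_integrable_def)
  ultimately have "(\<integral>y. indicat_real M y * \<bar>jacobian G y\<bar> \<partial>lebesgue) = 0"
  proof -
    have "((\<lambda>y. indicat_real M y * \<bar>jacobian G y\<bar>) has_integral (\<integral>y. indicat_real M y * \<bar>jacobian G y\<bar> \<partial>lebesgue)) UNIV"
      by (rule has_integral_integral_lebesgue[OF Jint])
    moreover have "((\<lambda>y. if y \<in> M then \<bar>jacobian G y\<bar> else 0) has_integral 0) UNIV"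
      using \<open>((\<lambda>y. \<bar>jacobian G y\<bar>) has_integral 0) M\<close> by (subst has_integral_restrict_UNIV)
    moreover have "(\<lambda>y. if y \<in> M then \<bar>jacobian G y\<bar> else 0) = (\<lambda>y. indicat_real M y * \<bar>jacobian G y\<bar>)"
      by (auto simp: indicator_def)
    ultimately show ?thesis using has_integral_unique by metis
  qed
  then have "AE y in lebesgue. indicat_real M y * \<bar>jacobian G y\<bar> = 0"
    using integral_nonneg_eq_0_iff_AE[OF Jint] by simp
  moreover have "AE y in lebesgue. y \<notin> N'" using N'(2,3) by (intro AE_completion AE_not_in) auto
  ultimately show ?thesis
  proof eventually_elim
    fix y assume J0: "indicat_real M y * \<bar>jacobian G y\<bar> = 0" and y: "y \<notin> N'"
    let ?L = "max_stretch (dif G y)" and ?l = "min_stretch (dif F (G y))"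
    show "?L ^ CARD('n) \<le> K * \<bar>jacobian G y\<bar>"
    proof (cases "G y \<in> N")
      case True
      then have "\<bar>jacobian G y\<bar> = 0" using J0 y by (simp add: M_def)
      \<comment> \<open>The finite bound \<open>K'\<close> turns a vanishing Jacobian into a
        vanishing stretch, whatever the size of \<open>K'\<close>.\<close>
      then show ?thesis using DG(2)[OF y] by simp
    next
      case False
      note inv = inverse_derivatives[of F G, OF FG DF(1)[OF False] DG(1)[OF y]]
      have L0: "0 \<le> ?L" by (rule max_stretch_nonneg[OF has_derivative_linear[OF DG(1)[OF y]]])
      have l0: "0 \<le> ?l" by (rule min_stretch_bound(2)[OF has_derivative_linear[OF DF(1)[OF False]]])
      have "?L ^ CARD('n) = ?L ^ CARD('n) * (\<bar>jacobian F (G y)\<bar> * \<bar>jacobian G y\<bar>)" by (simp add: inv(2))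
      also have "\<dots> \<le> ?L ^ CARD('n) * ((K * ?l ^ CARD('n)) * \<bar>jacobian G y\<bar>)"
        using L0 DF(2)[OF False] by (intro mult_left_mono mult_right_mono) auto
      also have "\<dots> = K * \<bar>jacobian G y\<bar> * (?L * ?l) ^ CARD('n)" by (simp add: power_mult_distrib mult_ac)
      also have "\<dots> \<le> K * \<bar>jacobian G y\<bar> * 1"
        using inv(1) L0 l0 K by (intro mult_left_mono power_le_one) auto
      finally show ?thesis by simp
    qed
  qed
qed

text \<open>The difference of \<open>F\<close> and its deck matrix is periodic, so its values on a
  compact ball meeting every coset bound it everywhere.\<close>

lemma lift_near_deck:
  assumes L: "\<Lambda> \<in> unit_lattices" and F: "continuous_on UNIV F" "deck \<Lambda> F A"
  obtains C where "\<And>x. norm (F x - A *v x) \<le> C"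
proof -
  obtain r where r: "\<And>x. \<exists>l\<in>\<Lambda>. norm (x - l) \<le> r" using lattice_cobounded[OF L] by metis
  have "continuous_on (cball 0 r) (\<lambda>x. F x - A *v x)"
    using F(1) by (intro continuous_intros) (auto intro: continuous_on_subset)
  then have "bounded ((\<lambda>x. F x - A *v x) ` cball 0 r)" by (intro compact_imp_bounded compact_continuous_image) auto
  then obtain C where "\<forall>z \<in> (\<lambda>x. F x - A *v x) ` cball 0 r. norm z \<le> C" unfolding bounded_iff by blast
  then have C: "\<And>x. norm x \<le> r \<Longrightarrow> norm (F x - A *v x) \<le> C" by simp
  show ?thesis
  proof (rule that[of C])
    fix x
    obtain l where l: "l \<in> \<Lambda>" "norm (x - l) \<le> r" using r by blast
    have "F ((x - l) + l) = F (x - l) + A *v l" using F(2) l(1) by (rule deckD)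
    then have "F x - A *v x = F (x - l) - A *v (x - l)" by (simp add: matrix_vector_mult_diff_distrib)
    then show "norm (F x - A *v x) \<le> C" using C[OF l(2)] by simp
  qed
qed

text \<open>The outer bound is applied to \<open>F\<close>, which stays near
  \<open>transition p q\<close>, and to its inverse, which stays near \<open>transition q p\<close>;
  an inner bound for \<open>F\<close> is an outer bound for the inverse. \<open>K\<close> is
  arbitrary, ready for the infima in the two dilatations.\<close>

lemma qc_lift_dilatation_bounds:
  fixes p q :: "'n::finite marked_torus"
  assumes p: "p \<in> marked_tori" and q: "q \<in> marked_tori"
    and \<phi>: "marked_homeo p q \<phi>" and F: "is_lift (fst p) (fst q) F \<phi>" and qc: "quasiconformal F"
  shows "AE x in lebesgue. max_stretch (dif F x) ^ CARD('n) \<le> K * \<bar>jacobian F x\<bar>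
      \<Longrightarrow> sqrt (rayleigh (gram p) (gram q)) ^ CARD('n) \<le> K"
    and "AE x in lebesgue. \<bar>jacobian F x\<bar> \<le> K * min_stretch (dif F x) ^ CARD('n)
      \<Longrightarrow> sqrt (rayleigh (gram q) (gram p)) ^ CARD('n) \<le> K"
proof -
  let ?T = "transition p q" and ?T' = "transition q p" and ?G = "inv_into UNIV F"
  have Lp: "fst p \<in> unit_lattices" using p by (rule marked_torusE)
  have homeo: "homeomorphism UNIV UNIV F ?G" and qcF: "analytically_qc F" and qcG: "analytically_qc ?G"
    using qc by (auto simp: quasiconformal_def)
  have FG: "F (?G y) = y" for y using homeo by (auto simp: homeomorphism_def)
  have deck: "deck (fst p) F ?T" by (rule marked_homeo_deck[OF p q \<phi> F])
  obtain C where C: "\<And>x. norm (F x - ?T *v x) \<le> C"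
    using lift_near_deck[OF Lp _ deck] F by (auto simp: is_lift_iff)
  obtain B where B: "B > 0" "\<And>v. norm (?T' *v v) \<le> B * norm v"
    using linear_bounded_pos[OF matrix_vector_mul_linear] by blast
  have G: "norm (?G y - ?T' *v y) \<le> B * C" for y
  proof -
    have "?G y = ?T' *v (?T *v ?G y)" by (simp add: matrix_vector_mul_assoc transition_inverse[OF p q])
    then have "?G y - ?T' *v y = ?T' *v (?T *v ?G y - F (?G y))" by (simp add: FG matrix_vector_mult_diff_distrib)
    then have "norm (?G y - ?T' *v y) \<le> B * norm (?T *v ?G y - F (?G y))" by (simp only: B(2))
    also have "\<dots> \<le> B * C" using C[of "?G y"] B(1) by (intro mult_left_mono) (auto simp: norm_minus_commute)
    finally show ?thesis .
  qed
  \<comment> \<open>A priori \<open>K\<close> could be negative, so the averaging bound is used with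
    max K 0; since the left-hand side is positive, the maximum must then be \<open>K\<close>
    itself.\<close>
  have bound: "sqrt (rayleigh (gram p) (gram q)) ^ CARD('n) \<le> K"
    if p: "p \<in> marked_tori" and q: "q \<in> marked_tori"
      and le: "\<And>K' u. 0 \<le> K' \<Longrightarrow> K \<le> K' \<Longrightarrow> norm u = 1 \<Longrightarrow> norm (transition p q *v u) ^ CARD('n) \<le> K'" for p q :: "'n marked_torus" and K
  proof -
    let ?n = "CARD('n)" and ?s = "sqrt (rayleigh (gram p) (gram q))" and ?K = "max K 0"
    have n: "0 < ?n" by simp
    have s: "0 < ?s" using rayleigh_pos[OF posdef_gram[OF p] posdef_gram[OF q]] by simp
    have "norm (transition p q *v v) \<le> root ?n ?K * norm v" for v
    proof (cases "v = 0")
      case False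
      let ?u = "(1 / norm v) *\<^sub>R v"
      have "norm (transition p q *v ?u) ^ ?n \<le> ?K" by (rule le) (use False in auto)
      then have "norm (transition p q *v ?u) \<le> root ?n ?K"
        using real_root_le_mono[OF n] by (metis n norm_ge_zero real_root_power_cancel)
      then show ?thesis using False by (simp add: matrix_vector_mult_scaleR field_simps)
    qed simp
    then have "?s \<le> root ?n ?K" by (intro sqrt_rayleigh_gram_le[OF p q]) auto
    then have "?s ^ ?n \<le> root ?n ?K ^ ?n" using s by (intro power_mono) auto
    also have "\<dots> = ?K" by (rule real_root_pow_pos2[OF n]) simp
    finally have "?s ^ ?n \<le> ?K" .
    moreover have "0 < ?s ^ ?n" using s by simp
    ultimately show ?thesis by (auto simp: max_def split: if_splits)
  qed
  have AEF: "ACL F" "AE x in lebesgue. F differentiable (at x)" and AEG: "ACL ?G" "AE x in lebesgue. ?G differentiable (at x)"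
    using qcF qcG by (auto simp: analytically_qc_def)
  have hG: "homeomorphism UNIV UNIV ?G F" using homeo by (rule homeomorphism_symD)
  {
    assume o: "AE x in lebesgue. max_stretch (dif F x) ^ CARD('n) \<le> K * \<bar>jacobian F x\<bar>"
    show "sqrt (rayleigh (gram p) (gram q)) ^ CARD('n) \<le> K"
    proof (rule bound[OF p q])
      fix K' :: real and u :: "real^'n" assume K': "0 \<le> K'" "K \<le> K'" and u: "norm u = 1"
      have "AE x in lebesgue. max_stretch (dif F x) ^ CARD('n) \<le> K' * \<bar>jacobian F x\<bar>"
        using o by eventually_elim (meson K'(2) abs_ge_zero mult_right_mono order_trans)
      then show "norm (?T *v u) ^ CARD('n) \<le> K'"
        by (rule outer_dilatation_bound[OF homeo C transition_det[OF p q] AEF _ K'(1) u])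
    qed
  }
  {
    assume i: "AE x in lebesgue. \<bar>jacobian F x\<bar> \<le> K * min_stretch (dif F x) ^ CARD('n)"
    obtain K0 where "AE y in lebesgue. max_stretch (dif ?G y) ^ CARD('n) \<le> K0 * \<bar>jacobian ?G y\<bar> \<and>
        \<bar>jacobian ?G y\<bar> \<le> K0 * min_stretch (dif ?G y) ^ CARD('n)" using qcG by (auto simp: analytically_qc_def)
    then have o: "AE y in lebesgue. max_stretch (dif ?G y) ^ CARD('n) \<le> K0 * \<bar>jacobian ?G y\<bar>" by eventually_elim simp
    show "sqrt (rayleigh (gram q) (gram p)) ^ CARD('n) \<le> K"
    proof (rule bound[OF q p])
      fix K' :: real and u :: "real^'n" assume K': "0 \<le> K'" "K \<le> K'" and u: "norm u = 1"
      have i': "AE x in lebesgue. \<bar>jacobian F x\<bar> \<le> K' * min_stretch (dif F x) ^ CARD('n)"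
        using i AEF(2)
      proof eventually_elim
        fix x assume *: "\<bar>jacobian F x\<bar> \<le> K * min_stretch (dif F x) ^ CARD('n)" and "F differentiable (at x)"
        then have "(F has_derivative dif F x) (at x)" by (simp add: frechet_derivative_works[symmetric])
        then have "0 \<le> min_stretch (dif F x)" by (rule min_stretch_bound(2)[OF has_derivative_linear])
        then have "K * min_stretch (dif F x) ^ CARD('n) \<le> K' * min_stretch (dif F x) ^ CARD('n)"
          using K'(2) by (intro mult_right_mono) auto
        then show "\<bar>jacobian F x\<bar> \<le> K' * min_stretch (dif F x) ^ CARD('n)" using * by linarith
      qed
      have "AE y in lebesgue. max_stretch (dif ?G y) ^ CARD('n) \<le> K' * \<bar>jacobian ?G y\<bar>"
        by (rule outer_dilatation_of_inverse[OF homeo AEF(2) AEG(2) i' o K'(1)])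
      then show "norm (?T' *v u) ^ CARD('n) \<le> K'"
        by (rule outer_dilatation_bound[OF hG G transition_det[OF q p] AEG _ K'(1) u])
    qed
  }
qed

section \<open>Linear maps as extremal quasiconformal maps\<close>

lemma ACL_matrix:
  fixes A :: "real^'n^'n"
  shows "ACL ((*v) A)"
  unfolding ACL_def
proof (intro allI AE_I2)
  fix i :: 'n and x :: "real^'n" and a b :: real
  let ?c = "norm (A *v axis i 1)"
  show "absolutely_continuous_on_interval a b (\<lambda>t. A *v (x + t *\<^sub>R axis i 1))"
    unfolding absolutely_continuous_on_interval_def
  proof (intro allI impI)
    fix e :: real assume e: "e > 0"
    show "\<exists>d>0. \<forall>D. finite D \<and> (\<forall>(s, t) \<in> D. a \<le> s \<and> s \<le> t \<and> t \<le> b) \<and>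
        pairwise (\<lambda>(s, t) (s', t'). disjnt {s<..<t} {s'<..<t'}) D \<and>
        (\<Sum>(s, t) \<in> D. t - s) < d \<longrightarrow> (\<Sum>(s, t) \<in> D. norm (A *v (x + t *\<^sub>R axis i 1) - A *v (x + s *\<^sub>R axis i 1))) < e"
    \<comment> \<open>\<open>?c\<close> is the Lipschitz constant along the line; adding 1 keeps the
      denominator positive when it is 0.\<close>
    proof (intro exI[of _ "e / (?c + 1)"] conjI allI impI)
      have c1: "?c + 1 > 0" by (simp add: add_nonneg_pos)
      then show "0 < e / (?c + 1)" using e by simp
      fix D :: "(real \<times> real) set"
      assume D: "finite D \<and> (\<forall>(s, t) \<in> D. a \<le> s \<and> s \<le> t \<and> t \<le> b) \<and>
        pairwise (\<lambda>(s, t) (s', t'). disjnt {s<..<t} {s'<..<t'}) D \<and> (\<Sum>(s, t) \<in> D. t - s) < e / (?c + 1)"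
      have eq: "norm (A *v (x + t *\<^sub>R axis i 1) - A *v (x + s *\<^sub>R axis i 1)) = \<bar>t - s\<bar> * ?c" for s t
      proof -
        have "A *v (x + t *\<^sub>R axis i 1) - A *v (x + s *\<^sub>R axis i 1) = (t - s) *\<^sub>R (A *v axis i 1)"
          by (simp add: matrix_vector_right_distrib matrix_vector_mult_scaleR scaleR_diff_left del: matrix_vector_mult_basis)
        then show ?thesis by (simp del: matrix_vector_mult_basis)
      qed
      have "(\<Sum>(s, t) \<in> D. norm (A *v (x + t *\<^sub>R axis i 1) - A *v (x + s *\<^sub>R axis i 1))) \<le> (\<Sum>(s, t) \<in> D. (t - s) * (?c + 1))"
        unfolding eq
      proof (rule sum_mono)
        fix z assume "z \<in> D"
        then obtain s t where z: "z = (s, t)" "s \<le> t" using D by fastforce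
        have "(t - s) * ?c \<le> (t - s) * (?c + 1)" using z(2) by (intro mult_left_mono) auto
        then show "(case z of (s, t) \<Rightarrow> \<bar>t - s\<bar> * ?c) \<le> (case z of (s, t) \<Rightarrow> (t - s) * (?c + 1))" using z by simp
      qed
      also have "\<dots> = (\<Sum>(s, t) \<in> D. t - s) * (?c + 1)" by (simp add: sum_distrib_right case_prod_unfold)
      also have "\<dots> < e" using D c1 by (simp add: pos_less_divide_eq)
      finally show "(\<Sum>(s, t) \<in> D. norm (A *v (x + t *\<^sub>R axis i 1) - A *v (x + s *\<^sub>R axis i 1))) < e" .
    qed
  qed
qed

lemma dif_matrix:
  fixes A :: "real^'n^'n"
  shows "dif ((*v) A) x = (*v) A" "((*v) A) differentiable (at x)" "jacobian ((*v) A) x = det A"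
proof -
  have D: "((*v) A has_derivative (*v) A) (at x)" by (rule bounded_linear_imp_has_derivative) simp
  show d: "dif ((*v) A) x = (*v) A" using frechet_derivative_at[OF D] by simp
  show "((*v) A) differentiable (at x)" using D by (rule differentiableI)
  show "jacobian ((*v) A) x = det A" by (simp add: jacobian_def d)
qed

text \<open>The linear map attains the lower bounds for both dilatations at once: its outer and
  inner dilatations are the n-th powers of the largest stretches of the transition map and of its
  inverse. The exponent n cancels against the n in the normalizing factor.\<close>

theorem teichmueller_marked_eq:
  fixes p q :: "'n::finite marked_torus"
  assumes p: "p \<in> marked_tori" and q: "q \<in> marked_tori"
  shows "teichmueller_marked p q = max (1/4 * ln (rayleigh (gram p) (gram q))) (1/4 * ln (rayleigh (gram q) (gram p)))"
proof -
  let ?n = "CARD('n)" and ?T = "transition p q" and ?T' = "transition q p"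
  let ?s = "sqrt (rayleigh (gram p) (gram q))" and ?s' = "sqrt (rayleigh (gram q) (gram p))"
  have r: "0 < rayleigh (gram p) (gram q)" "0 < rayleigh (gram q) (gram p)"
    using rayleigh_pos posdef_gram p q by blast+
  then have s: "0 < ?s" "0 < ?s'" by simp_all
  have stretch: "max_stretch ((*v) (transition p q)) \<le> sqrt (rayleigh (gram p) (gram q))"
    "1 / sqrt (rayleigh (gram q) (gram p)) \<le> min_stretch ((*v) (transition p q))"
    if p: "p \<in> marked_tori" and q: "q \<in> marked_tori" and s: "0 < sqrt (rayleigh (gram q) (gram p))" for p q :: "'n marked_torus"
  proof -
    show "max_stretch ((*v) (transition p q)) \<le> sqrt (rayleigh (gram p) (gram q))"
      by (rule max_stretch_le) (rule norm_transition_le[OF p q])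
    show "1 / sqrt (rayleigh (gram q) (gram p)) \<le> min_stretch ((*v) (transition p q))"
    proof (rule min_stretch_ge)
      fix v
      have "norm (transition q p *v (transition p q *v v)) \<le> sqrt (rayleigh (gram q) (gram p)) * norm (transition p q *v v)"
        by (rule norm_transition_le[OF q p])
      then have "norm v \<le> sqrt (rayleigh (gram q) (gram p)) * norm (transition p q *v v)"
        by (simp add: matrix_vector_mul_assoc transition_inverse[OF p q])
      then show "1 / sqrt (rayleigh (gram q) (gram p)) * norm v \<le> norm (transition p q *v v)"
        using s by (simp add: divide_le_eq mult.commute)
    qed
  qed
  have lin_out: "max_stretch ((*v) (transition p q)) ^ ?n \<le> sqrt (rayleigh (gram p) (gram q)) ^ ?n"
    and lin_in: "1 \<le> sqrt (rayleigh (gram q) (gram p)) ^ ?n * min_stretch ((*v) (transition p q)) ^ ?n"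
    if "p \<in> marked_tori" "q \<in> marked_tori" for p q :: "'n marked_torus"
  proof -
    have s: "0 < sqrt (rayleigh (gram q) (gram p))"
      using that by (simp add: rayleigh_pos posdef_gram)
    show "max_stretch ((*v) (transition p q)) ^ ?n \<le> sqrt (rayleigh (gram p) (gram q)) ^ ?n"
      using stretch(1)[OF that s] by (intro power_mono max_stretch_nonneg) auto
    have "1 \<le> sqrt (rayleigh (gram q) (gram p)) * min_stretch ((*v) (transition p q))"
      using stretch(2)[OF that s] s by (simp add: divide_le_eq mult.commute)
    then show "1 \<le> sqrt (rayleigh (gram q) (gram p)) ^ ?n * min_stretch ((*v) (transition p q)) ^ ?n"
      unfolding power_mult_distrib[symmetric] by (rule one_le_power)
  qed
  have aqc: "analytically_qc ((*v) (transition p q))" if pq: "p \<in> marked_tori" "q \<in> marked_tori" for p q :: "'n marked_torus"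
    unfolding analytically_qc_def dif_matrix transition_det[OF pq]
  proof (intro conjI ACL_matrix AE_I2 dif_matrix exI)
    let ?K = "max (sqrt (rayleigh (gram p) (gram q)) ^ ?n) (sqrt (rayleigh (gram q) (gram p)) ^ ?n)"
    show "max_stretch ((*v) (transition p q)) ^ ?n \<le> ?K * 1" using lin_out[OF pq] by simp
    have "0 \<le> min_stretch ((*v) (transition p q)) ^ ?n" by (intro zero_le_power min_stretch_bound(2)) simp
    then have "sqrt (rayleigh (gram q) (gram p)) ^ ?n * min_stretch ((*v) (transition p q)) ^ ?n \<le> ?K * min_stretch ((*v) (transition p q)) ^ ?n"
      by (intro mult_right_mono) auto
    then show "1 \<le> ?K * min_stretch ((*v) (transition p q)) ^ ?n" using lin_in[OF pq] by linarith
  qed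
  have inj: "inj ((*v) ?T)" by (rule inj_on_inverseI[of _ "(*v) ?T'"]) (simp add: matrix_vector_mul_assoc transition_inverse[OF p q])
  have TT': "?T *v (?T' *v v) = v" for v by (simp add: matrix_vector_mul_assoc transition_inverse[OF q p])
  have invT: "inv_into UNIV ((*v) ?T) = (*v) ?T'"
    by (rule ext, rule inv_into_f_eq[OF inj]) (simp_all add: TT')
  have "homeomorphism UNIV UNIV ((*v) ?T) ((*v) ?T')"
    by (rule homeomorphismI) (auto simp: TT' matrix_vector_mul_assoc transition_inverse[OF p q] transition_inverse[OF q p] intro!: continuous_intros)
  then have qcT: "quasiconformal ((*v) ?T)" unfolding quasiconformal_def invT using aqc[OF p q] aqc[OF q p] by blast
  note T = transition_map[OF p q]
  let ?S = "{max_dilatation F |F \<phi>. marked_homeo p q \<phi> \<and> is_lift (fst p) (fst q) F \<phi> \<and> quasiconformal F}"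
  have lower: "max (?s ^ ?n) (?s' ^ ?n) \<le> max_dilatation F"
    if F: "marked_homeo p q \<phi>" "is_lift (fst p) (fst q) F \<phi>" "quasiconformal F" for F \<phi>
  proof -
    note b = qc_lift_dilatation_bounds[OF p q F]
    obtain K where K: "AE x in lebesgue. max_stretch (dif F x) ^ ?n \<le> K * \<bar>jacobian F x\<bar> \<and>
        \<bar>jacobian F x\<bar> \<le> K * min_stretch (dif F x) ^ ?n" using F(3) by (auto simp: quasiconformal_def analytically_qc_def)
    have K1: "AE x in lebesgue. max_stretch (dif F x) ^ ?n \<le> K * \<bar>jacobian F x\<bar>" using K by eventually_elim simp
    have K2: "AE x in lebesgue. \<bar>jacobian F x\<bar> \<le> K * min_stretch (dif F x) ^ ?n" using K by eventually_elim simp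
    have "?s ^ ?n \<le> outer_dilatation F" unfolding outer_dilatation_def by (rule cInf_greatest) (use K1 b(1) in auto)
    moreover have "?s' ^ ?n \<le> inner_dilatation F" unfolding inner_dilatation_def by (rule cInf_greatest) (use K2 b(2) in auto)
    ultimately show ?thesis unfolding max_dilatation_def by linarith
  qed
  note bT = qc_lift_dilatation_bounds[OF p q T(2,1) qcT]
  have "outer_dilatation ((*v) ?T) \<le> ?s ^ ?n" unfolding outer_dilatation_def
  proof (rule cInf_lower)
    show "?s ^ ?n \<in> {K. AE x in lebesgue. max_stretch (dif ((*v) ?T) x) ^ ?n \<le> K * \<bar>jacobian ((*v) ?T) x\<bar>}"
      unfolding dif_matrix transition_det[OF p q] using lin_out[OF p q] by simp
    show "bdd_below {K. AE x in lebesgue. max_stretch (dif ((*v) ?T) x) ^ ?n \<le> K * \<bar>jacobian ((*v) ?T) x\<bar>}"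
      by (rule bdd_belowI) (use bT(1) in blast)
  qed
  moreover have "inner_dilatation ((*v) ?T) \<le> ?s' ^ ?n" unfolding inner_dilatation_def
  proof (rule cInf_lower)
    show "?s' ^ ?n \<in> {K. AE x in lebesgue. \<bar>jacobian ((*v) ?T) x\<bar> \<le> K * min_stretch (dif ((*v) ?T) x) ^ ?n}"
      unfolding dif_matrix transition_det[OF p q] using lin_in[OF p q] by simp
    show "bdd_below {K. AE x in lebesgue. \<bar>jacobian ((*v) ?T) x\<bar> \<le> K * min_stretch (dif ((*v) ?T) x) ^ ?n}"
      by (rule bdd_belowI) (use bT(2) in blast)
  qed
  ultimately have "max_dilatation ((*v) ?T) = max (?s ^ ?n) (?s' ^ ?n)"
    using lower[OF T(2,1) qcT] by (auto simp: max_dilatation_def)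
  then have "max (?s ^ ?n) (?s' ^ ?n) \<in> ?S" using T qcT by force
  then have Inf: "Inf ?S = max (?s ^ ?n) (?s' ^ ?n)" using lower by (intro cInf_eq_minimum) auto
  have "ln (max (?s ^ ?n) (?s' ^ ?n)) = max (ln (?s ^ ?n)) (ln (?s' ^ ?n))"
    using s by (auto simp: max_def)
  also have "\<dots> = max (real ?n * (ln (rayleigh (gram p) (gram q)) / 2)) (real ?n * (ln (rayleigh (gram q) (gram p)) / 2))"
    using s r by (simp add: ln_realpow ln_sqrt)
  also have "\<dots> = real ?n * (2 * max (1/4 * ln (rayleigh (gram p) (gram q))) (1/4 * ln (rayleigh (gram q) (gram p))))"
    by (auto simp: max_def)
  finally show ?thesis unfolding teichmueller_marked_def Inf by simp
qed

theorem teichmueller_eq: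
  assumes C: "C \<in> teich" and D: "D \<in> teich"
  shows "teichmueller C D = max (thurston C D) (thurston D C)"
  unfolding teichmueller_def thurston_eq[OF C D] thurston_eq[OF D C]
  using C D by (rule on_classes_teich[where f = "\<lambda>X Y. max (1/4 * ln (rayleigh X Y)) (1/4 * ln (rayleigh Y X))"]) (rule teichmueller_marked_eq)

section \<open>Finsler and Riemannian metrics on the symmetric space\<close>

text \<open>A convergent sequence together with its limit is compact, so \<open>f\<close> is
  uniformly continuous on its product with \<open>K\<close>, and uniformly close functions have
  close suprema.\<close>

lemma continuous_on_SUP_compact:
  fixes f :: "'a::euclidean_space \<Rightarrow> 'b::metric_space \<Rightarrow> real"
  assumes K: "compact K" "K \<noteq> {}" and f: "continuous_on (Z \<times> K) (\<lambda>(z, u). f z u)"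
  shows "continuous_on Z (\<lambda>z. SUP u\<in>K. f z u)"
  unfolding continuous_on_sequentially
proof (intro ballI allI impI)
  fix x and s :: "nat \<Rightarrow> 'a" assume x: "x \<in> Z" and s: "(\<forall>n. s n \<in> Z) \<and> s \<longlonglongrightarrow> x"
  let ?C = "insert x (range s)"
  have "compact ?C" using s by (intro compact_sequence_with_limit) blast
  then have "compact (?C \<times> K)" using K(1) by (rule compact_Times)
  moreover have cf: "continuous_on (?C \<times> K) (\<lambda>(z, u). f z u)" by (rule continuous_on_subset[OF f]) (use x s in auto)
  ultimately have uc: "uniformly_continuous_on (?C \<times> K) (\<lambda>(z, u). f z u)" by (intro compact_uniformly_continuous)
  have bdd: "bdd_above (f z ` K)" if "z \<in> ?C" for z
  proof -
    have "continuous_on K (\<lambda>u. f z u)"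
    proof -
      have p: "continuous_on K (\<lambda>u. (z, u))" by (intro continuous_intros)
      have "(\<lambda>u. (z, u)) ` K \<subseteq> ?C \<times> K" using that by blast
      from continuous_on_compose2[OF cf p this] show ?thesis by simp
    qed
    then show ?thesis using K(1) by (intro bounded_imp_bdd_above compact_imp_bounded compact_continuous_image)
  qed
  show "((\<lambda>z. SUP u\<in>K. f z u) \<circ> s) \<longlonglongrightarrow> (SUP u\<in>K. f x u)"
  proof (rule LIMSEQ_I)
    fix e :: real assume "e > 0"
    then obtain d where d: "d > 0" "\<And>p p'. p \<in> ?C \<times> K \<Longrightarrow> p' \<in> ?C \<times> K \<Longrightarrow> dist p' p < d \<Longrightarrow>
        dist ((\<lambda>(z, u). f z u) p') ((\<lambda>(z, u). f z u) p) < e / 2"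
      using uc unfolding uniformly_continuous_on_def by (metis half_gt_zero)
    obtain n0 where n0: "\<And>n. n \<ge> n0 \<Longrightarrow> dist (s n) x < d" using s d(1) by (metis lim_sequentially)
    have "norm ((SUP u\<in>K. f (s n) u) - (SUP u\<in>K. f x u)) < e" if n: "n \<ge> n0" for n
    proof -
      have close: "\<bar>f (s n) u - f x u\<bar> < e / 2" if u: "u \<in> K" for u
        using d(2)[of "(x, u)" "(s n, u)"] n0[OF n] u by (simp add: dist_Pair_Pair dist_real_def)
      have "(SUP u\<in>K. f (s n) u) \<le> (SUP u\<in>K. f x u) + e / 2"
      proof (rule cSUP_least[OF K(2)])
        fix u assume u: "u \<in> K"
        have "f x u \<le> (SUP u\<in>K. f x u)" by (rule cSUP_upper[OF u bdd]) simp
        then show "f (s n) u \<le> (SUP u\<in>K. f x u) + e / 2" using close[OF u] by linarith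
      qed
      moreover have "(SUP u\<in>K. f x u) \<le> (SUP u\<in>K. f (s n) u) + e / 2"
      proof (rule cSUP_least[OF K(2)])
        fix u assume u: "u \<in> K"
        have "f (s n) u \<le> (SUP u\<in>K. f (s n) u)" by (rule cSUP_upper[OF u bdd]) simp
        then show "f x u \<le> (SUP u\<in>K. f (s n) u) + e / 2" using close[OF u] by linarith
      qed
      ultimately show ?thesis using \<open>e > 0\<close> unfolding real_norm_def by linarith
    qed
    then show "\<exists>n0. \<forall>n\<ge>n0. norm (((\<lambda>z. SUP u\<in>K. f z u) \<circ> s) n - (SUP u\<in>K. f x u)) < e" by auto
  qed
qed

text \<open>Pairing with the rank-one matrix u u^T exhibits the form as linear in \<open>A\<close>;
  continuity in \<open>A\<close> and \<open>u\<close>, and derivatives along matrix paths, follow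
  from this.\<close>

lemma quadratic_form_as_inner:
  fixes A :: "real^'n^'n"
  shows "u \<bullet> (A *v u) = A \<bullet> (\<chi> i j. u $ i * u $ j)"
  by (simp add: inner_vec_def matrix_vector_mult_def sum_distrib_left mult_ac)

lemma continuous_on_quadratic_form:
  fixes A :: "'a::topological_space \<Rightarrow> real^'n^'n"
  assumes "continuous_on S A" "continuous_on S u"
  shows "continuous_on S (\<lambda>z. u z \<bullet> (A z *v u z))"
  unfolding quadratic_form_as_inner using assms by (intro continuous_intros)

lemma continuous_on_rayleigh:
  "continuous_on {(X :: real^'n^'n, A). posdef X} (\<lambda>(X, A). rayleigh X A)"
proof -
  let ?Z = "{(X, A). posdef X} :: ((real^'n^'n) \<times> (real^'n^'n)) set"
  have fst: "continuous_on (?Z \<times> sphere 0 1) (\<lambda>p. snd p \<bullet> (fst (fst p) *v snd p))"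
    and snd: "continuous_on (?Z \<times> sphere 0 1) (\<lambda>p. snd p \<bullet> (snd (fst p) *v snd p))"
    by (intro continuous_on_quadratic_form continuous_intros)+
  have nz: "\<forall>p \<in> ?Z \<times> sphere 0 1. snd p \<bullet> (fst (fst p) *v snd p) \<noteq> 0"
  proof clarsimp
    fix X :: "real^'n^'n" and u assume "posdef X" "norm u = 1" "u \<bullet> (X *v u) = 0"
    then show False using posdef_pos[of X u] by force
  qed
  have "continuous_on ?Z (\<lambda>z. SUP u\<in>sphere 0 1. (\<lambda>z u. (u \<bullet> (snd z *v u)) / (u \<bullet> (fst z *v u))) z u)"
    by (rule continuous_on_SUP_compact[OF compact_sphere sphere_0_1_nonempty])
      (use continuous_on_divide[OF snd fst nz] in \<open>simp add: case_prod_unfold\<close>)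
  then show ?thesis by (simp add: rayleigh_def case_prod_unfold)
qed

lemma rayleigh_attained:
  fixes X A :: "real^'n^'n"
  assumes X: "posdef X"
  obtains u where "u \<noteq> 0" "u \<bullet> (A *v u) = rayleigh X A * (u \<bullet> (X *v u))"
proof -
  let ?f = "\<lambda>u. (u \<bullet> (A *v u)) / (u \<bullet> (X *v u))"
  have nz: "u \<bullet> (X *v u) > 0" if "u \<in> sphere 0 1" for u
    using posdef_pos[OF X, of u] that by fastforce
  have "continuous_on (sphere 0 1) ?f" using nz by (intro continuous_intros) force
  from continuous_attains_sup[OF compact_sphere sphere_0_1_nonempty this]
  obtain u where u: "u \<in> sphere 0 1" "\<forall>v\<in>sphere 0 1. ?f v \<le> ?f u" by (elim bexE)
  have "rayleigh X A = ?f u" unfolding rayleigh_def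
    by (rule cSup_eq_maximum) (use u in auto)
  then have "u \<bullet> (A *v u) = rayleigh X A * (u \<bullet> (X *v u))" using nz[OF u(1)] by (simp add: field_simps)
  moreover have "u \<noteq> 0" using u(1) by auto
  ultimately show ?thesis using that by blast
qed

section \<open>Distances and eigenvalues on maximal flats\<close>

lemma transpose_diag_conj: "transpose (g ** diagm c) = diagm c ** transpose g"
  by (simp add: matrix_transpose_mul)

text \<open>The square roots of the entries of \<open>c\<close> are absorbed into \<open>g\<close>,
  which reduces the claim to \<open>rayleigh_diagm\<close>.\<close>

lemma rayleigh_flat:
  fixes g :: "real^'n^'n"
  assumes g: "invertible g" and c: "\<And>i. 0 < c $ i"
  shows "rayleigh (g ** diagm c ** transpose g) (g ** diagm (\<chi> i. c $ i * m i) ** transpose g) = Max (range m)"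
proof -
  let ?r = "\<chi> i. sqrt (c $ i)"
  let ?h = "g ** diagm ?r"
  have "invertible (diagm ?r)" using c by (intro posdef_invertible) (simp add: posdef_diagm)
  then have h: "invertible ?h" using g by (rule invertible_mult[rotated])
  have "?h ** transpose ?h = g ** (diagm ?r ** diagm ?r) ** transpose g"
    by (simp only: transpose_diag_conj matrix_mul_assoc)
  then have 1: "?h ** transpose ?h = g ** diagm c ** transpose g" using c by (simp add: diagm_mult less_imp_le)
  have "?h ** diagm (\<chi> i. m i) ** transpose ?h = g ** (diagm ?r ** diagm (\<chi> i. m i) ** diagm ?r) ** transpose g"
    by (simp only: transpose_diag_conj matrix_mul_assoc)
  also have "diagm ?r ** diagm (\<chi> i. m i) ** diagm ?r = diagm (\<chi> i. c $ i * m i)"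
    using c by (simp add: diagm_mult less_imp_le mult_ac)
  finally show ?thesis using rayleigh_diagm[OF h, of "\<chi> i. m i"] unfolding 1 by simp
qed

text \<open>Exponential coordinates on the flat through g g^T; here distances become maxima of
  coordinate differences, and det = 1 becomes a vanishing coordinate sum when det g = 1 or
  -1.\<close>

definition flat_point :: "real^'n^'n \<Rightarrow> ('n \<Rightarrow> real) \<Rightarrow> real^'n^'n" where
  "flat_point g l = g ** diagm (\<chi> i. exp (l i)) ** transpose g"

lemma posdef_flat_point: "invertible g \<Longrightarrow> posdef (flat_point g l)"
  unfolding flat_point_def by (intro posdef_congruence) (simp_all add: posdef_diagm)

lemma det_flat_point: "det (flat_point g l) = (det g)\<^sup>2 * exp (\<Sum>i\<in>UNIV. l i)"
  by (simp add: flat_point_def det_mul det_diagm exp_sum power2_eq_square)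

lemma ln_rayleigh_flat_point:
  fixes g :: "real^'n^'n"
  assumes "invertible g"
  shows "ln (rayleigh (flat_point g l) (flat_point g m)) = Max (range (\<lambda>i. m i - l i))"
proof -
  let ?x = "\<lambda>i. exp (m i - l i)"
  have "(\<chi> i. (\<chi> i. exp (l i)) $ i * ?x i) = (\<chi> i. exp (m i))" by (simp add: vec_eq_iff flip: exp_add)
  then have "rayleigh (flat_point g l) (flat_point g m) = Max (range ?x)"
    using rayleigh_flat[OF assms, of "\<chi> i. exp (l i)" ?x] by (simp add: flat_point_def)
  also have "\<dots> = exp (Max (range (\<lambda>i. m i - l i)))"
  proof (rule Max_eqI)
    have "Max (range (\<lambda>i. m i - l i)) \<in> range (\<lambda>i. m i - l i)" by (intro Max_in) auto
    then obtain i where "Max (range (\<lambda>i. m i - l i)) = m i - l i" by blast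
    then show "exp (Max (range (\<lambda>i. m i - l i))) \<in> range ?x" by simp
    fix y assume "y \<in> range ?x"
    then show "y \<le> exp (Max (range (\<lambda>i. m i - l i)))" by auto
  qed simp
  finally show ?thesis by simp
qed

text \<open>Any two points lie in a common maximal flat, by simultaneous diagonalization; the
  coordinates of the second point are the logarithms of its relative eigenvalues.\<close>

lemma spd_pairE:
  fixes X Y :: "real^'n^'n"
  assumes X: "X \<in> spd_space" and Y: "Y \<in> spd_space"
  obtains g l where "invertible g" "X = flat_point g (\<lambda>_. 0)" "Y = flat_point g l" "(\<Sum>i\<in>UNIV. l i) = 0" "(det g)\<^sup>2 = 1"
proof -
  have pd: "posdef X" and sym: "transpose Y = Y" using X Y by (simp_all add: spd_space_iff posdef_def)
  obtain g :: "real^'n^'n" and d where gd: "invertible g" "X = g ** transpose g" "Y = g ** diagm d ** transpose g"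
    by (rule simultaneous_diagonalization[OF pd sym])
  have d: "0 < d $ i" for i using congruence_diagm_posdef[OF gd(1), of d i] Y by (simp add: gd(3) spd_space_iff)
  have dg: "(det g)\<^sup>2 = 1" using X by (simp add: gd(2) spd_space_iff det_mul power2_eq_square)
  have Yf: "Y = flat_point g (\<lambda>i. ln (d $ i))" using d by (simp add: flat_point_def gd(3))
  have "X = flat_point g (\<lambda>_. 0)" by (simp add: flat_point_def gd(2) diagm_one)
  moreover have "(\<Sum>i\<in>UNIV. ln (d $ i)) = 0"
    using Y dg det_flat_point[of g "\<lambda>i. ln (d $ i)"] by (simp add: Yf spd_space_iff)
  ultimately show ?thesis using that[OF gd(1) _ Yf] dg by blast
qed

lemma flat_point_spd: "(det g)\<^sup>2 = 1 \<Longrightarrow> (\<Sum>i\<in>UNIV. l i) = 0 \<Longrightarrow> flat_point g l \<in> spd_space"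
  by (auto simp: spd_space_iff det_flat_point invertible_det_nz intro!: posdef_flat_point)

definition rayleigh_dist :: "real^'n^'n \<Rightarrow> real^'n^'n \<Rightarrow> real" where
  "rayleigh_dist X Y = 1/4 * ln (rayleigh X Y)"

text \<open>A family with sum zero and no positive member vanishes. This makes the one-sided maximum
  definite, both for distances and for tangent norms.\<close>

lemma sum_zero_Max_nonneg:
  fixes l :: "'n::finite \<Rightarrow> real"
  assumes "(\<Sum>i\<in>UNIV. l i) = 0"
  shows "0 \<le> Max (range l)" "Max (range l) = 0 \<longleftrightarrow> (\<forall>i. l i = 0)"
proof -
  have all: "\<forall>i. l i = 0" if "Max (range l) \<le> 0"
  proof -
    have "l i \<le> 0" for i using Max_ge[of "range l" "l i"] that by simp
    then show ?thesis using assms sum_nonneg_eq_0_iff[of UNIV "\<lambda>i. - l i"] by (simp add: sum_negf)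
  qed
  have zero: "Max (range l) = 0" if "\<forall>i. l i = 0"
  proof -
    have "range l = {0}" using that by auto
    then show ?thesis by simp
  qed
  have "\<forall>i. l i = 0" if "Max (range l) = 0" using that by (intro all) linarith
  then show "Max (range l) = 0 \<longleftrightarrow> (\<forall>i. l i = 0)" using zero by blast
  show "0 \<le> Max (range l)"
  proof (rule ccontr)
    assume neg: "\<not> 0 \<le> Max (range l)"
    then have "Max (range l) = 0" by (intro zero all) linarith
    then show False using neg by linarith
  qed
qed

lemma asymmetric_metric_rayleigh_dist:
  assumes n: "3 \<le> CARD('n::finite)"
  shows "asymmetric_metric (spd_space :: (real^'n^'n) set) rayleigh_dist"
  unfolding asymmetric_metric_def
proof (intro conjI ballI)
  fix X Y :: "real^'n^'n" assume XY: "X \<in> spd_space" "Y \<in> spd_space"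
  then obtain g l where gl: "invertible g" "X = flat_point g (\<lambda>_. 0)" "Y = flat_point g l" "(\<Sum>i\<in>UNIV. l i) = 0" by (rule spd_pairE)
  have d: "rayleigh_dist X Y = 1/4 * Max (range l)"
    unfolding rayleigh_dist_def gl(2,3) ln_rayleigh_flat_point[OF gl(1)] by simp
  show "0 \<le> rayleigh_dist X Y" using sum_zero_Max_nonneg(1)[OF gl(4)] by (simp add: d)
  have "X = Y" if "\<forall>i. l i = 0"
  proof -
    have "l = (\<lambda>_. 0)" using that by auto
    then show ?thesis using gl by simp
  qed
  moreover have "rayleigh X X = 1"
    using XY(1) rayleigh_attained[of X X] by (metis posdef_pos mult_cancel_right2 less_irrefl spd_space_iff)
  ultimately show "rayleigh_dist X Y = 0 \<longleftrightarrow> X = Y"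
    using sum_zero_Max_nonneg(2)[OF gl(4)] d by (auto simp: rayleigh_dist_def)
next
  fix X Y Z :: "real^'n^'n" assume "X \<in> spd_space" "Y \<in> spd_space" "Z \<in> spd_space"
  then have pd: "posdef X" "posdef Y" "posdef Z" by (auto simp: spd_space_iff)
  have pos: "0 < rayleigh X Y" "0 < rayleigh Y Z" "0 < rayleigh X Z" using pd by (auto intro: rayleigh_pos)
  have "rayleigh X Z \<le> rayleigh Y Z * rayleigh X Y"
  proof (rule rayleigh_le[OF pd(1)])
    fix u
    have "u \<bullet> (Z *v u) \<le> rayleigh Y Z * (u \<bullet> (Y *v u))" by (rule rayleigh_bound[OF pd(2)])
    also have "\<dots> \<le> rayleigh Y Z * (rayleigh X Y * (u \<bullet> (X *v u)))"
      using pos by (intro mult_left_mono rayleigh_bound[OF pd(1)]) auto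
    finally show "u \<bullet> (Z *v u) \<le> rayleigh Y Z * rayleigh X Y * (u \<bullet> (X *v u))" by (simp add: mult.assoc)
  qed
  then have "ln (rayleigh X Z) \<le> ln (rayleigh Y Z * rayleigh X Y)" using pos by simp
  then show "rayleigh_dist X Z \<le> rayleigh_dist X Y + rayleigh_dist Y Z"
    using pos by (simp add: rayleigh_dist_def ln_mult_pos)
next
  obtain S :: "'n set" where "card S = 3" using n obtain_subset_with_card_n by metis
  then obtain i j k :: 'n where ijk: "i \<noteq> j" "j \<noteq> k" "i \<noteq> k" unfolding card_3_iff by blast
  \<comment> \<open>The simplest traceless exponents whose maximum differs from that of their
    negatives, 2 against 1; this takes three distinct indices.\<close>
  define l where "l x = (if x = i then 2 else if x = j then -1 else if x = k then -1 else 0 :: real)" for x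
  have "(\<Sum>x\<in>UNIV. l x) = (\<Sum>x\<in>{i, j, k}. l x)" by (rule sum.mono_neutral_right) (auto simp: l_def)
  also have "\<dots> = 0" using ijk by (simp add: l_def)
  finally have sum: "(\<Sum>x\<in>UNIV. l x) = 0" .
  let ?X = "flat_point (mat 1 :: real^'n^'n) (\<lambda>_. 0)" and ?Y = "flat_point (mat 1 :: real^'n^'n) l"
  have inv: "invertible (mat 1 :: real^'n^'n)" by (simp add: invertible_det_nz)
  have "Max (range l) = 2" by (rule Max_eqI) (auto simp: l_def image_iff)
  then have "rayleigh_dist ?X ?Y = 1/4 * 2" unfolding rayleigh_dist_def ln_rayleigh_flat_point[OF inv] by simp
  moreover have "Max (range (\<lambda>x. - l x)) = 1" by (rule Max_eqI) (use ijk in \<open>auto simp: l_def image_iff\<close>)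
  then have "rayleigh_dist ?Y ?X = 1/4 * 1" unfolding rayleigh_dist_def ln_rayleigh_flat_point[OF inv] by simp
  moreover have "?X \<in> spd_space" "?Y \<in> spd_space" using sum by (intro flat_point_spd; simp)+
  ultimately show "\<exists>X\<in>spd_space. \<exists>Y\<in>spd_space. rayleigh_dist X (Y :: real^'n^'n) \<noteq> rayleigh_dist Y X"
    by (intro bexI[of _ ?X] bexI[of _ ?Y]) auto
qed

text \<open>For Y = g g^T and X = g D g^T one has X Y^-1 = g D g^-1, whose eigenvalues are the
  entries exp (l i) of D.\<close>

lemma rayleigh_dist_eigenvalues:
  fixes X Y :: "real^'n^'n"
  assumes X: "X \<in> spd_space" and Y: "Y \<in> spd_space"
  shows "rayleigh_dist Y X = 1/4 * Max {ln (cmod l) |l. complex_eigenvalue (X ** matrix_inv Y) l}"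
proof -
  obtain g l where gl: "invertible g" "Y = flat_point g (\<lambda>_. 0)" "X = flat_point g l" using Y X by (rule spd_pairE)
  have Yg: "Y = g ** transpose g" by (simp add: gl(2) flat_point_def diagm_one)
  have tI: "transpose g ** transpose (matrix_inv g) = mat 1"
    by (simp add: matrix_inv_left_right[OF gl(1)] flip: matrix_transpose_mul)
  have "Y ** (transpose (matrix_inv g) ** matrix_inv g) = g ** (transpose g ** transpose (matrix_inv g)) ** matrix_inv g"
    by (simp only: Yg matrix_mul_assoc)
  then have "matrix_inv Y = transpose (matrix_inv g) ** matrix_inv g"
    by (intro matrix_inv_unique) (simp add: tI matrix_inv_left_right[OF gl(1)])
  then have "X ** matrix_inv Y = g ** diagm (\<chi> i. exp (l i)) ** (transpose g ** transpose (matrix_inv g)) ** matrix_inv g"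
    by (simp only: gl(3) flat_point_def matrix_mul_assoc)
  then have XY: "X ** matrix_inv Y = g ** diagm (\<chi> i. exp (l i)) ** matrix_inv g" by (simp add: tI)
  have "{ln (cmod z) |z. complex_eigenvalue (X ** matrix_inv Y) z} = range l"
    unfolding XY complex_eigenvalue_diagm[OF gl(1)] by (auto simp: image_iff) (metis abs_exp_cancel ln_exp norm_of_real)+
  moreover have "ln (rayleigh Y X) = Max (range l)"
    using ln_rayleigh_flat_point[OF gl(1), of "\<lambda>_. 0" l] unfolding gl(2,3)[symmetric] by simp
  ultimately show ?thesis unfolding rayleigh_dist_def by simp
qed

definition rayleigh_finsler :: "real^'n^'n \<Rightarrow> real^'n^'n \<Rightarrow> real" where
  "rayleigh_finsler X A = 1/4 * rayleigh X A"

text \<open>Expresses tangency to the hypersurface det = 1 in the diagonalizing frame, as a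
  vanishing sum of the entries.\<close>

lemma trace_flat:
  fixes g :: "real^'n^'n"
  assumes g: "invertible g"
  shows "trace (matrix_inv (g ** transpose g) ** (g ** diagm d ** transpose g)) = (\<Sum>i\<in>UNIV. d $ i)"
proof -
  have tI: "transpose g ** transpose (matrix_inv g) = mat 1"
    by (simp add: matrix_inv_left_right[OF g] flip: matrix_transpose_mul)
  have "(g ** transpose g) ** (transpose (matrix_inv g) ** matrix_inv g) = g ** (transpose g ** transpose (matrix_inv g)) ** matrix_inv g"
    by (simp only: matrix_mul_assoc)
  then have inv: "matrix_inv (g ** transpose g) = transpose (matrix_inv g) ** matrix_inv g"
    by (intro matrix_inv_unique) (simp add: tI matrix_inv_left_right[OF g])
  have "matrix_inv (g ** transpose g) ** (g ** diagm d ** transpose g)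
      = transpose (matrix_inv g) ** ((matrix_inv g ** g) ** diagm d ** transpose g)"
    unfolding inv by (simp only: matrix_mul_assoc)
  also have "trace \<dots> = trace (diagm d ** transpose g ** transpose (matrix_inv g))"
    by (subst trace_mul_sym) (simp add: matrix_inv_left_right[OF g] matrix_mul_assoc)
  also have "diagm d ** transpose g ** transpose (matrix_inv g) = diagm d"
    by (simp add: tI flip: matrix_mul_assoc)
  finally show ?thesis by (simp add: trace_diagm)
qed

lemma rayleigh_scale_le:
  fixes X A :: "real^'n^'n"
  assumes X: "posdef X" and c: "0 \<le> c"
  shows "rayleigh X (c *\<^sub>R A) \<le> c * rayleigh X A"
proof (rule rayleigh_le[OF X])
  fix u
  have "u \<bullet> ((c *\<^sub>R A) *v u) = c * (u \<bullet> (A *v u))" by (simp add: scaleR_matrix_vector_assoc[symmetric])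
  also have "\<dots> \<le> c * (rayleigh X A * (u \<bullet> (X *v u)))" using c by (intro mult_left_mono rayleigh_bound[OF X])
  finally show "u \<bullet> ((c *\<^sub>R A) *v u) \<le> c * rayleigh X A * (u \<bullet> (X *v u))" by (simp add: mult.assoc)
qed

lemma rayleigh_scale:
  fixes X A :: "real^'n^'n"
  assumes X: "posdef X" and c: "0 \<le> c"
  shows "rayleigh X (c *\<^sub>R A) = c * rayleigh X A"
proof (cases "c = 0")
  case True
  obtain u :: "real^'n" where u: "u \<noteq> 0" using rayleigh_attained[OF X] by metis
  have "rayleigh X 0 = 0" by (rule rayleigh_eqI[OF X _ u]) simp_all
  then show ?thesis using True by simp
next
  case False
  then have "rayleigh X ((1 / c) *\<^sub>R (c *\<^sub>R A)) \<le> (1 / c) * rayleigh X (c *\<^sub>R A)"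
    using c by (intro rayleigh_scale_le[OF X]) simp
  then have "c * rayleigh X A \<le> rayleigh X (c *\<^sub>R A)" using False c by (simp add: field_simps)
  then show ?thesis using rayleigh_scale_le[OF X c, of A] by linarith
qed

text \<open>In a frame diagonalizing \<open>X\<close> and \<open>A\<close> together, the norm is a
  quarter of the largest entry; the entries sum to zero by tangency, which yields definiteness.
  Subadditivity is that of a supremum.\<close>

lemma rayleigh_finsler_metric: "finsler_metric (spd_space :: (real^'n^'n) set) spd_tangent rayleigh_finsler"
  unfolding finsler_metric_def
proof (intro conjI ballI allI impI)
  have "continuous_on {(X :: real^'n^'n, A). posdef X} (\<lambda>p. 1/4 * (\<lambda>(X, A). rayleigh X A) p)"
    by (intro continuous_intros continuous_on_rayleigh)
  then show "continuous_on (Sigma spd_space spd_tangent) (\<lambda>(X :: real^'n^'n, A). rayleigh_finsler X A)"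
    unfolding rayleigh_finsler_def case_prod_unfold by (rule continuous_on_subset) (auto simp: spd_space_iff)
next
  fix X A :: "real^'n^'n" assume X: "X \<in> spd_space" and A: "A \<in> spd_tangent X"
  have pd: "posdef X" and tA: "transpose A = A" using X A by (auto simp: spd_space_iff spd_tangent_def)
  obtain g :: "real^'n^'n" and d where gd: "invertible g" "X = g ** transpose g" "A = g ** diagm d ** transpose g"
    by (rule simultaneous_diagonalization[OF pd tA])
  have sum: "(\<Sum>i\<in>UNIV. d $ i) = 0" using A trace_flat[OF gd(1), of d] by (simp add: spd_tangent_def gd)
  have F: "rayleigh_finsler X A = 1/4 * Max (range (($) d))"
    unfolding rayleigh_finsler_def gd rayleigh_diagm[OF gd(1)] ..
  show "0 \<le> rayleigh_finsler X A" using sum_zero_Max_nonneg(1)[OF sum] by (simp add: F)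
  have "A = 0" if "\<forall>i. d $ i = 0"
  proof -
    have "diagm d = 0" using that by (simp add: diagm_def vec_eq_iff)
    then show ?thesis by (simp add: gd)
  qed
  moreover have "rayleigh_finsler X 0 = 0" using rayleigh_scale[OF pd, of 0 0] by (simp add: rayleigh_finsler_def)
  ultimately show "rayleigh_finsler X A = 0 \<longleftrightarrow> A = 0" using sum_zero_Max_nonneg(2)[OF sum] F by auto
next
  fix X A B :: "real^'n^'n" assume "X \<in> spd_space" "A \<in> spd_tangent X" "B \<in> spd_tangent X"
  then have pd: "posdef X" by (simp add: spd_space_iff)
  have "rayleigh X (A + B) \<le> rayleigh X A + rayleigh X B"
  proof (rule rayleigh_le[OF pd])
    fix u
    show "u \<bullet> ((A + B) *v u) \<le> (rayleigh X A + rayleigh X B) * (u \<bullet> (X *v u))"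
      using rayleigh_bound[OF pd, of u A] rayleigh_bound[OF pd, of u B]
      by (simp add: matrix_vector_mult_add_rdistrib inner_add_right distrib_right)
  qed
  then show "rayleigh_finsler X (A + B) \<le> rayleigh_finsler X A + rayleigh_finsler X B" by (simp add: rayleigh_finsler_def)
next
  fix X A :: "real^'n^'n" and c :: real assume "X \<in> spd_space" "A \<in> spd_tangent X" "0 \<le> c"
  then show "rayleigh_finsler X (c *\<^sub>R A) = c * rayleigh_finsler X A"
    by (simp add: rayleigh_finsler_def rayleigh_scale spd_space_iff)
qed

text \<open>Finitely many half-spaces inside a hyperplane. Boundedness from below comes from the sum
  condition: each entry is minus the sum of the others.\<close>

lemma polytope_trace_free_box: "polytope {d :: real^'n. (\<Sum>i\<in>UNIV. d $ i) = 0 \<and> (\<forall>i. d $ i \<le> c)}"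
proof -
  let ?P = "{d :: real^'n. (\<Sum>i\<in>UNIV. d $ i) = 0 \<and> (\<forall>i. d $ i \<le> c)}"
  have eq: "?P = {d. (\<chi> i. 1) \<bullet> d = 0} \<inter> \<Inter> (range (\<lambda>i. {d. axis i 1 \<bullet> d \<le> c}))"
    by (auto simp: inner_vec_def axis_def if_distrib[of "\<lambda>x. x * _"] sum.delta cong: if_cong)
  have "polyhedron ?P" unfolding eq
    by (intro polyhedron_Int polyhedron_hyperplane polyhedron_Inter) (auto simp: polyhedron_halfspace_le)
  moreover have "bounded ?P"
  proof (rule bounded_subset[OF bounded_cbox])
    show "?P \<subseteq> cbox (- (real CARD('n) * \<bar>c\<bar>) *\<^sub>R (\<chi> i. 1)) (\<bar>c\<bar> *\<^sub>R (\<chi> i. 1))"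
    proof
      fix d :: "real^'n" assume d: "d \<in> ?P"
      have "- (real CARD('n) * \<bar>c\<bar>) \<le> d $ i" for i
      proof -
        have "d $ i = - (\<Sum>j\<in>UNIV - {i}. d $ j)" using d sum.remove[of UNIV i "($) d"] by simp
        moreover have "(\<Sum>j\<in>UNIV - {i}. d $ j) \<le> (\<Sum>j\<in>UNIV - {i}. \<bar>c\<bar>)"
          using d by (intro sum_mono) (auto intro: order_trans[OF _ abs_ge_self])
        moreover have "(\<Sum>j\<in>UNIV - {i}. \<bar>c\<bar>) \<le> (\<Sum>j\<in>(UNIV :: 'n set). \<bar>c\<bar>)" by (rule sum_mono2) auto
        ultimately show ?thesis by simp
      qed
      moreover have "d $ i \<le> \<bar>c\<bar>" for i using d by (auto intro: order_trans[OF _ abs_ge_self])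
      ultimately show "d \<in> cbox (- (real CARD('n) * \<bar>c\<bar>) *\<^sub>R (\<chi> i. 1)) (\<bar>c\<bar> *\<^sub>R (\<chi> i. 1))" by (simp add: mem_box_cart)
    qed
  qed
  ultimately show ?thesis by (simp add: polytope_eq_bounded_polyhedron)
qed

lemma bounded_linear_congruence_diagm:
  fixes g :: "real^'n^'m"
  shows "bounded_linear (\<lambda>d. g ** diagm d ** transpose g)"
proof -
  have "linear (\<lambda>d. g ** diagm d ** transpose g)"
    by (rule linearI)
      (simp_all add: vec_eq_iff matrix_matrix_mult_def transpose_def diagm_def if_distrib[of "\<lambda>x. _ * x"]
        sum.delta sum.delta' distrib_left distrib_right sum.distrib sum_distrib_left mult_ac cong: if_cong)
  then show ?thesis by (simp add: linear_conv_bounded_linear)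
qed

theorem polyhedral_rayleigh_finsler: "polyhedral_finsler_metric (rayleigh_finsler :: real^'n^'n \<Rightarrow> real^'n^'n \<Rightarrow> real)"
  unfolding polyhedral_finsler_metric_def
proof (intro conjI rayleigh_finsler_metric allI impI)
  fix g :: "real^'n^'n" assume "det g = 1"
  then have g: "invertible g" by (simp add: invertible_det_nz)
  let ?f = "\<lambda>d. g ** diagm d ** transpose g"
  \<comment> \<open>The bound 4 cancels the factor 1/4 of the norm, so the unit ball is a linear
    image of this set.\<close>
  let ?P = "{d :: real^'n. (\<Sum>i\<in>UNIV. d $ i) = 0 \<and> (\<forall>i. d $ i \<le> 4)}"
  have flat: "flat_tangent g = ?f ` {d. (\<Sum>i\<in>UNIV. d $ i) = 0}"
  proof
    show "flat_tangent g \<subseteq> ?f ` {d. (\<Sum>i\<in>UNIV. d $ i) = 0}"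
    proof
      fix A assume "A \<in> flat_tangent g"
      then obtain D where D: "A = g ** D ** transpose g" "\<forall>i j. i \<noteq> j \<longrightarrow> D $ i $ j = 0" "trace D = 0"
        by (auto simp: flat_tangent_def)
      have "D = diagm (\<chi> i. D $ i $ i)" using D(2) by (auto simp: diagm_def vec_eq_iff)
      then show "A \<in> ?f ` {d. (\<Sum>i\<in>UNIV. d $ i) = 0}"
        using D(1,3) by (intro image_eqI[of _ _ "\<chi> i. D $ i $ i"]) (auto simp: trace_def)
    qed
    show "?f ` {d. (\<Sum>i\<in>UNIV. d $ i) = 0} \<subseteq> flat_tangent g"
    proof clarify
      fix d :: "real^'n" assume "(\<Sum>i\<in>UNIV. d $ i) = 0"
      then show "?f d \<in> flat_tangent g" unfolding flat_tangent_def
        by (intro CollectI exI[of _ "diagm d"]) (auto simp: trace_diagm, simp add: diagm_def)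
    qed
  qed
  have "rayleigh_finsler (g ** transpose g) (?f d) \<le> 1 \<longleftrightarrow> (\<forall>i. d $ i \<le> 4)" for d
    unfolding rayleigh_finsler_def rayleigh_diagm[OF g] by (simp add: mult.commute)
  then have "{A \<in> flat_tangent g. rayleigh_finsler (g ** transpose g) A \<le> 1} = ?f ` ?P"
    unfolding flat by auto
  moreover have "linear ?f" using bounded_linear_congruence_diagm by (rule bounded_linear.linear)
  ultimately show "polytope {A \<in> flat_tangent g. rayleigh_finsler (g ** transpose g) A \<le> 1}"
    by (simp only: polytope_linear_image polytope_trace_free_box)
qed

lemma quadratic_form_path_derivative:
  fixes \<gamma> :: "real \<Rightarrow> real^'n^'n"
  assumes "(\<gamma> has_vector_derivative D) F"
  shows "((\<lambda>t. u \<bullet> (\<gamma> t *v u)) has_vector_derivative (u \<bullet> (D *v u))) F"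
  unfolding quadratic_form_as_inner using assms by (rule bounded_linear.has_vector_derivative[OF bounded_linear_inner_left])

text \<open>One vector u, chosen to attain the quotient of the two endpoints, is used along the
  whole path: the logarithmic derivative of its quadratic form never exceeds
  \<open>rayleigh (\<gamma> t) (D t)\<close>.\<close>

lemma rayleigh_finsler_path_length:
  fixes X Y :: "real^'n^'n"
  assumes \<gamma>: "\<gamma> C1_differentiable_on {0..1}" "\<gamma> ` {0..1} \<subseteq> spd_space" "\<gamma> 0 = X" "\<gamma> 1 = Y"
  shows "rayleigh_dist X Y \<le> integral {0..1} (\<lambda>t. rayleigh_finsler (\<gamma> t) (vector_derivative \<gamma> (at t)))"
proof -
  obtain D where D: "\<And>t. t \<in> {0..1} \<Longrightarrow> (\<gamma> has_vector_derivative D t) (at t)" "continuous_on {0..1} D"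
    using \<gamma>(1) unfolding C1_differentiable_on_def by blast
  have vd: "vector_derivative \<gamma> (at t) = D t" if "t \<in> {0..1}" for t using D(1)[OF that] by (rule vector_derivative_at)
  have pd: "posdef (\<gamma> t)" if "t \<in> {0..1}" for t using subsetD[OF \<gamma>(2), of "\<gamma> t"] that by (simp add: spd_space_iff)
  have pX: "posdef X" and pY: "posdef Y" using pd[of 0] pd[of 1] \<gamma>(3,4) by auto
  obtain u where u: "u \<noteq> 0" "u \<bullet> (Y *v u) = rayleigh X Y * (u \<bullet> (X *v u))" by (rule rayleigh_attained[OF pX])
  let ?q = "\<lambda>t. u \<bullet> (\<gamma> t *v u)"
  have q: "0 < ?q t" if "t \<in> {0..1}" for t using posdef_pos[OF pd[OF that] u(1)] .
  have "((\<lambda>t. ln (?q t)) has_vector_derivative (u \<bullet> (D t *v u)) / ?q t) (at t within {0..1})" if "t \<in> {0..1}" for t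
  proof -
    have "(?q has_real_derivative u \<bullet> (D t *v u)) (at t within {0..1})"
      using quadratic_form_path_derivative[OF D(1)[OF that]]
      by (auto simp: has_real_derivative_iff_has_vector_derivative intro: has_vector_derivative_at_within)
    from DERIV_ln_divide[OF q[OF that]] DERIV_chain2[OF _ this]
    have "((\<lambda>t. ln (?q t)) has_real_derivative (1 / ?q t) * (u \<bullet> (D t *v u))) (at t within {0..1})" by blast
    then show ?thesis by (simp add: has_real_derivative_iff_has_vector_derivative)
  qed
  then have "((\<lambda>t. (u \<bullet> (D t *v u)) / ?q t) has_integral (ln (?q 1) - ln (?q 0))) {0..1}"
    by (intro fundamental_theorem_of_calculus) auto
  then have int: "((\<lambda>t. 1/4 * ((u \<bullet> (D t *v u)) / ?q t)) has_integral 1/4 * (ln (?q 1) - ln (?q 0))) {0..1}"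
    by (rule has_integral_mult_right)
  have cont\<gamma>: "continuous_on {0..1} \<gamma>"
    using D(1) by (intro continuous_at_imp_continuous_on ballI) (blast intro: has_vector_derivative_continuous)
  have "continuous_on {0..1} (\<lambda>t. (\<lambda>(X, A). rayleigh X A) (\<gamma> t, D t))"
    by (rule continuous_on_compose2[OF continuous_on_rayleigh])
      (use pd in \<open>auto intro!: continuous_on_Pair cont\<gamma> D(2)\<close>)
  then have "continuous_on {0..1} (\<lambda>t. rayleigh_finsler (\<gamma> t) (D t))"
    unfolding rayleigh_finsler_def by (intro continuous_intros) simp
  then have "((\<lambda>t. rayleigh_finsler (\<gamma> t) (D t)) has_integral integral {0..1} (\<lambda>t. rayleigh_finsler (\<gamma> t) (D t))) {0..1}"
    by (intro integrable_integral integrable_continuous_real)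
  with int have "1/4 * (ln (?q 1) - ln (?q 0)) \<le> integral {0..1} (\<lambda>t. rayleigh_finsler (\<gamma> t) (D t))"
  proof (rule has_integral_le)
    fix t :: real assume t: "t \<in> {0..1}"
    have "(u \<bullet> (D t *v u)) / ?q t \<le> rayleigh (\<gamma> t) (D t)"
      using rayleigh_bound[OF pd[OF t], of u "D t"] q[OF t] by (simp add: divide_le_eq)
    then show "1/4 * ((u \<bullet> (D t *v u)) / ?q t) \<le> rayleigh_finsler (\<gamma> t) (D t)" by (simp add: rayleigh_finsler_def)
  qed
  also have "\<dots> = integral {0..1} (\<lambda>t. rayleigh_finsler (\<gamma> t) (vector_derivative \<gamma> (at t)))"
    by (rule integral_cong) (simp add: vd)
  also have "1/4 * (ln (?q 1) - ln (?q 0)) = rayleigh_dist X Y"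
    using u(2) posdef_pos[OF pX u(1)] rayleigh_pos[OF pX pY] by (simp add: \<gamma>(3,4) rayleigh_dist_def ln_mult_pos)
  finally show ?thesis .
qed

theorem path_dist_rayleigh_finsler:
  fixes X Y :: "real^'n^'n"
  assumes X: "X \<in> spd_space" and Y: "Y \<in> spd_space"
  shows "path_dist spd_space rayleigh_finsler X Y = rayleigh_dist X Y"
proof -
  obtain g l where gl: "invertible g" "X = flat_point g (\<lambda>_. 0)" "Y = flat_point g l" "(\<Sum>i\<in>UNIV. l i) = 0" "(det g)\<^sup>2 = 1"
    using X Y by (rule spd_pairE)
  define \<gamma> where "\<gamma> t = flat_point g (\<lambda>i. t * l i)" for t
  define D where "D t = g ** diagm (\<chi> i. exp (t * l i) * l i) ** transpose g" for t
  have "((\<lambda>t. \<chi> i. exp (t * l i)) has_vector_derivative (\<chi> i. exp (t * l i) * l i)) (at t)" for t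
  proof -
    have "((\<lambda>t. exp (t * l i)) has_vector_derivative exp (t * l i) * l i) (at t)" for i
      unfolding has_real_derivative_iff_has_vector_derivative[symmetric] by (auto intro!: derivative_eq_intros)
    then show ?thesis
      unfolding has_vector_derivative_def by (subst has_derivative_componentwise_within) (auto simp: Basis_vec_def inner_axis)
  qed
  then have D: "(\<gamma> has_vector_derivative D t) (at t)" for t
    unfolding \<gamma>_def[abs_def] D_def flat_point_def by (rule bounded_linear.has_vector_derivative[OF bounded_linear_congruence_diagm])
  have "continuous_on {0..1} (\<lambda>t. \<chi> i. exp (t * l i) * l i)" by (intro continuous_intros)
  then have "continuous_on {0..1} D" unfolding D_def[abs_def] by (rule bounded_linear.continuous_on[OF bounded_linear_congruence_diagm])
  then have C1: "\<gamma> C1_differentiable_on {0..1}" unfolding C1_differentiable_on_def using D by blast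
  have "(\<Sum>i\<in>UNIV. t * l i) = 0" for t using gl(4) by (simp flip: sum_distrib_left)
  then have img: "\<gamma> ` {0..1} \<subseteq> spd_space" unfolding \<gamma>_def using flat_point_spd[OF gl(5)] by blast
  have ends: "\<gamma> 0 = X" "\<gamma> 1 = Y" by (simp_all add: \<gamma>_def gl(2,3))
  have XY: "rayleigh_dist X Y = 1/4 * Max (range l)"
    using ln_rayleigh_flat_point[OF gl(1), of "\<lambda>_. 0" l] unfolding rayleigh_dist_def gl(2,3) by simp
  \<comment> \<open>The exponents move linearly, so the path has constant speed, and its length
    equals the lower bound.\<close>
  have "rayleigh_finsler (\<gamma> t) (vector_derivative \<gamma> (at t)) = rayleigh_dist X Y" for t
  proof -
    have "rayleigh (\<gamma> t) (D t) = Max (range l)"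
      using rayleigh_flat[OF gl(1), of "\<chi> i. exp (t * l i)" l] by (simp add: \<gamma>_def D_def flat_point_def)
    then show ?thesis by (simp add: rayleigh_finsler_def vector_derivative_at[OF D] XY)
  qed
  then have len: "integral {0..1} (\<lambda>t. rayleigh_finsler (\<gamma> t) (vector_derivative \<gamma> (at t))) = rayleigh_dist X Y" by simp
  show ?thesis unfolding path_dist_def
  proof (rule cInf_eq_minimum)
    show "rayleigh_dist X Y \<in> {integral {0..1} (\<lambda>t. rayleigh_finsler (\<gamma> t) (vector_derivative \<gamma> (at t))) |\<gamma>.
       \<gamma> C1_differentiable_on {0..1} \<and> \<gamma> ` {0..1} \<subseteq> spd_space \<and> \<gamma> 0 = X \<and> \<gamma> 1 = Y}"
      using C1 img ends len by (intro CollectI exI[of _ \<gamma>]) simp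
  qed (use rayleigh_finsler_path_length in blast)
qed

section \<open>The Weil-Petersson metric\<close>

lemma weil_petersson_eq:
  fixes X A B :: "real^'n^'n"
  shows "weil_petersson X A B = trace (matrix_inv X ** A ** matrix_inv X ** B) * sqrt (det X)"
proof -
  have "measure lborel (cbox 0 (1 :: real^'n)) = 1"
    by (simp add: content_cbox_if_cart interval_eq_empty_cart)
  then show ?thesis by (simp add: weil_petersson_def l2_pairing_def)
qed

text \<open>Under the action X^-1 A is conjugated by g^-T, which the trace does not see, and the
  volume density is unchanged because det g = 1.\<close>

theorem natural_riemannian_metric_weil_petersson:
  "natural_riemannian_metric (weil_petersson :: real^'n^'n \<Rightarrow> real^'n^'n \<Rightarrow> real^'n^'n \<Rightarrow> real)"
  unfolding natural_riemannian_metric_def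
proof (intro conjI ballI allI impI)
  fix A B :: "real^'n^'n"
  have "matrix_inv (mat 1 :: real^'n^'n) = mat 1" by (rule matrix_inv_unique) simp
  then show "weil_petersson (mat 1) A B = trace (A ** B)" by (simp add: weil_petersson_eq)
next
  fix g X A B :: "real^'n^'n" assume g: "det g = 1" and "X \<in> spd_space"
  then have inv: "invertible g" "invertible X" by (auto simp: invertible_det_nz spd_space_iff)
  let ?h = "transpose g" and ?hi = "transpose (matrix_inv g)" and ?gi = "matrix_inv g" and ?Xi = "matrix_inv X"
  have hh: "?h ** ?hi = mat 1" by (simp add: matrix_inv_left_right[OF inv(1)] flip: matrix_transpose_mul)
  have "(g ** X ** ?h) ** (?hi ** ?Xi ** ?gi) = g ** (X ** ((?h ** ?hi) ** ?Xi)) ** ?gi" by (simp only: matrix_mul_assoc)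
  then have "matrix_inv (g ** X ** ?h) = ?hi ** ?Xi ** ?gi"
    by (intro matrix_inv_unique) (simp add: hh matrix_inv_left_right inv)
  moreover have "?hi ** ?Xi ** ?gi ** (g ** A ** ?h) ** (?hi ** ?Xi ** ?gi) ** (g ** B ** ?h)
    = ?hi ** (?Xi ** ((?gi ** g) ** (A ** ((?h ** ?hi) ** (?Xi ** ((?gi ** g) ** B)))))) ** ?h"
    by (simp only: matrix_mul_assoc)
  moreover have "\<dots> = ?hi ** (?Xi ** A ** ?Xi ** B ** ?h)"
    by (simp add: hh matrix_inv_left_right[OF inv(1)] matrix_mul_assoc)
  moreover have "trace (?hi ** (?Xi ** A ** ?Xi ** B ** ?h)) = trace (?Xi ** A ** ?Xi ** B)"
    by (subst trace_mul_sym) (simp add: hh flip: matrix_mul_assoc)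
  ultimately show "weil_petersson (g ** X ** ?h) (g ** A ** ?h) (g ** B ** ?h) = weil_petersson X A B"
    by (simp add: weil_petersson_eq det_mul g)
qed

section \<open>Flat 2-tori\<close>

text \<open>The Gram matrix of the basis \<open>1, z\<close> after rescaling to unit area.\<close>

definition plane_spd :: "complex \<Rightarrow> real^2^2" where
  "plane_spd z = vector [vector [1 / Im z, Re z / Im z], vector [Re z / Im z, (Re z)\<^sup>2 / Im z + Im z]]"

text \<open>The inverse of \<open>plane_spd\<close>, read off the first row: the (1,1) entry is 1 /
  Im z and the (1,2) entry is Re z / Im z.\<close>

definition spd_plane :: "real^2^2 \<Rightarrow> complex" where
  "spd_plane X = Complex (X $ 1 $ 2 / X $ 1 $ 1) (1 / X $ 1 $ 1)"

lemma quadratic_form_2: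
  fixes X :: "real^2^2"
  shows "u \<bullet> (X *v u) = X $ 1 $ 1 * (u $ 1)\<^sup>2 + (X $ 1 $ 2 + X $ 2 $ 1) * (u $ 1 * u $ 2) + X $ 2 $ 2 * (u $ 2)\<^sup>2"
  by (simp add: inner_vec_def matrix_vector_mult_def sum_2 power2_eq_square algebra_simps)

lemma quadratic_form_plane_spd:
  assumes "0 < Im z"
  shows "u \<bullet> (plane_spd z *v u) = ((u $ 1 + Re z * u $ 2)\<^sup>2 + (Im z * u $ 2)\<^sup>2) / Im z"
  using assms unfolding quadratic_form_2 by (simp add: plane_spd_def field_simps power2_eq_square)

lemma plane_spd_in_spd_space:
  assumes z: "z \<in> upper_half_plane"
  shows "plane_spd z \<in> spd_space"
proof -
  have y: "0 < Im z" using z by (simp add: upper_half_plane_def)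
  have "0 < u \<bullet> (plane_spd z *v u)" if "u \<noteq> 0" for u
  proof (cases "u $ 2 = 0")
    case True
    then have "u $ 1 \<noteq> 0" using that by (simp add: vec_eq_iff forall_2)
    then show ?thesis using True y by (simp add: quadratic_form_plane_spd)
  next
    case False
    then show ?thesis using y
      by (simp add: quadratic_form_plane_spd) (intro divide_pos_pos add_nonneg_pos; simp)
  qed
  moreover have "det (plane_spd z) = 1" using y by (simp add: det_2 plane_spd_def field_simps power2_eq_square)
  ultimately show ?thesis
    by (simp add: spd_space_def) (simp add: plane_spd_def transpose_def vec_eq_iff forall_2)
qed

text \<open>Symmetry and determinant 1 recover the second row from the first.\<close>

lemma plane_spd_spd_plane:
  assumes X: "X \<in> spd_space"
  shows "spd_plane X \<in> upper_half_plane" "plane_spd (spd_plane X) = X"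
proof -
  have "0 < axis 1 1 \<bullet> (X *v axis 1 1)" using X by (simp add: spd_space_def axis_eq_0_iff)
  then have a: "0 < X $ 1 $ 1" unfolding quadratic_form_2 by (simp add: axis_def)
  then show "spd_plane X \<in> upper_half_plane" by (simp add: spd_plane_def upper_half_plane_def)
  have "transpose X = X" using X by (simp add: spd_space_def)
  from arg_cong[OF this, of "\<lambda>A. A $ 1 $ 2"] have s: "X $ 2 $ 1 = X $ 1 $ 2" by (simp add: transpose_def)
  have "det X = 1" using X by (simp add: spd_space_def)
  then have "X $ 1 $ 1 * X $ 2 $ 2 = 1 + (X $ 1 $ 2)\<^sup>2" by (simp add: det_2 s power2_eq_square)
  then have "(X $ 1 $ 2)\<^sup>2 = X $ 1 $ 1 * X $ 2 $ 2 - 1" by simp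
  then have "(X $ 1 $ 2)\<^sup>2 / X $ 1 $ 1 = X $ 2 $ 2 - 1 / X $ 1 $ 1" using a by (simp add: diff_divide_distrib)
  then have "(X $ 1 $ 2 / X $ 1 $ 1)\<^sup>2 * X $ 1 $ 1 + 1 / X $ 1 $ 1 = X $ 2 $ 2" using a by (simp add: power2_eq_square)
  then show "plane_spd (spd_plane X) = X" using a s by (simp add: plane_spd_def spd_plane_def vec_eq_iff forall_2)
qed

lemma spd_plane_plane_spd: "z \<in> upper_half_plane \<Longrightarrow> spd_plane (plane_spd z) = z"
  by (simp add: upper_half_plane_def plane_spd_def spd_plane_def complex_eq_iff)

lemma bij_betw_plane_spd: "bij_betw plane_spd upper_half_plane spd_space"
  by (rule bij_betw_byWitness[where f' = spd_plane])
    (auto simp: spd_plane_plane_spd plane_spd_spd_plane plane_spd_in_spd_space)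

text \<open>The derivative of \<^const>\<open>plane_spd\<close> at \<open>z\<close> in the direction \<open>v\<close>.\<close>

definition plane_tangent :: "complex \<Rightarrow> complex \<Rightarrow> real^2^2" where
  "plane_tangent z v = (let b = Re v / Im z - Re z * Im v / (Im z)\<^sup>2 in
     vector [vector [- Im v / (Im z)\<^sup>2, b], vector [b, 2 * Re z * Re v / Im z - (Re z)\<^sup>2 * Im v / (Im z)\<^sup>2 + Im v]])"

text \<open>In the complex variable w, which depends linearly on u, the form of
  \<open>plane_spd z\<close> is a multiple of the squared modulus of w, while the tangent form is
  linear in w^2; the Rayleigh quotient becomes a Cauchy-Schwarz problem.\<close>

lemma quadratic_form_plane_tangent:
  fixes u :: "real^2" and z v :: complex
  defines "w \<equiv> Complex (Im z * u $ 2) (u $ 1 + Re z * u $ 2)"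
  assumes "0 < Im z"
  shows "u \<bullet> (plane_tangent z v *v u) = (cnj (w\<^sup>2) \<bullet> (Complex (Im v) (- Re v))) / (Im z)\<^sup>2"
  using assms(2) unfolding quadratic_form_2 w_def
  by (simp add: plane_tangent_def Let_def inner_complex_def field_simps power2_eq_square)

text \<open>As w runs through the unit circle so does w^2, hence the pairing with -i v attains the
  modulus of v.\<close>

lemma rayleigh_plane:
  assumes z: "z \<in> upper_half_plane"
  shows "rayleigh (plane_spd z) (plane_tangent z v) = cmod v / Im z"
proof -
  have y: "0 < Im z" using z by (simp add: upper_half_plane_def)
  have pd: "posdef (plane_spd z)" using plane_spd_in_spd_space[OF z] by (simp add: spd_space_iff)
  define v' where "v' = Complex (Im v) (- Re v)"
  have nv: "norm v' = cmod v" by (simp add: v'_def cmod_def add.commute)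
  define W where "W u = Complex (Im z * u $ 2) (u $ 1 + Re z * u $ 2)" for u :: "real^2"
  have X: "u \<bullet> (plane_spd z *v u) = (norm (W u))\<^sup>2 / Im z" for u
    by (simp add: quadratic_form_plane_spd[OF y] W_def cmod_power2 add.commute)
  have A: "u \<bullet> (plane_tangent z v *v u) = (cnj ((W u)\<^sup>2) \<bullet> v') / (Im z)\<^sup>2" for u
    unfolding quadratic_form_plane_tangent[OF y] W_def v'_def ..
  \<comment> \<open>a square root realizes equality in the Cauchy--Schwarz inequality below\<close>
  obtain w where w: "w \<noteq> 0" "cnj (w\<^sup>2) \<bullet> v' = (norm w)\<^sup>2 * norm v'"
  proof (cases "v' = 0")
    case True
    then show thesis using that[of 1] by simp
  next
    case False
    have "csqrt (cnj v') \<noteq> 0" using False by simp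
    moreover have "cnj ((csqrt (cnj v'))\<^sup>2) = v'" by simp
    moreover have "(norm (csqrt (cnj v')))\<^sup>2 = norm v'" by (simp flip: norm_power)
    moreover have "v' \<bullet> v' = norm v' * norm v'" by (simp add: dot_square_norm power2_eq_square)
    ultimately show thesis using that[of "csqrt (cnj v')"] by simp
  qed
  \<comment> \<open>The preimage of the maximizing w under the linear substitution
    \<open>W\<close>.\<close>
  define u0 :: "real^2" where "u0 = vector [Im w - Re z * (Re w / Im z), Re w / Im z]"
  have W0: "W u0 = w" using y by (simp add: W_def u0_def complex_eq_iff)
  show ?thesis
  proof (rule rayleigh_eqI[OF pd])
    fix u
    have "cnj ((W u)\<^sup>2) \<bullet> v' \<le> (norm (W u))\<^sup>2 * cmod v"
      using norm_cauchy_schwarz[of "cnj ((W u)\<^sup>2)" v'] by (simp add: norm_power nv)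
    then show "u \<bullet> (plane_tangent z v *v u) \<le> cmod v / Im z * (u \<bullet> (plane_spd z *v u))"
      unfolding X A using y by (simp add: field_simps power2_eq_square)
  next
    have "W 0 = 0" by (simp add: W_def complex_eq_iff)
    then show "u0 \<noteq> 0" using W0 w(1) by metis
    show "u0 \<bullet> (plane_tangent z v *v u0) = cmod v / Im z * (u0 \<bullet> (plane_spd z *v u0))"
      unfolding X A W0 w(2) nv by (simp add: field_simps power2_eq_square)
  qed
qed

lemma weil_petersson_plane:
  assumes z: "z \<in> upper_half_plane"
  shows "sqrt (weil_petersson (plane_spd z) (plane_tangent z v) (plane_tangent z v)) = sqrt 2 * (cmod v / Im z)"
proof -
  have y: "0 < Im z" using z by (simp add: upper_half_plane_def)
  let ?X = "plane_spd z" and ?A = "plane_tangent z v"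
  \<comment> \<open>The adjugate, which is the inverse because the determinant is 1.\<close>
  define J :: "real^2^2" where "J = vector [vector [?X $ 2 $ 2, - ?X $ 1 $ 2], vector [- ?X $ 1 $ 2, ?X $ 1 $ 1]]"
  have inv: "matrix_inv ?X = J"
    using y by (intro matrix_inv_unique)
      (simp add: J_def plane_spd_def vec_eq_iff forall_2 matrix_matrix_mult_def mat_def sum_2 field_simps power2_eq_square)
  define N :: "real^2^2" where "N = J ** ?A"
  \<comment> \<open>\<open>N\<close> is traceless with determinant minus the squared hyperbolic norm
    of v, so the trace of its square is twice that norm squared; this is the source of the factor
    sqrt 2.\<close>
  have N: "N $ 1 $ 1 = - Re v * Re z / (Im z)\<^sup>2 - Im v / Im z" "N $ 2 $ 2 = - N $ 1 $ 1"
    "N $ 1 $ 2 * N $ 2 $ 1 = ((Re v)\<^sup>2 + (Im v)\<^sup>2) / (Im z)\<^sup>2 - (N $ 1 $ 1)\<^sup>2"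
    using y by (simp_all add: N_def J_def plane_spd_def plane_tangent_def Let_def matrix_matrix_mult_def sum_2
      field_simps power2_eq_square)
  have "matrix_inv ?X ** ?A ** matrix_inv ?X ** ?A = N ** N" by (simp add: inv N_def matrix_mul_assoc)
  moreover have "trace (N ** N) = (N $ 1 $ 1)\<^sup>2 + 2 * (N $ 1 $ 2 * N $ 2 $ 1) + (N $ 2 $ 2)\<^sup>2"
    by (simp add: trace_def sum_2 matrix_matrix_mult_def power2_eq_square)
  ultimately have "weil_petersson ?X ?A ?A = 2 * (cmod v / Im z)\<^sup>2"
    using plane_spd_in_spd_space[OF z] by (simp add: weil_petersson_eq spd_space_def N(2,3) power_divide cmod_power2)
  then show ?thesis using y by (simp add: real_sqrt_mult real_sqrt_divide)
qed

lemma tau_matrix_det: "0 < Im \<tau> \<Longrightarrow> det (tau_matrix \<tau>) = 1"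
  by (simp add: tau_matrix_def det_2 field_simps flip: power2_eq_square)

lemma matrix_torus_tau_matrix:
  assumes \<tau>: "\<tau> \<in> upper_half_plane"
  shows "matrix_torus (tau_matrix \<tau>) \<in> marked_tori" "gram (matrix_torus (tau_matrix \<tau>)) = plane_spd \<tau>"
proof -
  have y: "0 < Im \<tau>" using \<tau> by (simp add: upper_half_plane_def)
  define r where "r = 1 / sqrt (Im \<tau>)"
  have r: "0 < r" "r\<^sup>2 = 1 / Im \<tau>" using y by (simp_all add: r_def power_divide)
  have M: "tau_matrix \<tau> = vector [vector [r, r * Re \<tau>], vector [0, r * Im \<tau>]]"
    by (simp add: tau_matrix_def r_def vec_eq_iff forall_2)
  \<comment> \<open>\<open>tau_matrix\<close> is upper triangular with positive diagonal, and so is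
    every convex combination with the identity; the equation is solved from the second coordinate
    upwards.\<close>
  have seg: "v = 0" if t: "0 \<le> t" "t \<le> 1" and eq: "(1 - t) *\<^sub>R v + t *\<^sub>R (tau_matrix \<tau> *v v) = 0" for t v
  proof -
    have pos: "0 < (1 - t) + t * c" if "0 < c" for c
      using t that by (cases "t = 1") (auto intro: add_pos_nonneg)
    have c: "(1 - t) * v $ i + t * (tau_matrix \<tau> *v v) $ i = 0" for i using eq by (simp add: vec_eq_iff)
    have "((1 - t) + t * (r * Im \<tau>)) * v $ 2 = 0"
      using c[of 2] by (simp add: M matrix_vector_mult_def sum_2 algebra_simps)
    then have v2: "v $ 2 = 0" using pos[of "r * Im \<tau>"] r y by simp
    have "((1 - t) + t * r) * v $ 1 = 0"
      using c[of 1] v2 by (simp add: M matrix_vector_mult_def sum_2 algebra_simps)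
    then have "v $ 1 = 0" using pos[of r] r by simp
    with v2 show ?thesis by (simp add: vec_eq_iff forall_2)
  qed
  have d: "\<bar>det (tau_matrix \<tau>)\<bar> = 1" by (simp add: tau_matrix_det[OF y])
  note * = matrix_torus_marked[OF d seg]
  show "matrix_torus (tau_matrix \<tau>) \<in> marked_tori" by (rule *(1))
  have "r * r = 1 / Im \<tau>" using r(2) by (simp add: power2_eq_square)
  moreover have "transpose (tau_matrix \<tau>) ** tau_matrix \<tau>
    = (r * r) *\<^sub>R vector [vector [1, Re \<tau>], vector [Re \<tau>, (Re \<tau>)\<^sup>2 + (Im \<tau>)\<^sup>2]]"
    by (simp add: M vec_eq_iff forall_2 matrix_matrix_mult_def transpose_def sum_2 power2_eq_square algebra_simps)
  ultimately show "gram (matrix_torus (tau_matrix \<tau>)) = plane_spd \<tau>"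
    using y by (simp add: gram_def *(2) plane_spd_def vec_eq_iff forall_2 add_divide_distrib power2_eq_square)
qed

lemma tau_class:
  assumes \<tau>: "\<tau> \<in> upper_half_plane"
  shows "tau_class \<tau> \<in> teich" "teich_to_spd (tau_class \<tau>) = plane_spd \<tau>"
proof -
  have eq: "tau_class \<tau> = marking_equiv `` {matrix_torus (tau_matrix \<tau>)}" by (simp add: tau_class_def matrix_torus_def)
  show "tau_class \<tau> \<in> teich" unfolding eq teich_def using matrix_torus_tau_matrix(1)[OF \<tau>] by (rule quotientI)
  show "teich_to_spd (tau_class \<tau>) = plane_spd \<tau>"
    unfolding eq teich_to_spd_class[OF matrix_torus_tau_matrix(1)[OF \<tau>]] by (rule matrix_torus_tau_matrix(2)[OF \<tau>])
qed

theorem bij_betw_tau_class: "bij_betw tau_class upper_half_plane teich"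
proof -
  have "bij_betw (inv_into teich teich_to_spd \<circ> plane_spd) upper_half_plane teich"
    by (rule bij_betw_trans[OF bij_betw_plane_spd bij_betw_inv_into[OF bij_betw_teich_to_spd]])
  moreover have "(inv_into teich teich_to_spd \<circ> plane_spd) \<tau> = tau_class \<tau>" if "\<tau> \<in> upper_half_plane" for \<tau>
    using inv_into_f_eq[OF bij_betw_imp_inj_on[OF bij_betw_teich_to_spd] tau_class[OF that]] by simp
  ultimately show ?thesis by (simp cong: bij_betw_cong)
qed

text \<open>Two exponents with sum zero are opposite, so negating them does not change their
  maximum.\<close>

lemma rayleigh_dist_commute_2:
  fixes X Y :: "real^2^2"
  assumes "X \<in> spd_space" "Y \<in> spd_space"
  shows "rayleigh_dist X Y = rayleigh_dist Y X"
proof -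
  obtain g :: "real^2^2" and l where gl: "invertible g" "X = flat_point g (\<lambda>_. 0)" "Y = flat_point g l" "(\<Sum>i\<in>UNIV. l i) = 0"
    using assms by (rule spd_pairE)
  have "l 2 = - l 1" using gl(4) by (simp add: sum_2)
  then show ?thesis unfolding rayleigh_dist_def gl(2,3) ln_rayleigh_flat_point[OF gl(1)]
    by (simp add: UNIV_2 max.commute)
qed

section \<open>Transport of paths between the half-plane and the space of matrices\<close>

lemma has_vector_derivative_componentwise:
  fixes f :: "real \<Rightarrow> 'a::euclidean_space"
  shows "(f has_vector_derivative D) (at t within S) \<longleftrightarrow>
    (\<forall>b\<in>Basis. ((\<lambda>t. f t \<bullet> b) has_real_derivative D \<bullet> b) (at t within S))"
  unfolding has_vector_derivative_def has_field_derivative_def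
  by (subst has_derivative_componentwise_within) (simp add: mult.commute[of _ "D \<bullet> _"])

lemma has_vector_derivative_matrix:
  fixes f :: "real \<Rightarrow> real^'n^'m"
  shows "(f has_vector_derivative D) (at t within S) \<longleftrightarrow>
    (\<forall>i j. ((\<lambda>t. f t $ i $ j) has_real_derivative D $ i $ j) (at t within S))"
  unfolding has_vector_derivative_componentwise by (simp add: Basis_vec_def inner_axis)

lemma has_vector_derivative_complex:
  fixes f :: "real \<Rightarrow> complex"
  shows "(f has_vector_derivative D) (at t within S) \<longleftrightarrow>
    ((\<lambda>t. Re (f t)) has_real_derivative Re D) (at t within S) \<and>
    ((\<lambda>t. Im (f t)) has_real_derivative Im D) (at t within S)"
  unfolding has_vector_derivative_componentwise by (simp add: Basis_complex_def inner_complex_def)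

lemma continuous_on_matrix:
  fixes f :: "'a::t2_space \<Rightarrow> real^'n^'m"
  shows "continuous_on S f \<longleftrightarrow> (\<forall>i j. continuous_on S (\<lambda>t. f t $ i $ j))"
  by (subst continuous_on_componentwise) (simp add: Basis_vec_def inner_axis)

lemma plane_spd_has_vector_derivative:
  assumes \<gamma>: "(\<gamma> has_vector_derivative D) (at t within S)" and y: "0 < Im (\<gamma> t)"
  shows "((\<lambda>t. plane_spd (\<gamma> t)) has_vector_derivative plane_tangent (\<gamma> t) D) (at t within S)"
proof -
  note d[derivative_intros] = \<gamma>[unfolded has_vector_derivative_complex, THEN conjunct1]
    \<gamma>[unfolded has_vector_derivative_complex, THEN conjunct2]
  have "((\<lambda>t. 1 / Im (\<gamma> t)) has_real_derivative - Im D / (Im (\<gamma> t))\<^sup>2) (at t within S)"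
    using y by (auto intro!: derivative_eq_intros simp: power2_eq_square)
  moreover have "((\<lambda>t. Re (\<gamma> t) / Im (\<gamma> t)) has_real_derivative Re D / Im (\<gamma> t) - Re (\<gamma> t) * Im D / (Im (\<gamma> t))\<^sup>2) (at t within S)"
    using y by (auto intro!: derivative_eq_intros simp: power2_eq_square field_simps)
  moreover have "((\<lambda>t. (Re (\<gamma> t))\<^sup>2 / Im (\<gamma> t) + Im (\<gamma> t)) has_real_derivative
      2 * Re (\<gamma> t) * Re D / Im (\<gamma> t) - (Re (\<gamma> t))\<^sup>2 * Im D / (Im (\<gamma> t))\<^sup>2 + Im D) (at t within S)"
    using y by (auto intro!: derivative_eq_intros simp: power2_eq_square field_simps)
  ultimately show ?thesis
    unfolding has_vector_derivative_matrix by (simp add: forall_2 plane_spd_def plane_tangent_def Let_def)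
qed

lemma spd_plane_has_vector_derivative:
  assumes \<gamma>: "(\<gamma> has_vector_derivative D) (at t within S)" and a: "\<gamma> t $ 1 $ 1 \<noteq> 0"
  shows "((\<lambda>t. spd_plane (\<gamma> t)) has_vector_derivative
    Complex (D $ 1 $ 2 / \<gamma> t $ 1 $ 1 - \<gamma> t $ 1 $ 2 * D $ 1 $ 1 / (\<gamma> t $ 1 $ 1)\<^sup>2) (- D $ 1 $ 1 / (\<gamma> t $ 1 $ 1)\<^sup>2)) (at t within S)"
proof -
  note d[derivative_intros] = \<gamma>[unfolded has_vector_derivative_matrix, rule_format, of 1 1]
    \<gamma>[unfolded has_vector_derivative_matrix, rule_format, of 1 2]
  have "((\<lambda>t. 1 / \<gamma> t $ 1 $ 1) has_real_derivative - D $ 1 $ 1 / (\<gamma> t $ 1 $ 1)\<^sup>2) (at t within S)"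
    using a by (auto intro!: derivative_eq_intros simp: power2_eq_square)
  moreover have "((\<lambda>t. \<gamma> t $ 1 $ 2 / \<gamma> t $ 1 $ 1) has_real_derivative
      D $ 1 $ 2 / \<gamma> t $ 1 $ 1 - \<gamma> t $ 1 $ 2 * D $ 1 $ 1 / (\<gamma> t $ 1 $ 1)\<^sup>2) (at t within S)"
    using a by (auto intro!: derivative_eq_intros simp: power2_eq_square field_simps)
  ultimately show ?thesis by (simp add: has_vector_derivative_complex spd_plane_def)
qed

lemma Inf_scaled:
  fixes S :: "real set"
  assumes "0 < c" "S \<noteq> {}" "bdd_below S"
  shows "Inf ((*) c ` S) = c * Inf S"
  using assms by (intro continuous_at_Inf_mono[symmetric]) (auto intro!: monoI mult_left_mono continuous_intros)

text \<open>\<open>plane_spd\<close> and \<open>spd_plane\<close> carry C1 paths to C1 paths in both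
  directions, and lengths scale by \<open>c\<close>; hence the two sets of lengths correspond and so
  do their infima.\<close>

lemma path_dist_plane:
  fixes G :: "real^2^2 \<Rightarrow> real^2^2 \<Rightarrow> real"
  assumes c: "0 < c"
    and G: "\<And>z v. z \<in> upper_half_plane \<Longrightarrow> G (plane_spd z) (plane_tangent z v) = c * (cmod v / Im z)"
    and \<sigma>: "\<sigma> \<in> upper_half_plane" and \<tau>: "\<tau> \<in> upper_half_plane"
  shows "path_dist spd_space G (plane_spd \<sigma>) (plane_spd \<tau>) = c * hyperbolic_dist \<sigma> \<tau>"
proof -
  let ?len = "\<lambda>F \<gamma>. integral {0..1} (\<lambda>t. F (\<gamma> t) (vector_derivative \<gamma> (at t)))"
  let ?h = "\<lambda>z v. cmod v / Im z"
  define S where "S = {?len ?h \<gamma> |\<gamma>. \<gamma> C1_differentiable_on {0..1} \<and> \<gamma> ` {0..1} \<subseteq> upper_half_plane \<and> \<gamma> 0 = \<sigma> \<and> \<gamma> 1 = \<tau>}"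
  define T where "T = {?len G \<gamma> |\<gamma>. \<gamma> C1_differentiable_on {0..1} \<and> \<gamma> ` {0..1} \<subseteq> spd_space \<and> \<gamma> 0 = plane_spd \<sigma> \<and> \<gamma> 1 = plane_spd \<tau>}"
  have len_eq: "?len G \<gamma> = c * ?len ?h \<delta>"
    if "\<And>t. t \<in> {0..1} \<Longrightarrow> \<gamma> t = plane_spd (\<delta> t) \<and> \<delta> t \<in> upper_half_plane \<and>
      vector_derivative \<gamma> (at t) = plane_tangent (\<delta> t) (vector_derivative \<delta> (at t))" for \<gamma> \<delta>
  proof -
    have "?len G \<gamma> = integral {0..1} (\<lambda>t. c * ?h (\<delta> t) (vector_derivative \<delta> (at t)))"
      using that by (intro integral_cong) (simp add: G)
    then show ?thesis by (simp only: integral_mult_right)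
  qed
  have len_spd: "c * ?len ?h \<delta> \<in> T"
    if \<delta>: "\<delta> C1_differentiable_on {0..1}" "\<delta> ` {0..1} \<subseteq> upper_half_plane" "\<delta> 0 = \<sigma>" "\<delta> 1 = \<tau>" for \<delta>
  proof -
    obtain D where D: "\<And>t. t \<in> {0..1} \<Longrightarrow> (\<delta> has_vector_derivative D t) (at t)" "continuous_on {0..1} D"
      using \<delta>(1) unfolding C1_differentiable_on_def by blast
    have H: "\<delta> t \<in> upper_half_plane" if "t \<in> {0..1}" for t using \<delta>(2) that by blast
    have y: "0 < Im (\<delta> t)" if "t \<in> {0..1}" for t using H[OF that] by (simp add: upper_half_plane_def)
    have d: "((\<lambda>t. plane_spd (\<delta> t)) has_vector_derivative plane_tangent (\<delta> t) (D t)) (at t)" if "t \<in> {0..1}" for t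
      using D(1)[OF that] y[OF that] by (rule plane_spd_has_vector_derivative)
    have "continuous_on {0..1} (\<lambda>t. plane_tangent (\<delta> t) (D t))"
      unfolding continuous_on_matrix forall_2 plane_tangent_def Let_def
      using y by (auto intro!: continuous_intros D(2) C1_differentiable_imp_continuous_on[OF \<delta>(1)] simp: less_imp_neq[symmetric])
    then have "(\<lambda>t. plane_spd (\<delta> t)) C1_differentiable_on {0..1}"
      unfolding C1_differentiable_on_def by (intro exI conjI ballI) (erule d)
    moreover have "?len G (\<lambda>t. plane_spd (\<delta> t)) = c * ?len ?h \<delta>"
      using H by (intro len_eq) (simp add: vector_derivative_at[OF d] vector_derivative_at[OF D(1)])
    ultimately show ?thesis unfolding T_def using plane_spd_in_spd_space[OF H] \<delta>(3,4)
      by (intro CollectI exI[of _ "\<lambda>t. plane_spd (\<delta> t)"]) auto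
  qed
  have len_plane: "?len G \<gamma> \<in> (*) c ` S"
    if \<gamma>: "\<gamma> C1_differentiable_on {0..1}" "\<gamma> ` {0..1} \<subseteq> spd_space" "\<gamma> 0 = plane_spd \<sigma>" "\<gamma> 1 = plane_spd \<tau>" for \<gamma>
  proof -
    obtain D where D: "\<And>t. t \<in> {0..1} \<Longrightarrow> (\<gamma> has_vector_derivative D t) (at t)" "continuous_on {0..1} D"
      using \<gamma>(1) unfolding C1_differentiable_on_def by blast
    define \<delta> where "\<delta> t = spd_plane (\<gamma> t)" for t
    define E where "E t = Complex (D t $ 1 $ 2 / \<gamma> t $ 1 $ 1 - \<gamma> t $ 1 $ 2 * D t $ 1 $ 1 / (\<gamma> t $ 1 $ 1)\<^sup>2)
      (- D t $ 1 $ 1 / (\<gamma> t $ 1 $ 1)\<^sup>2)" for t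
    have spd: "\<gamma> t \<in> spd_space" if "t \<in> {0..1}" for t using \<gamma>(2) that by blast
    have H: "\<delta> t \<in> upper_half_plane" and eq: "\<gamma> t = plane_spd (\<delta> t)" if "t \<in> {0..1}" for t
      using plane_spd_spd_plane[OF spd[OF that]] by (simp_all add: \<delta>_def)
    have y: "0 < Im (\<delta> t)" if "t \<in> {0..1}" for t using H[OF that] by (simp add: upper_half_plane_def)
    have a: "\<gamma> t $ 1 $ 1 \<noteq> 0" if "t \<in> {0..1}" for t using y[OF that] by (auto simp: \<delta>_def spd_plane_def)
    have d: "(\<delta> has_vector_derivative E t) (at t)" if "t \<in> {0..1}" for t
      unfolding \<delta>_def[abs_def] E_def using D(1)[OF that] a[OF that] by (rule spd_plane_has_vector_derivative)
    have "continuous_on {0..1} E"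
      unfolding E_def[abs_def] complex_eq_cancel_iff2 Complex_eq
      using a by (auto intro!: continuous_intros D(2) C1_differentiable_imp_continuous_on[OF \<gamma>(1)])
    then have C1: "\<delta> C1_differentiable_on {0..1}" unfolding C1_differentiable_on_def by (intro exI conjI ballI) (erule d)
    \<comment> \<open>The path agrees with its image under \<open>plane_spd\<close> only on the unit
      interval, so derivatives are compared within the interval, where they are still
      unique.\<close>
    have DE: "D t = plane_tangent (\<delta> t) (E t)" if t: "t \<in> {0..1}" for t
    proof (rule vector_derivative_unique_within_closed_interval[of 0 1 t \<gamma>])
      show "(\<gamma> has_vector_derivative D t) (at t within cbox 0 1)"
        using D(1)[OF t] by (rule has_vector_derivative_at_within)
      have "((\<lambda>t. plane_spd (\<delta> t)) has_vector_derivative plane_tangent (\<delta> t) (E t)) (at t within cbox 0 1)"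
        using plane_spd_has_vector_derivative[OF d[OF t] y[OF t]] by (rule has_vector_derivative_at_within)
      then show "(\<gamma> has_vector_derivative plane_tangent (\<delta> t) (E t)) (at t within cbox 0 1)"
        by (rule has_vector_derivative_transform[rotated 2]) (use t eq in auto)
    qed (use t in auto)
    have "?len G \<gamma> = c * ?len ?h \<delta>"
      using H eq by (intro len_eq) (simp add: vector_derivative_at[OF d] vector_derivative_at[OF D(1)] DE)
    moreover have "?len ?h \<delta> \<in> S" unfolding S_def using C1 H \<gamma>(3,4)
      by (intro CollectI exI[of _ \<delta>]) (auto simp: \<delta>_def spd_plane_plane_spd \<sigma> \<tau>)
    ultimately show ?thesis by (rule image_eqI)
  qed
  have TS: "T = (*) c ` S"
  proof
    show "(*) c ` S \<subseteq> T" unfolding S_def by clarify (rule len_spd; (assumption | erule sym))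
    show "T \<subseteq> (*) c ` S" unfolding T_def by clarify (rule len_plane; (assumption | erule sym))
  qed
  \<comment> \<open>The upper half-plane is convex, so the straight segment shows that the set of
    lengths is nonempty.\<close>
  have "?len ?h (\<lambda>t. \<sigma> + t *\<^sub>R (\<tau> - \<sigma>)) \<in> S"
  proof -
    have "0 < Im \<sigma> + t * (Im \<tau> - Im \<sigma>)" if "0 \<le> t" "t \<le> 1" for t
    proof -
      have "0 < (1 - t) * Im \<sigma> + t * Im \<tau>"
        using that \<sigma> \<tau> by (cases "t = 0") (auto simp: upper_half_plane_def intro: add_nonneg_pos)
      then show ?thesis by (simp add: algebra_simps)
    qed
    then have "(\<lambda>t. \<sigma> + t *\<^sub>R (\<tau> - \<sigma>)) ` {0..1} \<subseteq> upper_half_plane" by (auto simp: upper_half_plane_def)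
    moreover have "(\<lambda>t. \<sigma> + t *\<^sub>R (\<tau> - \<sigma>)) C1_differentiable_on {0..1}"
      unfolding C1_differentiable_on_def
      by (rule exI[of _ "\<lambda>_. \<tau> - \<sigma>"]) (auto intro!: derivative_eq_intros)
    ultimately show ?thesis unfolding S_def by (intro CollectI exI[of _ "\<lambda>t. \<sigma> + t *\<^sub>R (\<tau> - \<sigma>)"]) auto
  qed
  then have "S \<noteq> {}" by blast
  moreover have "0 \<le> s" if "s \<in> S" for s
  proof -
    obtain \<gamma> where \<gamma>: "s = ?len ?h \<gamma>" "\<gamma> ` {0..1} \<subseteq> upper_half_plane" using \<open>s \<in> S\<close> unfolding S_def by blast
    have "0 \<le> ?h (\<gamma> t) (vector_derivative \<gamma> (at t))" if "t \<in> {0..1}" for t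
      using subsetD[OF \<gamma>(2), of "\<gamma> t"] that by (simp add: upper_half_plane_def)
    then show ?thesis unfolding \<gamma>(1)
      \<comment> \<open>A function that is not integrable has integral 0 by convention, so the lower
        bound 0 holds in either case.\<close>
      by (cases "(\<lambda>t. ?h (\<gamma> t) (vector_derivative \<gamma> (at t))) integrable_on {0..1}")
        (auto intro: Henstock_Kurzweil_Integration.integral_nonneg simp: not_integrable_integral)
  qed
  then have "bdd_below S" by (rule bdd_belowI)
  ultimately have "Inf T = c * Inf S" unfolding TS by (rule Inf_scaled[OF c])
  then show ?thesis unfolding path_dist_def hyperbolic_dist_def S_def T_def .
qed

theorem plane_metrics:
  assumes \<sigma>: "\<sigma> \<in> upper_half_plane" and \<tau>: "\<tau> \<in> upper_half_plane"
  shows "thurston (tau_class \<sigma>) (tau_class \<tau>) = 1/4 * hyperbolic_dist \<sigma> \<tau>"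
    "teichmueller (tau_class \<sigma>) (tau_class \<tau>) = 1/4 * hyperbolic_dist \<sigma> \<tau>"
    "weil_petersson_dist (tau_class \<sigma>) (tau_class \<tau>) = sqrt 2 * hyperbolic_dist \<sigma> \<tau>"
proof -
  note spd = plane_spd_in_spd_space[OF \<sigma>] plane_spd_in_spd_space[OF \<tau>]
  have Th: "thurston (tau_class z) (tau_class w) = rayleigh_dist (plane_spd z) (plane_spd w)"
    if "z \<in> upper_half_plane" "w \<in> upper_half_plane" for z w
    using tau_class[OF that(1)] tau_class[OF that(2)] by (simp add: thurston_eq rayleigh_dist_def)
  have "path_dist spd_space rayleigh_finsler (plane_spd \<sigma>) (plane_spd \<tau>) = 1/4 * hyperbolic_dist \<sigma> \<tau>"
    using \<sigma> \<tau> by (intro path_dist_plane) (simp_all add: rayleigh_finsler_def rayleigh_plane)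
  then show *: "thurston (tau_class \<sigma>) (tau_class \<tau>) = 1/4 * hyperbolic_dist \<sigma> \<tau>"
    unfolding Th[OF \<sigma> \<tau>] path_dist_rayleigh_finsler[OF spd] .
  have "thurston (tau_class \<tau>) (tau_class \<sigma>) = thurston (tau_class \<sigma>) (tau_class \<tau>)"
    unfolding Th[OF \<sigma> \<tau>] Th[OF \<tau> \<sigma>] by (rule rayleigh_dist_commute_2[OF spd(2,1)])
  then show "teichmueller (tau_class \<sigma>) (tau_class \<tau>) = 1/4 * hyperbolic_dist \<sigma> \<tau>"
    using * by (simp add: teichmueller_eq tau_class(1) \<sigma> \<tau>)
  show "weil_petersson_dist (tau_class \<sigma>) (tau_class \<tau>) = sqrt 2 * hyperbolic_dist \<sigma> \<tau>"
    unfolding weil_petersson_dist_def tau_class(2)[OF \<sigma>] tau_class(2)[OF \<tau>]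
    using \<sigma> \<tau> by (intro path_dist_plane) (simp_all add: weil_petersson_plane)
qed

theorem theorem1p1:
  shows
    "(bij_betw tau_class upper_half_plane (teich :: 2 marked_torus set set) \<and>
      (\<forall>\<sigma> \<in> upper_half_plane. \<forall>\<tau> \<in> upper_half_plane.
         thurston (tau_class \<sigma>) (tau_class \<tau>) = 1/4 * hyperbolic_dist \<sigma> \<tau> \<and>
         teichmueller (tau_class \<sigma>) (tau_class \<tau>) = 1/4 * hyperbolic_dist \<sigma> \<tau> \<and>
         weil_petersson_dist (tau_class \<sigma>) (tau_class \<tau>) = sqrt 2 * hyperbolic_dist \<sigma> \<tau>)) \<and>
     (CARD('n::finite) \<ge> 3 \<longrightarrow>
      bij_betw teich_to_spd (teich :: 'n marked_torus set set) spd_space \<and>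
      (let d_Th = on_spd thurston :: real^'n^'n \<Rightarrow> real^'n^'n \<Rightarrow> real;
           d_Teich = on_spd teichmueller :: real^'n^'n \<Rightarrow> real^'n^'n \<Rightarrow> real
       in asymmetric_metric spd_space d_Th \<and>
          (\<exists>F. polyhedral_finsler_metric F \<and>
             (\<forall>X \<in> spd_space. \<forall>Y \<in> spd_space. d_Th X Y = path_dist spd_space F X Y)) \<and>
          (\<forall>X \<in> spd_space. \<forall>Y \<in> spd_space.
             d_Th Y X = 1/4 * Max {ln (cmod l) |l. complex_eigenvalue (X ** matrix_inv Y) l}) \<and>
          (\<forall>X \<in> spd_space. \<forall>Y \<in> spd_space. d_Teich X Y = max (d_Th X Y) (d_Th Y X)) \<and>
          natural_riemannian_metric (weil_petersson :: real^'n^'n \<Rightarrow> real^'n^'n \<Rightarrow> real^'n^'n \<Rightarrow> real)))"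
proof (intro conjI ballI impI)
  show "bij_betw tau_class upper_half_plane teich" by (rule bij_betw_tau_class)
next
  assume n: "3 \<le> CARD('n)"
  show "bij_betw teich_to_spd (teich :: 'n marked_torus set set) spd_space" by (rule bij_betw_teich_to_spd)
  have Th: "on_spd thurston X Y = rayleigh_dist X Y" if "X \<in> spd_space" "Y \<in> spd_space" for X Y :: "real^'n^'n"
    using on_spd_thurston[OF that] by (simp add: rayleigh_dist_def)
  have "on_spd teichmueller X Y = max (rayleigh_dist X Y) (rayleigh_dist Y X)"
    if "X \<in> spd_space" "Y \<in> spd_space" for X Y :: "real^'n^'n"
    using that by (rule on_spd_teich) (simp add: teichmueller_eq thurston_eq rayleigh_dist_def)
  moreover have "asymmetric_metric (spd_space :: (real^'n^'n) set) (on_spd thurston)"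
    using asymmetric_metric_rayleigh_dist[OF n] by (simp add: asymmetric_metric_def Th cong: ball_cong bex_cong)
  moreover have "\<forall>X \<in> spd_space. \<forall>Y \<in> spd_space. on_spd thurston X Y = path_dist spd_space rayleigh_finsler X (Y :: real^'n^'n)"
    by (simp add: Th path_dist_rayleigh_finsler)
  ultimately show "let d_Th = on_spd thurston :: real^'n^'n \<Rightarrow> real^'n^'n \<Rightarrow> real;
           d_Teich = on_spd teichmueller :: real^'n^'n \<Rightarrow> real^'n^'n \<Rightarrow> real
       in asymmetric_metric spd_space d_Th \<and>
          (\<exists>F. polyhedral_finsler_metric F \<and>
             (\<forall>X \<in> spd_space. \<forall>Y \<in> spd_space. d_Th X Y = path_dist spd_space F X Y)) \<and>
          (\<forall>X \<in> spd_space. \<forall>Y \<in> spd_space.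
             d_Th Y X = 1/4 * Max {ln (cmod l) |l. complex_eigenvalue (X ** matrix_inv Y) l}) \<and>
          (\<forall>X \<in> spd_space. \<forall>Y \<in> spd_space. d_Teich X Y = max (d_Th X Y) (d_Th Y X)) \<and>
          natural_riemannian_metric (weil_petersson :: real^'n^'n \<Rightarrow> real^'n^'n \<Rightarrow> real^'n^'n \<Rightarrow> real)"
    unfolding Let_def using polyhedral_rayleigh_finsler natural_riemannian_metric_weil_petersson
    by (intro conjI ballI exI[of _ rayleigh_finsler]) (simp_all add: Th rayleigh_dist_eigenvalues)
qed (simp_all add: plane_metrics)

end
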